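(* Let $q,c,d$ be complex numbers with $|q|<1$, $|c|<1$ and $|d|<1$. Then $$\sigma(q)=\frac{(-c,-d)_{\infty}}{(-cd)_{\infty}}\sum_{n=0}^{\infty}\frac{(-cd)_n(1-cdq^{2n})q^{n(n+1)/2}}{(-q)_n(1-cq^n)(1-dq^n)}+\Lambda(c,d,q),$$ where $$\begin{aligned} \Lambda(c,d,q)=\;&1-\frac{3cd(-cq,-dq)_{\infty}}{(-cd,-q)_{\infty}}\sum_{n=0}^{\infty}\frac{(c,d,-cd)_n}{(-cq,-dq,q)_n}q^{\frac{n(n+1)}{2}+2n}\\ &-\frac{(-dq,c)_{\infty}}{(-cd,-q)_{\infty}}\sum_{p=0}^{\infty}\frac{(-q)_p(-1)_pc^p}{(q)_p}\sum_{k=0}^{\infty}\frac{(-q^{p+1})_kc^k}{(q^{p+1})_k}\\ &\qquad\times\sum_{n=0}^{\infty}\frac{(-cd,d)_n}{(-dq,q)_n}q^{\frac{n(n+1)}{2}+(p+k)n}\left(1+cdq^{2n}(1+q^{p})(1+q^{p+1})\right)\\ &-\frac{(d,c)_{\infty}}{(-cd,-q)_{\infty}}\sum_{p=1}^{\infty}\frac{(-q)_p(-1)_pd^p}{(q)_p}\sum_{k=0}^{\infty}\frac{(-q)_k(-q^p)_kc^k}{(q)_k}\sum_{j=0}^{\infty}\frac{(-q^{p+1})_jd^j}{(q^{p+1})_j}\\ &\qquad\times\sum_{n=0}^{\infty}\frac{(-cd)_n}{(q)_n}q^{\frac{n(n+1)}{2}+(p+k+j)n}\left(1+cdq^{2n}(1+q^{p+k})(1+q^{p+k+1})\right)\\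 &-2(d,c)_{\infty}\sum_{p=1}^{\infty}\frac{(-cd)^{p}}{(q)_p}\sum_{j=0}^{\infty}\frac{(-q)_jd^j}{(q)_j}\sum_{k=0}^{\infty}\frac{(-q)_kc^k}{(q)_k}\\ &\qquad\times\sum_{m=0}^{\infty}\frac{(-cd)^m}{(q^{p+1})_m(-q^{p+k+j})_{m+1}}\left(1+cd\,\frac{(1+q^{p+k+j})(1+q^{p+k+j+1})}{(1+q^{p+k+j+m+1})(1+q^{p+k+j+m+2})}\right). \end{aligned}$$
   Context: For complex $A$ and $|q|<1$: $(A)_0=1$, $(A)_n=(A;q)_n=(1-A)(1-Aq)\cdots(1-Aq^{n-1})$ for positive integers $n$, and $(A)_\infty=(A;q)_\infty=\lim_{n\to\infty}(A;q)_n$. Also $(A_1,\dots,A_m)_n=(A_1)_n\cdots(A_m)_n$ and $(A_1,\dots,A_m)_\infty=(A_1)_\infty\cdots(A_m)_\infty$; all $q$-shifted factorials have base $q$. Note that $(-cd)_n$ and $(-cd)_\infty$ with a subscript denote $q$-shifted factorials, whereas $(-cd)^p$, $(-cd)^m$ are ordinary powers. In $\Lambda$, within each product term, each sum extends over everything to its right up to the end of that term (nested sums). Ramanujan's function $\sigma(q)$ is defined by $$\sigma(q)=\sum_{n=0}^{\infty}\frac{q^{n(n+1)/2}}{(-q)_n}.$$ *)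

theory Defs
  imports "HOL-Analysis.Analysis"
begin

definition qpoch :: "complex \<Rightarrow> complex \<Rightarrow> nat \<Rightarrow> complex" where
  "qpoch A q n = (\<Prod>i<n. 1 - A * q ^ i)"

definition qpoch_inf :: "complex \<Rightarrow> complex \<Rightarrow> complex" where
  "qpoch_inf A q = lim (\<lambda>n. qpoch A q n)"

definition ramanujan_sigma :: "complex \<Rightarrow> complex" where
  "ramanujan_sigma q = (\<Sum>n. q ^ (n * (n + 1) div 2) / qpoch (-q) q n)"

(* The multi-parameter symbols (A_1, ..., A_m)_n and (A_1, ..., A_m)_\<infinity> are written out as
   products. Series over p \<ge> 1 are indexed by i \<ge> 0 with p = i + 1. For |q|, |c|, |d| < 1 all
   the iterated series below converge absolutely and no denominator vanishes. *)
definition Lambda_cdq :: "complex \<Rightarrow> complex \<Rightarrow> complex \<Rightarrow> complex" where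
  "Lambda_cdq c d q =
     1
     - 3 * c * d * (qpoch_inf (-(c * q)) q * qpoch_inf (-(d * q)) q)
         / (qpoch_inf (-(c * d)) q * qpoch_inf (-q) q)
       * (\<Sum>n. (qpoch c q n * qpoch d q n * qpoch (-(c * d)) q n)
                / (qpoch (-(c * q)) q n * qpoch (-(d * q)) q n * qpoch q q n)
                * q ^ (n * (n + 1) div 2 + 2 * n))
     - (qpoch_inf (-(d * q)) q * qpoch_inf c q)
         / (qpoch_inf (-(c * d)) q * qpoch_inf (-q) q)
       * (\<Sum>p. qpoch (-q) q p * qpoch (-1) q p * c ^ p / qpoch q q p
           * (\<Sum>k. qpoch (-(q ^ (p + 1))) q k * c ^ k / qpoch (q ^ (p + 1)) q k
               * (\<Sum>n. (qpoch (-(c * d)) q n * qpoch d q n)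
                        / (qpoch (-(d * q)) q n * qpoch q q n)
                        * q ^ (n * (n + 1) div 2 + (p + k) * n)
                        * (1 + c * d * q ^ (2 * n) * (1 + q ^ p) * (1 + q ^ (p + 1))))))
     - (qpoch_inf d q * qpoch_inf c q)
         / (qpoch_inf (-(c * d)) q * qpoch_inf (-q) q)
       * (\<Sum>i. let p = i + 1 in
           qpoch (-q) q p * qpoch (-1) q p * d ^ p / qpoch q q p
           * (\<Sum>k. qpoch (-q) q k * qpoch (-(q ^ p)) q k * c ^ k / qpoch q q k
               * (\<Sum>j. qpoch (-(q ^ (p + 1))) q j * d ^ j / qpoch (q ^ (p + 1)) q j
                   * (\<Sum>n. qpoch (-(c * d)) q n / qpoch q q n
                            * q ^ (n * (n + 1) div 2 + (p + k + j) * n)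
                            * (1 + c * d * q ^ (2 * n)
                                   * (1 + q ^ (p + k)) * (1 + q ^ (p + k + 1)))))))
     - 2 * (qpoch_inf d q * qpoch_inf c q)
       * (\<Sum>i. let p = i + 1 in
           (-(c * d)) ^ p / qpoch q q p
           * (\<Sum>j. qpoch (-q) q j * d ^ j / qpoch q q j
               * (\<Sum>k. qpoch (-q) q k * c ^ k / qpoch q q k
                   * (\<Sum>m. (-(c * d)) ^ m
                            / (qpoch (q ^ (p + 1)) q m
                               * qpoch (-(q ^ (p + k + j))) q (m + 1))
                            * (1 + c * d
                                   * (((1 + q ^ (p + k + j)) * (1 + q ^ (p + k + j + 1)))
                                      / ((1 + q ^ (p + k + j + m + 1))
                                         * (1 + q ^ (p + k + j + m + 2)))))))))"

end

theory Submission
  imports Defs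
begin

text \<open>
  Write \<open>w\<^sub>j = (-q)\<^sub>j / (q)\<^sub>j\<close> (\<open>ratio_coeff\<close>) and
  \<open>S\<^sub>N = (-1)\<^sub>0 + \<dots> + (-1)\<^sub>N\<close> (\<open>qpoch_partial_sum\<close>). The proof has two halves, which meet
  in one auxiliary function \<open>Z(c,d)\<close> (\<open>kernel_value\<close>): the value that the linear functional sending
  \<open>x\<^sup>N\<close> to \<open>g\<^sub>N = S\<^sub>N / (-q)\<^sub>N\<close> (\<open>sigma_seq\<close>) takes on the power series in \<open>x\<close> of
  \<open>(-cqx, -dqx)\<^sub>\<infinity> (1 + cdx\<^sup>2) / (cx, dx, -cdx)\<^sub>\<infinity>\<close>.

  The first half shows \<open>\<Lambda>(c,d,q) = 1 - (c,d)\<^sub>\<infinity> Z(c,d)\<close> (\<open>Lambda_eq_kernel_value\<close>).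
  The q-binomial theorem expands every quotient \<open>(d)\<^sub>n / (-dq)\<^sub>n\<close> in powers of \<open>q\<^sup>n\<close>,
  which reduces the inner sums over \<open>n\<close> to a single limiting case of Heine's transformation. Each of the
  four pieces of \<open>\<Lambda>\<close> then becomes a double series in \<open>w\<^sub>k c\<^sup>k w\<^sub>A d\<^sup>A\<close>. In the last three the index \<open>p\<close>
  occurs in the coefficients only through \<open>(-1)\<^sub>r\<close> with \<open>r\<close> equal to \<open>p\<close> plus other indices, so that
  summing along the diagonals replaces \<open>(-1)\<^sub>r\<close> by differences of the partial sums \<open>S\<close>. The
  differences of the four pieces telescope, and what remains is \<open>Z\<close>. The first piece, with its
  coefficient \<open>3\<close>, supplies the missing initial terms \<open>(-1)\<^sub>0 + (-1)\<^sub>1 = 3\<close>.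

  The second half compares \<open>Z\<close> with the series in the theorem. Let \<open>V(c,d)\<close> be that series
  times \<open>(-c,-d)\<^sub>\<infinity> / (c,d,-cd)\<^sub>\<infinity>\<close> (\<open>sigma_normalised\<close>). Both functions satisfy
  \<open>f(c,dq) = (1-d) f(c,d) - 2d (-c,-dq)\<^sub>\<infinity> / (c,d,-cd)\<^sub>\<infinity>\<close>: for \<open>V\<close> the summand telescopes in \<open>n\<close>
  (\<open>sigma_deform_contiguous\<close>), for \<open>Z\<close> this follows from the recurrence
  \<open>(1 + q\<^sup>N\<^sup>+\<^sup>1) g\<^sub>N\<^sub>+\<^sub>1 = g\<^sub>N + 2\<close> together with a polynomial identity between contiguous kernels
  (\<open>kernel_value_contiguous\<close>). Hence \<open>\<Delta> = V - Z\<close> satisfies \<open>\<Delta>(c,dq) = (1-d) \<Delta>(c,d)\<close>; iterating and letting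
  \<open>dq\<^sup>m\<close> tend to \<open>0\<close> gives \<open>(d)\<^sub>\<infinity> \<Delta>(c,d) = \<Delta>(c,0)\<close>. As \<open>\<Delta>\<close> is symmetric in \<open>c\<close> and \<open>d\<close>, also
  \<open>(c,d)\<^sub>\<infinity> \<Delta>(c,d) = \<Delta>(0,0) = \<sigma>(q) - 1\<close>, and the two halves together are the theorem.
\<close>

section \<open>Rearranging iterated series\<close>

text \<open>
  All exchanges of summation below rest on a majorant that is a product of two summable sequences, most
  often of geometric ones.
\<close>
lemma summable_on_product_majorant:
  fixes f :: "nat \<Rightarrow> nat \<Rightarrow> complex" and a b :: "nat \<Rightarrow> real"
  assumes "summable a" "summable b" and le: "\<And>i j. norm (f i j) \<le> a i * b j"
    and pos: "\<And>i. 0 \<le> a i" "\<And>j. 0 \<le> b j"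
  shows "(\<lambda>(i, j). f i j) summable_on UNIV"
proof -
  have a: "a summable_on UNIV" and b: "b summable_on UNIV"
    using assms pos by (simp_all add: summable_nonneg_imp_summable_on)
  have "(\<lambda>p. norm (case p of (i, j) \<Rightarrow> a i * b j)) summable_on UNIV \<times> UNIV"
    by (subst Infinite_Sum.abs_summable_on_Sigma_iff)
      (use a b pos in \<open>simp add: abs_mult infsum_cmult_right' infsum_nonneg
          summable_on_cmult_right summable_on_cmult_left\<close>)
  hence "(\<lambda>p. norm (case p of (i, j) \<Rightarrow> f i j)) summable_on UNIV"
    unfolding UNIV_Times_UNIV
    by (rule Infinite_Sum.abs_summable_on_comparison_test)
      (auto simp: pos abs_mult intro: le)
  thus ?thesis by (rule abs_summable_summable)
qed

lemma infsum_eq_suminf: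
  fixes f :: "nat \<Rightarrow> complex"
  assumes "summable (\<lambda>n. norm (f n))"
  shows "infsum f UNIV = suminf f"
  by (rule infsumI[OF norm_summable_imp_has_sum[OF assms summable_sums[OF summable_norm_cancel[OF assms]]]])

lemma summable_row:
  fixes f :: "nat \<Rightarrow> nat \<Rightarrow> complex" and a b :: "nat \<Rightarrow> real"
  assumes "summable b" and le: "\<And>i j. norm (f i j) \<le> a i * b j"
  shows "summable (\<lambda>j. norm (f i j))"
  by (rule summable_comparison_test'[OF summable_mult[OF assms(1), of "a i"], of 0]) (simp add: le)

lemma norm_suminf_row_le:
  fixes f :: "nat \<Rightarrow> nat \<Rightarrow> complex" and a b :: "nat \<Rightarrow> real"
  assumes "summable b" and le: "\<And>i j. norm (f i j) \<le> a i * b j"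
  shows "norm (\<Sum>j. f i j) \<le> a i * (\<Sum>j. b j)"
proof -
  have "norm (\<Sum>j. f i j) \<le> (\<Sum>j. a i * b j)"
    by (rule norm_suminf_le) (auto intro: le summable_mult assms)
  thus ?thesis by (simp add: suminf_mult assms)
qed

lemma suminf_suminf_eq_infsum:
  fixes f :: "nat \<Rightarrow> nat \<Rightarrow> complex" and a b :: "nat \<Rightarrow> real"
  assumes ab: "summable a" "summable b" and le: "\<And>i j. norm (f i j) \<le> a i * b j"
    and pos: "\<And>i. 0 \<le> a i" "\<And>j. 0 \<le> b j"
  shows "(\<Sum>i. \<Sum>j. f i j) = infsum (\<lambda>(i, j). f i j) UNIV"
proof -
  have s: "(\<lambda>(i, j). f i j) summable_on UNIV \<times> UNIV"
    using summable_on_product_majorant[OF assms] by simp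
  have row: "infsum (f i) UNIV = (\<Sum>j. f i j)" for i
    by (rule infsum_eq_suminf) (rule summable_row[OF ab(2) le])
  have "summable (\<lambda>i. norm (\<Sum>j. f i j))"
    by (rule summable_comparison_test'[OF summable_mult2[OF ab(1), of "suminf b"], of 0])
      (use norm_suminf_row_le[OF ab(2) le] in auto)
  hence "infsum (\<lambda>i. \<Sum>j. f i j) UNIV = (\<Sum>i. \<Sum>j. f i j)"
    by (rule infsum_eq_suminf)
  moreover have "infsum (\<lambda>i. infsum (f i) UNIV) UNIV = infsum (\<lambda>(i, j). f i j) UNIV"
    using infsum_Sigma'_banach[OF s] by simp
  ultimately show ?thesis by (simp add: row)
qed

lemma suminf_swap:
  fixes f :: "nat \<Rightarrow> nat \<Rightarrow> complex" and a b :: "nat \<Rightarrow> real"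
  assumes ab: "summable a" "summable b" and le: "\<And>i j. norm (f i j) \<le> a i * b j"
    and pos: "\<And>i. 0 \<le> a i" "\<And>j. 0 \<le> b j"
  shows "(\<Sum>i. \<Sum>j. f i j) = (\<Sum>j. \<Sum>i. f i j)"
proof -
  have "(\<Sum>j. \<Sum>i. f i j) = infsum (\<lambda>(j, i). f i j) UNIV"
    by (rule suminf_suminf_eq_infsum[OF ab(2,1) _ pos(2,1)]) (simp add: le mult.commute)
  also have "\<dots> = infsum (\<lambda>(i, j). f i j) UNIV"
    by (rule infsum_reindex_bij_witness[of _ prod.swap prod.swap]) auto
  finally show ?thesis using suminf_suminf_eq_infsum[OF assms] by simp
qed

lemma suminf_diagonals:
  fixes f :: "nat \<Rightarrow> nat \<Rightarrow> complex" and a b :: "nat \<Rightarrow> real"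
  assumes ab: "summable a" "summable b" and le: "\<And>i j. norm (f i j) \<le> a i * b j"
    and pos: "\<And>i. 0 \<le> a i" "\<And>j. 0 \<le> b j"
  shows "(\<lambda>n. \<Sum>i\<le>n. f i (n - i)) sums (\<Sum>i. \<Sum>j. f i j)"
proof -
  have "(\<lambda>(i, j). f i j) summable_on UNIV"
    using summable_on_product_majorant[OF assms] .
  hence "((\<lambda>(i, j). f i j) has_sum (\<Sum>i. \<Sum>j. f i j)) UNIV"
    by (simp add: suminf_suminf_eq_infsum[OF assms])
  hence "((\<lambda>(n, i). f i (n - i)) has_sum (\<Sum>i. \<Sum>j. f i j)) (SIGMA n:UNIV. {..n})"
    by (rule iffD1[OF has_sum_reindex_bij_witness[where S = UNIV and T = "SIGMA n:UNIV. {..n}"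
          and j = "\<lambda>(i, j). (i + j, i)" and i = "\<lambda>(n, i). (i, n - i)"], rotated -1]) auto
  from has_sum_SigmaD[OF this, of "\<lambda>n. \<Sum>i\<le>n. f i (n - i)"]
  have "((\<lambda>n. \<Sum>i\<le>n. f i (n - i)) has_sum (\<Sum>i. \<Sum>j. f i j)) UNIV"
    by (simp add: has_sum_finite)
  thus ?thesis by (rule has_sum_imp_sums)
qed

section \<open>The q-shifted factorial\<close>

lemma qpoch_0 [simp]: "qpoch a q 0 = 1"
  by (simp add: qpoch_def)

lemma qpoch_Suc: "qpoch a q (Suc n) = qpoch a q n * (1 - a * q ^ n)"
  by (simp add: qpoch_def)

lemma qpoch_add: "qpoch a q (m + n) = qpoch a q m * qpoch (a * q ^ m) q n"
  by (induction n) (simp_all add: qpoch_Suc power_add algebra_simps)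

lemma qpoch_Suc_left: "qpoch a q (Suc n) = (1 - a) * qpoch (a * q) q n"
  using qpoch_add[of a q 1 n] by (simp add: qpoch_Suc)

lemma norm_mult_power_lt_1:
  fixes a q :: complex
  assumes "norm q < 1" "norm a < 1"
  shows "norm (a * q ^ n) < 1"
proof -
  have "norm (a * q ^ n) \<le> norm a * 1"
    unfolding norm_mult norm_power
    by (intro mult_left_mono power_le_one) (use assms in auto)
  thus ?thesis using assms by simp
qed

lemma one_minus_neq_0: "norm (x :: complex) < 1 \<Longrightarrow> 1 - x \<noteq> 0"
  by auto

lemma qpoch_nonzero:
  assumes "norm q < 1" "norm a < 1"
  shows "qpoch a q n \<noteq> 0"
  unfolding qpoch_def using norm_mult_power_lt_1[OF assms] one_minus_neq_0 by auto

lemma summable_norm_power_mult: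
  fixes a q :: complex
  assumes "norm q < 1" shows "summable (\<lambda>i. norm (a * q ^ i))"
  using assms by (simp add: norm_mult norm_power summable_mult)

lemma convergent_prod_qpoch:
  fixes a q :: complex
  assumes "norm q < 1"
  shows "convergent_prod (\<lambda>i. 1 - a * q ^ i)"
  by (rule abs_convergent_prod_imp_convergent_prod)
    (use summable_norm_power_mult[OF assms, of a] in \<open>simp add: abs_convergent_prod_conv_summable\<close>)

lemma LIMSEQ_qpoch:
  assumes "norm q < 1"
  shows "(\<lambda>n. qpoch a q n) \<longlonglongrightarrow> qpoch_inf a q"
proof -
  have "convergent (\<lambda>n. \<Prod>i\<le>n. 1 - a * q ^ i)"
    using convergent_prod_LIMSEQ[OF convergent_prod_qpoch[OF assms]] convergentI by blast
  hence "convergent (\<lambda>n. qpoch a q (Suc n))"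
    by (simp add: qpoch_def lessThan_Suc_atMost)
  hence "convergent (\<lambda>n. qpoch a q n)"
    by (simp add: convergent_Suc_iff)
  thus ?thesis by (simp add: qpoch_inf_def convergent_LIMSEQ_iff)
qed

lemma qpoch_inf_0 [simp]: "qpoch_inf 0 q = 1"
  by (simp add: qpoch_inf_def qpoch_def)

lemma qpoch_inf_nonzero:
  assumes "norm q < 1" "norm a < 1"
  shows "qpoch_inf a q \<noteq> 0"
proof -
  have "(\<lambda>n. qpoch a q (Suc n)) \<longlonglongrightarrow> prodinf (\<lambda>i. 1 - a * q ^ i)"
    using convergent_prod_LIMSEQ[OF convergent_prod_qpoch[OF assms(1)]]
    by (simp add: qpoch_def lessThan_Suc_atMost)
  hence "qpoch_inf a q = prodinf (\<lambda>i. 1 - a * q ^ i)"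
    using LIMSEQ_unique LIMSEQ_Suc[OF LIMSEQ_qpoch[OF assms(1)]] by blast
  moreover have "1 - a * q ^ i \<noteq> 0" for i
    using norm_mult_power_lt_1[OF assms] one_minus_neq_0 by blast
  ultimately show ?thesis
    using prodinf_nonzero[OF convergent_prod_qpoch[OF assms(1)]] by auto
qed

lemma qpoch_inf_split:
  assumes "norm q < 1"
  shows "qpoch_inf a q = qpoch a q m * qpoch_inf (a * q ^ m) q"
proof -
  have "(\<lambda>n. qpoch a q (n + m)) \<longlonglongrightarrow> qpoch_inf a q"
    by (rule LIMSEQ_ignore_initial_segment[OF LIMSEQ_qpoch[OF assms]])
  moreover have "(\<lambda>n. qpoch a q (n + m)) \<longlonglongrightarrow> qpoch a q m * qpoch_inf (a * q ^ m) q"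
    unfolding add.commute[of _ m] qpoch_add by (intro tendsto_mult_left LIMSEQ_qpoch assms)
  ultimately show ?thesis by (rule LIMSEQ_unique)
qed

lemma qpoch_inf_step:
  assumes "norm q < 1"
  shows "qpoch_inf a q = (1 - a) * qpoch_inf (a * q) q"
  using qpoch_inf_split[OF assms, of a 1] by (simp add: qpoch_Suc)

text \<open>
  The bound is uniform in the parameter, as is needed when \<open>c\<close> or \<open>d\<close> moves: for
  \<open>\<bar>a\<bar> \<le> 1\<close> each factor is at most \<open>1 + \<bar>q\<bar>\<^sup>i\<close> in norm, which is a factor of \<open>(-1; \<bar>q\<bar>)\<^sub>n\<close>.
\<close>
lemma qpoch_bounded:
  assumes "norm q < 1"
  obtains C where "C > 0" "\<And>a n. norm a \<le> 1 \<Longrightarrow> norm (qpoch a q n) \<le> C"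
proof -
  have q': "norm (complex_of_real (norm q)) < 1" using assms by simp
  have "Bseq (\<lambda>n. qpoch (-1) (complex_of_real (norm q)) n)"
    by (intro convergent_imp_Bseq convergentI[OF LIMSEQ_qpoch[OF q']])
  then obtain C where C: "C > 0" "\<And>n. norm (qpoch (-1) (complex_of_real (norm q)) n) \<le> C"
    by (auto simp: Bseq_def)
  have "norm (qpoch a q n) \<le> C" if "norm a \<le> 1" for a n
  proof -
    have le: "norm (1 - a * q ^ i) \<le> norm (1 + complex_of_real (norm q) ^ i)" for i
    proof -
      have "norm (1 - a * q ^ i) \<le> 1 + norm a * norm q ^ i"
        by (metis norm_triangle_ineq4 norm_mult norm_one norm_power)
      also have "\<dots> \<le> 1 + 1 * norm q ^ i"
        using that by (intro add_left_mono mult_right_mono) auto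
      also have "\<dots> = norm (1 + complex_of_real (norm q) ^ i)"
        by (metis (no_types, lifting) abs_of_nonneg add_nonneg_nonneg mult_1 norm_ge_zero
            norm_of_real of_real_1 of_real_add of_real_power zero_le_one zero_le_power)
      finally show ?thesis .
    qed
    have "norm (qpoch a q n) \<le> norm (qpoch (-1) (complex_of_real (norm q)) n)"
      unfolding qpoch_def by (simp add: prod_norm[symmetric], intro prod_mono) (use le in auto)
    thus ?thesis using C(2)[of n] by linarith
  qed
  with C(1) that show ?thesis by blast
qed

lemma inverse_qpoch_bounded:
  assumes "norm q < 1" "norm a < 1"
  obtains C where "C > 0" "\<And>n. norm (1 / qpoch a q n) \<le> C"
proof -
  have "(\<lambda>n. 1 / qpoch a q n) \<longlonglongrightarrow> 1 / qpoch_inf a q"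
    by (intro tendsto_divide tendsto_const LIMSEQ_qpoch assms qpoch_inf_nonzero)
  hence "Bseq (\<lambda>n. 1 / qpoch a q n)" by (intro convergent_imp_Bseq convergentI)
  thus ?thesis using that by (auto simp: Bseq_def)
qed

lemma norm_power_triangle_le:
  fixes q :: complex
  assumes "norm q < 1"
  shows "norm (q ^ (n * (n + 1) div 2)) \<le> norm q ^ n"
proof -
  have "n * 2 \<le> n * (n + 1)" by (cases n) auto
  hence "n \<le> n * (n + 1) div 2" by linarith
  thus ?thesis unfolding norm_power by (intro power_decreasing) (use assms in auto)
qed

lemma power_triangle_Suc: "q ^ (Suc n * (Suc n + 1) div 2) = (q :: complex) ^ (n * (n + 1) div 2) * q ^ Suc n"
proof -
  have "Suc n * (Suc n + 1) div 2 = n * (n + 1) div 2 + Suc n"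
    by simp
  thus ?thesis by (simp add: power_add)
qed

section \<open>The q-binomial theorem and a limit of Heine's transformation\<close>

lemma summable_bounded_mult_power:
  fixes c :: "nat \<Rightarrow> complex"
  assumes "\<And>n. norm (c n) \<le> C" and "norm z < 1"
  shows "summable (\<lambda>n. norm (c n * z ^ n))"
proof (rule summable_comparison_test')
  show "summable (\<lambda>n. C * norm z ^ n)" using assms by (intro summable_mult summable_geometric) auto
  show "norm (norm (c n * z ^ n)) \<le> C * norm z ^ n" if "n \<ge> 0" for n
    using assms(1)[of n] by (simp add: norm_mult norm_power mult_right_mono)
qed

lemma powser_at_scaled_arguments:
  fixes c :: "nat \<Rightarrow> complex"
  assumes q: "norm q < 1" and c: "\<And>n. norm (c n) \<le> C"
  shows "(\<lambda>m. \<Sum>n. c n * (z * q ^ m) ^ n) \<longlonglongrightarrow> c 0"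
proof -
  have "summable (\<lambda>n. norm (c n * (1/2) ^ n))"
    by (rule summable_bounded_mult_power[OF c]) auto
  hence cont: "isCont (\<lambda>x. \<Sum>n. c n * x ^ n) 0"
    by (rule isCont_powser[OF summable_norm_cancel]) auto
  have "(\<lambda>m. z * q ^ m) \<longlonglongrightarrow> z * 0"
    by (intro tendsto_mult tendsto_const LIMSEQ_power_zero q)
  hence "(\<lambda>m. z * q ^ m) \<longlonglongrightarrow> 0" by simp
  from isCont_tendsto_compose[OF cont this] show ?thesis by simp
qed

lemma qpoch_ratio_bounded:
  assumes "norm q < 1" "norm b < 1"
  obtains C where "C > 0" "\<And>n. norm (qpoch a q n / qpoch b q n) \<le> C"
proof -
  have "(\<lambda>n. qpoch a q n / qpoch b q n) \<longlonglongrightarrow> qpoch_inf a q / qpoch_inf b q"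
    by (intro tendsto_divide LIMSEQ_qpoch assms qpoch_inf_nonzero)
  hence "Bseq (\<lambda>n. qpoch a q n / qpoch b q n)" by (intro convergent_imp_Bseq convergentI)
  thus ?thesis using that by (auto simp: Bseq_def)
qed

text \<open>
  The sum \<open>f(z)\<close> satisfies \<open>(1 - z) f(z) = (1 - az) f(zq)\<close> because of the recurrence of its
  coefficients. Iterating moves the argument to \<open>z q\<^sup>m \<rightarrow> 0\<close>, where \<open>f\<close> is continuous with value \<open>1\<close>.
\<close>
lemma q_binomial_theorem:
  fixes q z a :: complex
  assumes q: "norm q < 1" and z: "norm z < 1"
  shows "(\<lambda>n. qpoch a q n / qpoch q q n * z ^ n) sums (qpoch_inf (a * z) q / qpoch_inf z q)"
proof -
  define c where "c n = qpoch a q n / qpoch q q n" for n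
  obtain C where C: "\<And>n. norm (c n) \<le> C" using qpoch_ratio_bounded[OF q q, of a] by (auto simp: c_def)
  define f where "f x = (\<Sum>n. c n * x ^ n)" for x
  have sums_f: "(\<lambda>n. c n * x ^ n) sums f x" if "norm x < 1" for x
    unfolding f_def
    by (rule summable_sums[OF summable_norm_cancel[OF summable_bounded_mult_power[of c, OF C that]]])
  have rec: "c (Suc n) * (1 - q ^ Suc n) = c n * (1 - a * q ^ n)" for n
    using qpoch_nonzero[OF q q, of n] qpoch_nonzero[OF q q, of "Suc n"]
    by (simp add: c_def qpoch_Suc divide_simps)
  have step: "(1 - x) * f x = (1 - a * x) * f (x * q)" if x: "norm x < 1" for x
  proof -
    have xq: "norm (x * q) < 1" using norm_mult_power_lt_1[OF q x, of 1] by simp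
    have "(\<lambda>n. c n * x ^ n - c n * (x * q) ^ n) sums (f x - f (x * q))"
      by (intro sums_diff sums_f x xq)
    hence "(\<lambda>n. c (Suc n) * x ^ Suc n - c (Suc n) * (x * q) ^ Suc n) sums (f x - f (x * q))"
      using sums_Suc_iff[of "\<lambda>n. c n * x ^ n - c n * (x * q) ^ n" "f x - f (x * q)"] by simp
    moreover have "(\<lambda>n. x * (c n * x ^ n) - a * x * (c n * (x * q) ^ n)) sums (x * f x - a * x * f (x * q))"
      by (intro sums_diff sums_mult sums_f x xq)
    moreover have "c (Suc n) * x ^ Suc n - c (Suc n) * (x * q) ^ Suc n
        = x * (c n * x ^ n) - a * x * (c n * (x * q) ^ n)" for n
    proof -
      have "c (Suc n) * x ^ Suc n - c (Suc n) * (x * q) ^ Suc n = x ^ Suc n * (c (Suc n) * (1 - q ^ Suc n))"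
        by (simp add: power_mult_distrib algebra_simps)
      also have "\<dots> = x * (c n * x ^ n) - a * x * (c n * (x * q) ^ n)"
        unfolding rec by (simp add: power_mult_distrib algebra_simps)
      finally show ?thesis .
    qed
    ultimately have "f x - f (x * q) = x * f x - a * x * f (x * q)"
      using sums_unique2 by simp
    thus ?thesis by (simp add: algebra_simps)
  qed
  have iter: "qpoch z q m * f z = qpoch (a * z) q m * f (z * q ^ m)" for m
  proof (induction m)
    case (Suc m)
    have "qpoch z q (Suc m) * f z = (1 - z * q ^ m) * (qpoch z q m * f z)"
      by (simp add: qpoch_Suc)
    also have "\<dots> = qpoch (a * z) q m * ((1 - z * q ^ m) * f (z * q ^ m))"
      by (simp add: Suc.IH)
    also have "\<dots> = qpoch (a * z) q (Suc m) * f (z * q ^ Suc m)"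
      unfolding step[OF norm_mult_power_lt_1[OF q z]] by (simp add: qpoch_Suc mult_ac)
    finally show ?case .
  qed simp
  have lim: "(\<lambda>m. f (z * q ^ m)) \<longlonglongrightarrow> 1"
    using powser_at_scaled_arguments[of q c C z, OF q C] by (simp add: f_def c_def)
  have "(\<lambda>m. qpoch z q m * f z) \<longlonglongrightarrow> qpoch_inf z q * f z"
    by (intro tendsto_mult LIMSEQ_qpoch q tendsto_const)
  moreover have "(\<lambda>m. qpoch z q m * f z) \<longlonglongrightarrow> qpoch_inf (a * z) q * 1"
    unfolding iter by (intro tendsto_mult LIMSEQ_qpoch q lim)
  ultimately have "qpoch_inf z q * f z = qpoch_inf (a * z) q"
    using LIMSEQ_unique by fastforce
  hence "f z = qpoch_inf (a * z) q / qpoch_inf z q"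
    using qpoch_inf_nonzero[OF q z] by (simp add: field_simps)
  with sums_f[OF z] show ?thesis by (simp add: c_def)
qed

lemma inverse_qpoch_inf_sums:
  fixes q z :: complex
  assumes "norm q < 1" "norm z < 1"
  shows "(\<lambda>n. z ^ n / qpoch q q n) sums (1 / qpoch_inf z q)"
  using q_binomial_theorem[OF assms, of 0] by (simp add: qpoch_def)

text \<open>
  Euler's second identity, by the same device: here \<open>f(x) = (1 + xq) f(xq)\<close>.
\<close>
lemma euler_triangular_sum:
  fixes q x :: complex
  assumes q: "norm q < 1" and x: "norm x \<le> 1"
  shows "(\<lambda>n. q ^ (n * (n + 1) div 2) / qpoch q q n * x ^ n) sums qpoch_inf (-(x * q)) q"
proof -
  define c where "c n = q ^ (n * (n + 1) div 2) / qpoch q q n" for n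
  obtain C where C: "C > 0" "\<And>n. norm (1 / qpoch q q n) \<le> C" using inverse_qpoch_bounded[OF q q] by blast
  have cle: "norm (c n) \<le> C * norm q ^ n" for n
  proof -
    have "norm (c n) = norm (q ^ (n * (n + 1) div 2)) * norm (1 / qpoch q q n)"
      by (simp add: c_def norm_divide)
    also have "\<dots> \<le> norm q ^ n * C"
      by (intro mult_mono norm_power_triangle_le[OF q] C) auto
    finally show ?thesis by (simp add: mult.commute)
  qed
  have c_le: "norm (c n) \<le> C" for n
  proof -
    have "C * norm q ^ n \<le> C * 1"
      using C(1) q by (intro mult_left_mono power_le_one) auto
    with cle[of n] show ?thesis by simp
  qed
  have sc: "summable (\<lambda>n. norm (c n))"
    by (rule summable_comparison_test'[of "\<lambda>n. C * norm q ^ n" 0])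
      (use cle q in \<open>auto intro!: summable_mult summable_geometric\<close>)
  define f where "f x = (\<Sum>n. c n * x ^ n)" for x
  have sums_f: "(\<lambda>n. c n * x ^ n) sums f x" if "norm x \<le> 1" for x
    unfolding f_def
  proof (rule summable_sums, rule summable_norm_cancel, rule summable_comparison_test'[OF sc, of 0])
    show "norm (norm (c n * x ^ n)) \<le> norm (c n)" for n
      using that power_le_one[of "norm x" n]
      by (simp add: norm_mult norm_power mult_left_le)
  qed
  have rec: "c (Suc n) * (1 - q ^ Suc n) = c n * q ^ Suc n" for n
    unfolding c_def power_triangle_Suc
    using qpoch_nonzero[OF q q, of n] qpoch_nonzero[OF q q, of "Suc n"]
    by (simp add: qpoch_Suc divide_simps)
  have step: "f x = (1 + x * q) * f (x * q)" if x: "norm x \<le> 1" for x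
  proof -
    have xq: "norm (x * q) \<le> 1" using x q by (simp add: norm_mult mult_le_one)
    have "(\<lambda>n. c n * x ^ n - c n * (x * q) ^ n) sums (f x - f (x * q))"
      by (intro sums_diff sums_f x xq)
    hence "(\<lambda>n. c (Suc n) * x ^ Suc n - c (Suc n) * (x * q) ^ Suc n) sums (f x - f (x * q))"
      using sums_Suc_iff[of "\<lambda>n. c n * x ^ n - c n * (x * q) ^ n" "f x - f (x * q)"] by simp
    moreover have "(\<lambda>n. x * q * (c n * (x * q) ^ n)) sums (x * q * f (x * q))"
      by (intro sums_mult sums_f xq)
    moreover have "c (Suc n) * x ^ Suc n - c (Suc n) * (x * q) ^ Suc n
        = x * q * (c n * (x * q) ^ n)" for n
    proof -
      have "c (Suc n) * x ^ Suc n - c (Suc n) * (x * q) ^ Suc n = x ^ Suc n * (c (Suc n) * (1 - q ^ Suc n))"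
        by (simp add: power_mult_distrib algebra_simps)
      also have "\<dots> = x * q * (c n * (x * q) ^ n)"
        unfolding rec by (simp add: power_mult_distrib algebra_simps)
      finally show ?thesis .
    qed
    ultimately have "f x - f (x * q) = x * q * f (x * q)"
      using sums_unique2 by simp
    thus ?thesis by (simp add: algebra_simps)
  qed
  have iter: "f x = qpoch (-(x * q)) q m * f (x * q ^ m)" for m
  proof (induction m)
    case (Suc m)
    have "norm (x * q ^ m) \<le> 1"
      using x q by (simp add: norm_mult norm_power mult_le_one power_le_one)
    from step[OF this] Suc show ?case by (simp add: qpoch_Suc mult_ac)
  qed simp
  have "(\<lambda>m. qpoch (-(x * q)) q m * f (x * q ^ m)) \<longlonglongrightarrow> qpoch_inf (-(x * q)) q * c 0"
    unfolding f_def by (intro tendsto_mult LIMSEQ_qpoch q powser_at_scaled_arguments[of q c C, OF q c_le])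
  hence "f x = qpoch_inf (-(x * q)) q"
    unfolding iter[symmetric] by (simp add: LIMSEQ_const_iff c_def)
  with sums_f[OF x] show ?thesis by (simp add: c_def)
qed

definition ratio_coeff :: "complex \<Rightarrow> nat \<Rightarrow> complex" where
  "ratio_coeff q j = qpoch (-q) q j / qpoch q q j"

lemma ratio_coeff_sums:
  fixes q z :: complex
  assumes "norm q < 1" "norm z < 1"
  shows "(\<lambda>n. ratio_coeff q n * z ^ n) sums (qpoch_inf (-(z * q)) q / qpoch_inf z q)"
  using q_binomial_theorem[OF assms, of "-q"] by (simp add: ratio_coeff_def mult.commute)

lemma ratio_coeff_bounded:
  assumes "norm q < 1"
  obtains C where "C > 0" "\<And>n. norm (ratio_coeff q n) \<le> C"
  using qpoch_ratio_bounded[OF assms assms] unfolding ratio_coeff_def by blast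

text \<open>
  Because \<open>(d)\<^sub>n / (-dq)\<^sub>n\<close> equals \<open>(d)\<^sub>\<infinity> / (-dq)\<^sub>\<infinity>\<close> times the q-binomial series at \<open>dq\<^sup>n\<close>, a factor of this
  shape under a sum can be traded for an outer series whose inner sums only carry an extra power \<open>q\<^sup>A\<^sup>n\<close>.
\<close>
lemma suminf_qpoch_ratio_factor:
  fixes q d :: complex and \<alpha> :: "nat \<Rightarrow> complex"
  assumes q: "norm q < 1" and d: "norm d < 1" and \<alpha>: "summable (\<lambda>n. norm (\<alpha> n))"
  shows "(\<Sum>n. \<alpha> n * (qpoch d q n / qpoch (-(d * q)) q n)) =
    qpoch_inf d q / qpoch_inf (-(d * q)) q * (\<Sum>A. ratio_coeff q A * d ^ A * (\<Sum>n. \<alpha> n * q ^ (A * n)))"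
proof -
  obtain C where C: "C > 0" "\<And>n. norm (ratio_coeff q n) \<le> C" using ratio_coeff_bounded[OF q] by blast
  have dq: "norm (-(d * q)) < 1" using norm_mult_power_lt_1[OF q d, of 1] by simp
  define K where "K = qpoch_inf d q / qpoch_inf (-(d * q)) q"
  have "qpoch d q n / qpoch (-(d * q)) q n = K * (\<Sum>A. ratio_coeff q A * (d * q ^ n) ^ A)" for n
  proof -
    have "qpoch_inf d q = qpoch d q n * qpoch_inf (d * q ^ n) q"
      by (rule qpoch_inf_split[OF q])
    moreover have "qpoch_inf (-(d * q)) q = qpoch (-(d * q)) q n * qpoch_inf (-(d * q ^ n * q)) q"
      using qpoch_inf_split[OF q, of "-(d * q)" n] by (simp add: mult_ac)
    moreover have "(\<Sum>A. ratio_coeff q A * (d * q ^ n) ^ A) = qpoch_inf (-(d * q ^ n * q)) q / qpoch_inf (d * q ^ n) q"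
      using ratio_coeff_sums[OF q norm_mult_power_lt_1[OF q d]] by (rule sums_unique[symmetric])
    moreover have "qpoch_inf d q \<noteq> 0" "qpoch_inf (-(d * q)) q \<noteq> 0"
      using qpoch_inf_nonzero q d dq by auto
    ultimately show ?thesis by (auto simp: K_def)
  qed
  hence "(\<Sum>n. \<alpha> n * (qpoch d q n / qpoch (-(d * q)) q n))
      = (\<Sum>n. K * (\<alpha> n * (\<Sum>A. ratio_coeff q A * (d * q ^ n) ^ A)))"
    by (simp add: mult_ac)
  also have "\<dots> = (\<Sum>n. \<Sum>A. K * (\<alpha> n * (ratio_coeff q A * (d * q ^ n) ^ A)))"
  proof -
    have "summable (\<lambda>A. ratio_coeff q A * (d * q ^ n) ^ A)" for n
      using ratio_coeff_sums[OF q norm_mult_power_lt_1[OF q d]] by (rule sums_summable)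
    thus ?thesis by (simp add: suminf_mult summable_mult)
  qed
  also have "\<dots> = (\<Sum>A. \<Sum>n. K * (\<alpha> n * (ratio_coeff q A * (d * q ^ n) ^ A)))"
  proof (rule suminf_swap[where a = "\<lambda>n. norm K * norm (\<alpha> n)" and b = "\<lambda>A. C * norm d ^ A"])
    fix n A
    have "norm (d * q ^ n) ^ A \<le> norm d ^ A"
      using q by (intro power_mono) (auto simp: norm_mult norm_power mult_left_le power_le_one)
    hence "norm (ratio_coeff q A) * norm (d * q ^ n) ^ A \<le> C * norm d ^ A"
      using C by (intro mult_mono) auto
    thus "norm (K * (\<alpha> n * (ratio_coeff q A * (d * q ^ n) ^ A))) \<le> norm K * norm (\<alpha> n) * (C * norm d ^ A)"
      by (simp add: norm_mult norm_power mult_left_mono mult.assoc)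
  qed (use \<alpha> d C in \<open>auto intro!: summable_mult summable_geometric\<close>)
  also have "\<dots> = (\<Sum>A. K * (ratio_coeff q A * d ^ A * (\<Sum>n. \<alpha> n * q ^ (A * n))))"
  proof (rule suminf_cong)
    fix A
    have s: "summable (\<lambda>n. \<alpha> n * q ^ (A * n))"
    proof (rule summable_norm_cancel, rule summable_comparison_test'[OF \<alpha>, of 0])
      show "norm (norm (\<alpha> n * q ^ (A * n))) \<le> norm (\<alpha> n)" for n
        using q power_le_one[of "norm q" "A * n"] by (simp add: norm_mult norm_power mult_left_le)
    qed
    have "(\<Sum>n. K * (\<alpha> n * (ratio_coeff q A * (d * q ^ n) ^ A)))
        = (\<Sum>n. K * (ratio_coeff q A * d ^ A) * (\<alpha> n * q ^ (A * n)))"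
      by (simp add: power_mult_distrib power_mult[symmetric] mult_ac)
    thus "(\<Sum>n. K * (\<alpha> n * (ratio_coeff q A * (d * q ^ n) ^ A)))
       = K * (ratio_coeff q A * d ^ A * (\<Sum>n. \<alpha> n * q ^ (A * n)))"
      by (simp add: suminf_mult s mult.assoc)
  qed
  also have "\<dots> = K * (\<Sum>A. ratio_coeff q A * d ^ A * (\<Sum>n. \<alpha> n * q ^ (A * n)))"
  proof (rule suminf_mult)
    show "summable (\<lambda>A. ratio_coeff q A * d ^ A * (\<Sum>n. \<alpha> n * q ^ (A * n)))"
    proof (rule summable_norm_cancel, rule summable_comparison_test'[of "\<lambda>A. C * norm d ^ A * (\<Sum>n. norm (\<alpha> n))" 0])
      fix A
      have "norm (\<Sum>n. \<alpha> n * q ^ (A * n)) \<le> (\<Sum>n. norm (\<alpha> n))"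
      proof (rule norm_suminf_le[OF _ \<alpha>])
        show "norm (\<alpha> n * q ^ (A * n)) \<le> norm (\<alpha> n)" for n
          using q power_le_one[of "norm q" "A * n"] by (simp add: norm_mult norm_power mult_left_le)
      qed
      thus "norm (norm (ratio_coeff q A * d ^ A * (\<Sum>n. \<alpha> n * q ^ (A * n)))) \<le> C * norm d ^ A * (\<Sum>n. norm (\<alpha> n))"
        unfolding real_norm_def abs_norm_cancel
        unfolding norm_mult norm_power using C
        by (intro mult_mono) (auto intro: mult_nonneg_nonneg less_imp_le)
    qed (use d in \<open>auto intro!: summable_mult2 summable_mult summable_geometric\<close>)
  qed
  finally show ?thesis by (simp add: K_def)
qed

definition euler_series :: "complex \<Rightarrow> complex \<Rightarrow> nat \<Rightarrow> complex" where
  "euler_series a q s = (\<Sum>M. a ^ M / qpoch q q M / qpoch (-q) q (s + M))"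

text \<open>
  The limiting case of Heine's transformation: expand \<open>(a)\<^sub>n = (a)\<^sub>\<infinity> / (aq\<^sup>n)\<^sub>\<infinity>\<close> by Euler's first identity,
  exchange the sums, and evaluate the sum over \<open>n\<close> by Euler's second identity.
\<close>
lemma heine_limit:
  fixes q a :: complex
  assumes q: "norm q < 1" and a: "norm a < 1"
  shows "(\<Sum>n. qpoch a q n / qpoch q q n * q ^ (n * (n + 1) div 2 + s * n)) =
    qpoch_inf a q * qpoch_inf (-q) q * euler_series a q s"
proof -
  obtain C where C: "C > 0" "\<And>n. norm (1 / qpoch q q n) \<le> C" using inverse_qpoch_bounded[OF q q] by blast
  obtain D where D: "D > 0" "\<And>n. norm (1 / qpoch (-q) q n) \<le> D"
    using inverse_qpoch_bounded[OF q, of "-q"] q by auto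
  define K where "K = qpoch_inf a q"
  define t where "t n = 1 / qpoch q q n * q ^ (n * (n + 1) div 2) * q ^ (s * n)" for n
  have t_le: "norm (t n) \<le> C * norm q ^ n" for n
  proof -
    have "norm (t n) = norm (1 / qpoch q q n) * norm (q ^ (n * (n + 1) div 2)) * norm (q ^ (s * n))"
      by (simp add: t_def norm_mult norm_power norm_divide)
    also have "\<dots> \<le> C * norm q ^ n * 1"
      using C q by (intro mult_mono norm_power_triangle_le C) (auto simp: norm_power power_le_one)
    finally show ?thesis by simp
  qed
  have "qpoch a q n = K * (\<Sum>M. (a * q ^ n) ^ M / qpoch q q M)" for n
  proof -
    have "qpoch_inf a q = qpoch a q n * qpoch_inf (a * q ^ n) q"
      by (rule qpoch_inf_split[OF q])
    moreover have "(\<Sum>M. (a * q ^ n) ^ M / qpoch q q M) = 1 / qpoch_inf (a * q ^ n) q"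
      using inverse_qpoch_inf_sums[OF q norm_mult_power_lt_1[OF q a]] by (rule sums_unique[symmetric])
    moreover have "qpoch_inf a q \<noteq> 0"
      using qpoch_inf_nonzero q a by auto
    ultimately show ?thesis by (auto simp: K_def)
  qed
  hence "(\<Sum>n. qpoch a q n / qpoch q q n * q ^ (n * (n + 1) div 2 + s * n))
      = (\<Sum>n. K * (t n * (\<Sum>M. (a * q ^ n) ^ M / qpoch q q M)))"
    by (simp add: t_def power_add mult_ac)
  also have "\<dots> = (\<Sum>n. \<Sum>M. K * (t n * ((a * q ^ n) ^ M / qpoch q q M)))"
  proof -
    have "summable (\<lambda>M. (a * q ^ n) ^ M / qpoch q q M)" for n
      using inverse_qpoch_inf_sums[OF q norm_mult_power_lt_1[OF q a]] by (rule sums_summable)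
    thus ?thesis by (simp only: suminf_mult summable_mult)
  qed
  also have "\<dots> = (\<Sum>M. \<Sum>n. K * (t n * ((a * q ^ n) ^ M / qpoch q q M)))"
  proof (rule suminf_swap[where a = "\<lambda>n. norm K * (C * norm q ^ n)" and b = "\<lambda>M. C * norm a ^ M"])
    fix n M
    have "norm (a * q ^ n) ^ M \<le> norm a ^ M"
      using q by (intro power_mono) (auto simp: norm_mult norm_power mult_left_le power_le_one)
    hence "norm (1 / qpoch q q M) * norm (a * q ^ n) ^ M \<le> C * norm a ^ M"
      using C by (intro mult_mono) auto
    hence "norm ((a * q ^ n) ^ M / qpoch q q M) \<le> C * norm a ^ M"
      by (simp add: norm_divide norm_power)
    hence "norm (t n) * norm ((a * q ^ n) ^ M / qpoch q q M) \<le> (C * norm q ^ n) * (C * norm a ^ M)"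
      using C by (intro mult_mono t_le) auto
    thus "norm (K * (t n * ((a * q ^ n) ^ M / qpoch q q M))) \<le> norm K * (C * norm q ^ n) * (C * norm a ^ M)"
      unfolding norm_mult[of K] norm_mult[of "t n"] mult.assoc[of "norm K"] by (intro mult_left_mono) auto
  qed (use a q C in \<open>auto intro!: summable_mult summable_geometric\<close>)
  also have "\<dots> = (\<Sum>M. K * qpoch_inf (-q) q * (a ^ M / qpoch q q M / qpoch (-q) q (s + M)))"
  proof (rule suminf_cong)
    fix M
    have "norm (q ^ (s + M)) \<le> 1" using q by (simp add: norm_power power_le_one)
    from euler_triangular_sum[OF q this]
    have "(\<lambda>n. K * (a ^ M / qpoch q q M) * (q ^ (n * (n + 1) div 2) / qpoch q q n * (q ^ (s + M)) ^ n))
        sums (K * (a ^ M / qpoch q q M) * qpoch_inf (-(q ^ (s + M) * q)) q)"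
      by (rule sums_mult)
    moreover have "K * (a ^ M / qpoch q q M) * (q ^ (n * (n + 1) div 2) / qpoch q q n * (q ^ (s + M)) ^ n)
       = K * (t n * ((a * q ^ n) ^ M / qpoch q q M))" for n
      by (simp add: t_def power_mult_distrib power_add power_mult[symmetric] add_mult_distrib mult_ac)
    ultimately have "(\<Sum>n. K * (t n * ((a * q ^ n) ^ M / qpoch q q M)))
        = K * (a ^ M / qpoch q q M) * qpoch_inf (-(q ^ (s + M) * q)) q"
      by (simp add: sums_iff)
    moreover have "qpoch_inf (-q) q = qpoch (-q) q (s + M) * qpoch_inf (-(q ^ (s + M) * q)) q"
      using qpoch_inf_split[OF q, of "-q" "s + M"] by (simp add: mult_ac)
    moreover have "qpoch (-q) q (s + M) \<noteq> 0" using qpoch_nonzero[OF q, of "-q"] q by simp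
    ultimately show "(\<Sum>n. K * (t n * ((a * q ^ n) ^ M / qpoch q q M)))
        = K * qpoch_inf (-q) q * (a ^ M / qpoch q q M / qpoch (-q) q (s + M))"
      by simp
  qed
  also have "\<dots> = K * qpoch_inf (-q) q * euler_series a q s"
    unfolding euler_series_def
  proof (rule suminf_mult, rule summable_norm_cancel, rule summable_comparison_test'[of "\<lambda>M. norm a ^ M * C * D" 0])
    fix M
    have "norm (a ^ M / qpoch q q M / qpoch (-q) q (s + M)) = norm a ^ M * norm (1 / qpoch q q M) * norm (1 / qpoch (-q) q (s + M))"
      by (simp add: norm_divide norm_power norm_mult)
    also have "\<dots> \<le> norm a ^ M * C * D"
      using C by (intro mult_mono C D) auto
    finally show "norm (norm (a ^ M / qpoch q q M / qpoch (-q) q (s + M))) \<le> norm a ^ M * C * D" by simp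
  qed (use a in \<open>auto intro!: summable_mult2 summable_geometric\<close>)
  finally show ?thesis by (simp add: K_def)
qed

section \<open>The deformed sigma series and its contiguous relation\<close>

lemma qpoch_inf_shift_tendsto_1:
  fixes q x :: complex
  assumes q: "norm q < 1" and x: "norm x < 1"
  shows "(\<lambda>m. qpoch_inf (x * q ^ m) q) \<longlonglongrightarrow> 1"
proof -
  have "qpoch_inf (x * q ^ m) q = qpoch_inf x q / qpoch x q m" for m
    using qpoch_inf_split[OF q, of x m] qpoch_nonzero[OF q x, of m] by (simp add: field_simps)
  moreover have "(\<lambda>m. qpoch_inf x q / qpoch x q m) \<longlonglongrightarrow> qpoch_inf x q / qpoch_inf x q"
    by (intro tendsto_divide tendsto_const LIMSEQ_qpoch q qpoch_inf_nonzero x)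
  ultimately show ?thesis using qpoch_inf_nonzero[OF q x] by simp
qed

lemma tannery_sequentially:
  fixes a :: "nat \<Rightarrow> nat \<Rightarrow> complex"
  assumes "\<And>n. (\<lambda>m. a n m) \<longlonglongrightarrow> b n" and "\<And>n m. norm (a n m) \<le> M n" and "summable M"
  shows "(\<lambda>m. \<Sum>n. a n m) \<longlonglongrightarrow> (\<Sum>n. b n)"
proof -
  have "eventually (\<lambda>(n, m). norm (a n m) \<le> M n) (at_top \<times>\<^sub>F sequentially)"
    using assms(2) by (intro always_eventually) auto
  from tannerys_theorem[OF assms(1) this assms(3)] show ?thesis by simp
qed

definition sigma_deform_term :: "complex \<Rightarrow> complex \<Rightarrow> complex \<Rightarrow> nat \<Rightarrow> complex" where
  "sigma_deform_term q c d n =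
     qpoch (-(c * d)) q n * (1 - c * d * q ^ (2 * n)) * q ^ (n * (n + 1) div 2)
       / (qpoch (-q) q n * (1 - c * q ^ n) * (1 - d * q ^ n))"

lemma norm_one_minus_ge:
  fixes x q :: complex
  assumes "norm q < 1" "norm x \<le> r"
  shows "1 - r \<le> norm (1 - x * q ^ n)"
proof -
  have "norm (x * q ^ n) \<le> norm x * 1"
    unfolding norm_mult norm_power by (intro mult_left_mono power_le_one) (use assms in auto)
  moreover have "1 - norm (x * q ^ n) \<le> norm (1 - x * q ^ n)"
    using norm_triangle_ineq2[of 1 "x * q ^ n"] by simp
  ultimately show ?thesis using assms by simp
qed

lemma sigma_deform_term_bounded:
  assumes q: "norm q < 1" and r: "r < 1"
  obtains C where "\<And>c d n. norm c \<le> r \<Longrightarrow> norm d \<le> r \<Longrightarrow> norm (sigma_deform_term q c d n) \<le> C * norm q ^ n"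
proof -
  obtain C where C: "C > 0" "\<And>a n. norm a \<le> 1 \<Longrightarrow> norm (qpoch a q n) \<le> C"
    using qpoch_bounded[OF q] by blast
  obtain D where D: "D > 0" "\<And>n. norm (1 / qpoch (-q) q n) \<le> D"
    using inverse_qpoch_bounded[OF q, of "-q"] q by auto
  have "norm (sigma_deform_term q c d n) \<le> (C * 2 * D / ((1 - r) * (1 - r))) * norm q ^ n"
    if c: "norm c \<le> r" and d: "norm d \<le> r" for c d n
  proof -
    have cd: "norm (c * d) \<le> 1" unfolding norm_mult by (rule mult_le_one) (use c d r in auto)
    have "norm (c * d * q ^ (2 * n)) \<le> 1"
      unfolding norm_mult[of "c * d"] norm_power
      by (rule mult_le_one) (use cd q in \<open>auto intro: power_le_one\<close>)
    hence "norm (1 - c * d * q ^ (2 * n)) \<le> 2"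
      using norm_triangle_ineq4[of 1 "c * d * q ^ (2 * n)"] by simp
    moreover have inv: "norm (1 / (1 - x * q ^ n)) \<le> 1 / (1 - r)" if "norm x \<le> r" for x
      using norm_one_minus_ge[OF q that, of n] r by (simp add: norm_divide frac_le)
    moreover have "sigma_deform_term q c d n = qpoch (-(c * d)) q n * (1 - c * d * q ^ (2 * n))
        * (1 / qpoch (-q) q n) * ((1 / (1 - c * q ^ n)) * (1 / (1 - d * q ^ n))) * q ^ (n * (n + 1) div 2)"
      by (simp add: sigma_deform_term_def)
    ultimately have "norm (sigma_deform_term q c d n) \<le> C * 2 * D * (1 / (1 - r) * (1 / (1 - r))) * norm q ^ n"
      unfolding \<open>sigma_deform_term q c d n = _\<close>
      using C(1) D r cd inv[OF c] inv[OF d]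
      by (simp only: norm_mult) (intro mult_mono C(2) norm_power_triangle_le[OF q] mult_nonneg_nonneg; simp add: norm_mult)
    thus ?thesis by simp
  qed
  with that show ?thesis by blast
qed

lemma sigma_deform_summable:
  assumes q: "norm q < 1" and c: "norm c < 1" and d: "norm d < 1"
  shows "summable (sigma_deform_term q c d)"
proof -
  obtain C where "\<And>c' d' n. norm c' \<le> max (norm c) (norm d) \<Longrightarrow> norm d' \<le> max (norm c) (norm d)
      \<Longrightarrow> norm (sigma_deform_term q c' d' n) \<le> C * norm q ^ n"
    using sigma_deform_term_bounded[OF q, of "max (norm c) (norm d)"] c d by auto
  hence "norm (sigma_deform_term q c d n) \<le> C * norm q ^ n" for n by simp
  thus ?thesis
    by (rule summable_comparison_test'[of "\<lambda>n. C * norm q ^ n" 0, rotated])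
      (use q in \<open>auto intro!: summable_mult summable_geometric\<close>)
qed

definition sigma_deform :: "complex \<Rightarrow> complex \<Rightarrow> complex \<Rightarrow> complex" where
  "sigma_deform q c d = (\<Sum>n. sigma_deform_term q c d n)"

lemma sigma_deform_tendsto:
  assumes q: "norm q < 1" and c: "norm c < 1" and d: "norm d < 1"
  shows "(\<lambda>m. sigma_deform q c (d * q ^ m)) \<longlonglongrightarrow> sigma_deform q c 0"
  unfolding sigma_deform_def
proof -
  obtain C where C: "\<And>c' d' n. norm c' \<le> max (norm c) (norm d) \<Longrightarrow> norm d' \<le> max (norm c) (norm d)
      \<Longrightarrow> norm (sigma_deform_term q c' d' n) \<le> C * norm q ^ n"
    using sigma_deform_term_bounded[OF q, of "max (norm c) (norm d)"] c d by auto
  have "(\<lambda>m. d * q ^ m) \<longlonglongrightarrow> d * 0"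
    by (intro tendsto_mult tendsto_const LIMSEQ_power_zero q)
  hence lim: "(\<lambda>m. d * q ^ m) \<longlonglongrightarrow> 0" by simp
  show "(\<lambda>m. \<Sum>n. sigma_deform_term q c (d * q ^ m) n) \<longlonglongrightarrow> (\<Sum>n. sigma_deform_term q c 0 n)"
  proof (rule tannery_sequentially[where M = "\<lambda>n. C * norm q ^ n"])
    show "(\<lambda>m. sigma_deform_term q c (d * q ^ m) n) \<longlonglongrightarrow> sigma_deform_term q c 0 n" for n
      unfolding sigma_deform_term_def qpoch_def
      by (intro tendsto_intros lim)
        (use qpoch_nonzero[OF q, of "-q" n] q norm_mult_power_lt_1[OF q c, of n] in \<open>auto simp: qpoch_def\<close>)
    show "norm (sigma_deform_term q c (d * q ^ m) n) \<le> C * norm q ^ n" for n m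
    proof (rule C)
      have "norm d * norm q ^ m \<le> norm d * 1"
        using q by (intro mult_left_mono power_le_one) auto
      thus "norm (d * q ^ m) \<le> max (norm c) (norm d)" by (simp add: norm_mult norm_power)
    qed auto
  qed (use q in \<open>auto intro!: summable_mult summable_geometric\<close>)
qed

text \<open>
  The combination of the two series telescopes. With \<open>y = q\<^sup>n\<close> the ratio of consecutive factors \<open>u\<^sub>n\<close> is
  rational in \<open>y\<close>, and \<open>d (1 + y) / (1 - dy)\<close> is the rational certificate that turns the difference
  of summands into \<open>G\<^sub>n\<^sub>+\<^sub>1 - G\<^sub>n\<close>; only \<open>G\<^sub>0 = 2d / (1 - d)\<close> survives.
\<close>
lemma sigma_deform_contiguous:
  assumes q: "norm q < 1" and c: "norm c < 1" and d: "norm d < 1"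
  shows "(1 + c * d) * sigma_deform q c (d * q) = (1 + d) * sigma_deform q c d - 2 * d / (1 - d)"
proof -
  define u where "u n = qpoch (-(c * d)) q n * q ^ (n * (n + 1) div 2) / qpoch (-q) q n" for n
  define G where "G n = u n * (d * (1 + q ^ n) / (1 - d * q ^ n))" for n
  have dq: "norm (d * q) < 1" using norm_mult_power_lt_1[OF q d, of 1] by simp
  have "norm (-(c * d)) < 1"
    using c d mult_strict_mono[of "norm c" 1 "norm d" 1] by (simp add: norm_mult)
  hence lim_u: "(\<lambda>n. u n) \<longlonglongrightarrow> 0"
  proof -
    have "(\<lambda>n. q ^ (n * (n + 1) div 2)) \<longlonglongrightarrow> 0"
      by (rule Lim_null_comparison[of _ "\<lambda>n. norm q ^ n"])
        (use q norm_power_triangle_le[OF q] in \<open>auto intro: LIMSEQ_power_zero\<close>)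
    hence "(\<lambda>n. u n) \<longlonglongrightarrow> qpoch_inf (-(c * d)) q * 0 / qpoch_inf (-q) q"
      unfolding u_def by (intro tendsto_divide tendsto_mult LIMSEQ_qpoch q qpoch_inf_nonzero) (use q in auto)
    thus ?thesis by simp
  qed
  have "(\<lambda>n. G n) \<longlonglongrightarrow> 0 * (d * (1 + 0) / (1 - d * 0))"
    unfolding G_def by (intro tendsto_mult tendsto_divide tendsto_add tendsto_diff tendsto_const lim_u LIMSEQ_power_zero q) auto
  hence "(\<lambda>n. G (Suc n) - G n) sums (0 - G 0)"
    by (intro telescope_sums) simp
  moreover have "G (Suc n) - G n
      = (1 + c * d) * sigma_deform_term q c (d * q) n - (1 + d) * sigma_deform_term q c d n" for n
  proof -
    define y where "y = q ^ n"
    have nz: "1 - c * y \<noteq> 0" "1 - d * y \<noteq> 0" "1 - d * q * y \<noteq> 0" "1 + q * y \<noteq> 0" "qpoch (-q) q n \<noteq> 0"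
    proof -
      show "1 - c * y \<noteq> 0" "1 - d * y \<noteq> 0" "1 - d * q * y \<noteq> 0"
        using norm_mult_power_lt_1[OF q c, of n] norm_mult_power_lt_1[OF q d, of n]
          norm_mult_power_lt_1[OF q dq, of n] by (auto simp: y_def)
      show "1 + q * y \<noteq> 0"
        using norm_mult_power_lt_1[OF q, of "-q" n] q one_minus_neq_0[of "- q * q ^ n"] by (simp add: y_def)
      show "qpoch (-q) q n \<noteq> 0" using qpoch_nonzero[OF q, of "-q"] q by simp
    qed
    have shift: "(1 + c * d) * qpoch (-(c * (d * q))) q n = qpoch (-(c * d)) q n * (1 + c * d * y)"
      using qpoch_Suc_left[of "-(c * d)" q n] by (simp add: qpoch_Suc y_def mult_ac)
    have uSuc: "u (Suc n) = u n * ((1 + c * d * y) * (q * y) / (1 + q * y))"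
      unfolding u_def power_triangle_Suc qpoch_Suc by (simp add: y_def)
    have y2: "q ^ (2 * n) = y ^ 2" by (simp add: y_def power_mult[symmetric] mult.commute)
    have "(1 + c * d) * sigma_deform_term q c (d * q) n
       = ((1 + c * d) * qpoch (-(c * (d * q))) q n) * (1 - c * (d * q) * y ^ 2) * q ^ (n * (n + 1) div 2)
       / (qpoch (-q) q n * (1 - c * y) * (1 - d * q * y))"
      by (simp add: sigma_deform_term_def y2 flip: y_def)
    also have "\<dots> = u n * ((1 + c * d * y) * (1 - c * d * q * y ^ 2) / ((1 - c * y) * (1 - d * q * y)))"
      unfolding shift by (simp add: u_def mult_ac)
    finally have 1: "(1 + c * d) * sigma_deform_term q c (d * q) n
      = u n * ((1 + c * d * y) * (1 - c * d * q * y ^ 2) / ((1 - c * y) * (1 - d * q * y)))" .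
    have 2: "(1 + d) * sigma_deform_term q c d n
      = u n * ((1 + d) * (1 - c * d * y ^ 2) / ((1 - c * y) * (1 - d * y)))"
      by (simp add: sigma_deform_term_def u_def y2 flip: y_def) (simp add: mult_ac)
    have 3: "G (Suc n) = u n * ((1 + c * d * y) * d * (q * y) / (1 - d * q * y))"
      unfolding G_def uSuc using nz by (simp add: mult_ac flip: y_def)
    have 4: "G n = u n * (d * (1 + y) / (1 - d * y))"
      by (simp add: G_def y_def)
    have "(1 + c * d * y) * d * (q * y) / (1 - d * q * y) - d * (1 + y) / (1 - d * y)
      = (1 + c * d * y) * (1 - c * d * q * y ^ 2) / ((1 - c * y) * (1 - d * q * y))
        - (1 + d) * (1 - c * d * y ^ 2) / ((1 - c * y) * (1 - d * y))"
      using nz by (simp add: divide_simps) algebra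
    thus ?thesis unfolding 1 2 3 4 by (simp only: right_diff_distrib[symmetric])
  qed
  moreover have "(\<lambda>n. (1 + c * d) * sigma_deform_term q c (d * q) n - (1 + d) * sigma_deform_term q c d n)
      sums ((1 + c * d) * sigma_deform q c (d * q) - (1 + d) * sigma_deform q c d)"
    unfolding sigma_deform_def
    by (intro sums_diff sums_mult summable_sums sigma_deform_summable q c d dq)
  ultimately have "0 - G 0 = (1 + c * d) * sigma_deform q c (d * q) - (1 + d) * sigma_deform q c d"
    using sums_unique2 by simp
  moreover have "G 0 = 2 * d / (1 - d)" by (simp add: G_def u_def)
  ultimately show ?thesis by (simp add: algebra_simps)
qed

text \<open>
  With this prefactor the contiguous relation acquires the coefficient \<open>1 - d\<close>, whose product over
  \<open>d, dq, dq\<^sup>2, \<dots>\<close> is \<open>(d)\<^sub>\<infinity>\<close>, and an inhomogeneous term that depends on infinite products only.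
\<close>
definition sigma_normalised :: "complex \<Rightarrow> complex \<Rightarrow> complex \<Rightarrow> complex" where
  "sigma_normalised q c d = qpoch_inf (-c) q * qpoch_inf (-d) q
     / (qpoch_inf c q * qpoch_inf d q * qpoch_inf (-(c * d)) q) * sigma_deform q c d"

lemma norm_mult_lt_1:
  fixes c d :: complex
  assumes "norm c < 1" "norm d < 1"
  shows "norm (c * d) < 1"
  using assms mult_strict_mono[of "norm c" 1 "norm d" 1] by (simp add: norm_mult)

lemma sigma_normalised_contiguous:
  assumes q: "norm q < 1" and c: "norm c < 1" and d: "norm d < 1"
  shows "sigma_normalised q c (d * q) = (1 - d) * sigma_normalised q c d
    - 2 * d * (qpoch_inf (-c) q * qpoch_inf (-(d * q)) q
        / (qpoch_inf c q * qpoch_inf d q * qpoch_inf (-(c * d)) q))"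
proof -
  have cd: "norm (-(c * d)) < 1" using norm_mult_lt_1[OF c d] by simp
  have nz: "qpoch_inf c q \<noteq> 0" "qpoch_inf d q \<noteq> 0" "qpoch_inf (-(c * d)) q \<noteq> 0"
    using qpoch_inf_nonzero q c d cd by auto
  have s: "qpoch_inf d q = (1 - d) * qpoch_inf (d * q) q" "qpoch_inf (-d) q = (1 + d) * qpoch_inf (-(d * q)) q"
     "qpoch_inf (-(c * d)) q = (1 + c * d) * qpoch_inf (-(c * (d * q))) q"
    using qpoch_inf_step[OF q, of d] qpoch_inf_step[OF q, of "-d"] qpoch_inf_step[OF q, of "-(c*d)"]
    by (simp_all add: mult_ac)
  have nz': "1 - d \<noteq> 0" "1 + c * d \<noteq> 0" "qpoch_inf (d * q) q \<noteq> 0" "qpoch_inf (-(c * (d * q))) q \<noteq> 0"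
    using nz s by auto
  define K where "K = qpoch_inf (-c) q * qpoch_inf (-(d * q)) q / (qpoch_inf c q * qpoch_inf d q * qpoch_inf (-(c * d)) q)"
  have 1: "sigma_normalised q c (d * q) = K * (1 - d) * ((1 + c * d) * sigma_deform q c (d * q))"
    unfolding sigma_normalised_def K_def s using nz nz' by (simp add: divide_simps)
  have 2: "sigma_normalised q c d = K * ((1 + d) * sigma_deform q c d)"
    unfolding sigma_normalised_def K_def s(2) by simp
  have "sigma_normalised q c (d * q) = (1 - d) * (K * ((1 + d) * sigma_deform q c d)) - 2 * d * K"
    unfolding 1 sigma_deform_contiguous[OF q c d] using nz' by (simp add: divide_simps) (simp add: algebra_simps)
  thus ?thesis unfolding 2 K_def .
qed

lemma sigma_normalised_tendsto:
  assumes q: "norm q < 1" and c: "norm c < 1" and d: "norm d < 1"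
  shows "(\<lambda>m. sigma_normalised q c (d * q ^ m)) \<longlonglongrightarrow> sigma_normalised q c 0"
proof -
  have cd: "norm (-(c * d)) < 1" using norm_mult_lt_1[OF c d] by simp
  have "(\<lambda>m. qpoch_inf (-c) q * qpoch_inf (-d * q ^ m) q
     / (qpoch_inf c q * qpoch_inf (d * q ^ m) q * qpoch_inf (-(c * d) * q ^ m) q) * sigma_deform q c (d * q ^ m))
     \<longlonglongrightarrow> qpoch_inf (-c) q * 1 / (qpoch_inf c q * 1 * 1) * sigma_deform q c 0"
    by (intro tendsto_mult tendsto_divide tendsto_const qpoch_inf_shift_tendsto_1 sigma_deform_tendsto q c d cd)
      (use d qpoch_inf_nonzero[OF q c] in auto)
  thus ?thesis by (simp add: sigma_normalised_def mult_ac)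
qed

lemma sigma_normalised_commute: "sigma_normalised q c d = sigma_normalised q d c"
  by (simp add: sigma_normalised_def sigma_deform_def sigma_deform_term_def mult_ac)

lemma sigma_normalised_0_0: "sigma_normalised q 0 0 = ramanujan_sigma q"
  by (simp add: sigma_normalised_def sigma_deform_def sigma_deform_term_def ramanujan_sigma_def qpoch_def)

section \<open>Linear functionals on power series\<close>

definition weighted_summable :: "real \<Rightarrow> complex fps \<Rightarrow> bool" where
  "weighted_summable \<rho> f \<longleftrightarrow> summable (\<lambda>n. norm (fps_nth f n) * \<rho> ^ n)"

definition fps_pairing :: "(nat \<Rightarrow> complex) \<Rightarrow> complex fps \<Rightarrow> complex" where
  "fps_pairing g f = (\<Sum>n. fps_nth f n * g n)"

lemma weighted_summable_add:
  assumes "\<rho> \<ge> 0" "weighted_summable \<rho> f" "weighted_summable \<rho> g"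
  shows "weighted_summable \<rho> (f + g)"
  unfolding weighted_summable_def
proof (rule summable_comparison_test'[OF summable_add[OF assms(2,3)[unfolded weighted_summable_def]], of 0])
  fix n
  have "norm (fps_nth (f + g) n) * \<rho> ^ n \<le> (norm (fps_nth f n) + norm (fps_nth g n)) * \<rho> ^ n"
    using assms by (intro mult_right_mono) (auto intro: norm_triangle_ineq)
  thus "norm (norm (fps_nth (f + g) n) * \<rho> ^ n) \<le> norm (fps_nth f n) * \<rho> ^ n + norm (fps_nth g n) * \<rho> ^ n"
    using assms by (simp add: algebra_simps)
qed

lemma weighted_summable_mult:
  assumes "\<rho> \<ge> 0" "weighted_summable \<rho> f" "weighted_summable \<rho> g"
  shows "weighted_summable \<rho> (f * g)"
  unfolding weighted_summable_def
proof (rule summable_comparison_test')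
  show "summable (\<lambda>n. \<Sum>i\<le>n. (norm (fps_nth f i) * \<rho> ^ i) * (norm (fps_nth g (n - i)) * \<rho> ^ (n - i)))"
    by (rule summable_Cauchy_product) (use assms in \<open>simp_all add: weighted_summable_def\<close>)
  fix n
  have "norm (fps_nth (f * g) n) \<le> (\<Sum>i\<le>n. norm (fps_nth f i) * norm (fps_nth g (n - i)))"
    unfolding fps_mult_nth atMost_atLeast0 by (intro sum_norm_le) (simp add: norm_mult)
  hence "norm (fps_nth (f * g) n) * \<rho> ^ n \<le> (\<Sum>i\<le>n. norm (fps_nth f i) * norm (fps_nth g (n - i))) * \<rho> ^ n"
    using assms by (intro mult_right_mono) auto
  also have "\<dots> = (\<Sum>i\<le>n. (norm (fps_nth f i) * \<rho> ^ i) * (norm (fps_nth g (n - i)) * \<rho> ^ (n - i)))"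
    unfolding sum_distrib_right
  proof (rule sum.cong)
    fix i assume "i \<in> {..n}"
    hence "\<rho> ^ n = \<rho> ^ i * \<rho> ^ (n - i)" by (simp flip: power_add)
    thus "norm (fps_nth f i) * norm (fps_nth g (n - i)) * \<rho> ^ n
      = (norm (fps_nth f i) * \<rho> ^ i) * (norm (fps_nth g (n - i)) * \<rho> ^ (n - i))" by simp
  qed simp
  finally show "norm (norm (fps_nth (f * g) n) * \<rho> ^ n)
     \<le> (\<Sum>i\<le>n. (norm (fps_nth f i) * \<rho> ^ i) * (norm (fps_nth g (n - i)) * \<rho> ^ (n - i)))"
    using assms by simp
qed

lemma weighted_summable_const: "weighted_summable \<rho> (fps_const a)"
  unfolding weighted_summable_def by (rule summable_finite[of "{0}"]) auto

lemma weighted_summable_X: "weighted_summable \<rho> fps_X"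
  unfolding weighted_summable_def by (rule summable_finite[of "{1}"]) (auto simp: fps_X_def)

lemma weighted_summable_1: "weighted_summable \<rho> 1"
  using weighted_summable_const[of \<rho> 1] by simp

lemmas weighted_summable_intros = weighted_summable_add weighted_summable_mult weighted_summable_const
  weighted_summable_X weighted_summable_1

lemma fps_pairing_summable:
  assumes "weighted_summable \<rho> f" "\<And>n. norm (g n) \<le> C * \<rho> ^ n"
  shows "summable (\<lambda>n. fps_nth f n * g n)"
proof (rule summable_comparison_test')
  show "summable (\<lambda>n. C * (norm (fps_nth f n) * \<rho> ^ n))"
    using assms(1) by (intro summable_mult) (simp add: weighted_summable_def)
  show "norm (fps_nth f n * g n) \<le> C * (norm (fps_nth f n) * \<rho> ^ n)" if "n \<ge> 0" for n
    using mult_left_mono[OF assms(2)[of n], of "norm (fps_nth f n)"] by (simp add: norm_mult mult_ac)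
qed

lemma fps_pairing_add:
  assumes "weighted_summable \<rho> f" "weighted_summable \<rho> f'" "\<And>n. norm (g n) \<le> C * \<rho> ^ n"
  shows "fps_pairing g (f + f') = fps_pairing g f + fps_pairing g f'"
  unfolding fps_pairing_def
  by (simp add: distrib_right suminf_add[OF fps_pairing_summable[OF assms(1,3)] fps_pairing_summable[OF assms(2,3)]])

lemma fps_pairing_const_mult:
  assumes "weighted_summable \<rho> f" "\<And>n. norm (g n) \<le> C * \<rho> ^ n"
  shows "fps_pairing g (fps_const a * f) = a * fps_pairing g f"
  unfolding fps_pairing_def
  by (simp add: mult.assoc suminf_mult[OF fps_pairing_summable[OF assms]])

lemma fps_pairing_X_mult:
  assumes "weighted_summable \<rho> f" "\<And>n. norm (g n) \<le> C * \<rho> ^ n" "\<rho> \<ge> 0"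
  shows "fps_pairing g (fps_X * f) = fps_pairing (\<lambda>n. g (Suc n)) f"
proof -
  have "summable (\<lambda>n. fps_nth (fps_X * f) n * g n)"
    by (intro fps_pairing_summable[OF _ assms(2)] weighted_summable_intros assms)
  from suminf_split_head[OF this] show ?thesis by (simp add: fps_pairing_def)
qed

text \<open>
  Pairing with a product unfolds into an iterated sum in which the two indices are added; this is how
  formal power series in one variable encode the multiple series of the theorem.
\<close>
lemma fps_pairing_mult:
  assumes f: "weighted_summable \<rho> f" and f': "weighted_summable \<rho> f'"
    and g: "\<And>n. norm (g n) \<le> C * \<rho> ^ n" and \<rho>: "\<rho> \<ge> 0"
  shows "fps_pairing g (f * f') = (\<Sum>i. fps_nth f i * (\<Sum>j. fps_nth f' j * g (i + j)))"
proof -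
  have C: "C \<ge> 0" using g[of 0] by (metis norm_ge_zero mult.right_neutral order_trans power_0)
  have "(\<lambda>n. \<Sum>i\<le>n. fps_nth f i * (fps_nth f' (n - i) * g (i + (n - i))))
      sums (\<Sum>i. \<Sum>j. fps_nth f i * (fps_nth f' j * g (i + j)))"
  proof (rule suminf_diagonals[where a = "\<lambda>i. C * (norm (fps_nth f i) * \<rho> ^ i)"
        and b = "\<lambda>j. norm (fps_nth f' j) * \<rho> ^ j"])
    fix i j
    have "norm (fps_nth f i * (fps_nth f' j * g (i + j))) \<le> norm (fps_nth f i) * (norm (fps_nth f' j) * (C * \<rho> ^ (i + j)))"
      unfolding norm_mult by (intro mult_left_mono g) auto
    thus "norm (fps_nth f i * (fps_nth f' j * g (i + j)))
      \<le> C * (norm (fps_nth f i) * \<rho> ^ i) * (norm (fps_nth f' j) * \<rho> ^ j)"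
      by (simp add: power_add mult_ac)
  qed (use f f' C \<rho> in \<open>auto simp: weighted_summable_def intro!: summable_mult\<close>)
  moreover have "(\<Sum>i\<le>n. fps_nth f i * (fps_nth f' (n - i) * g (i + (n - i)))) = fps_nth (f * f') n * g n" for n
    unfolding fps_mult_nth sum_distrib_right atMost_atLeast0 by (rule sum.cong) auto
  moreover have "summable (\<lambda>j. fps_nth f' j * g (i + j))" for i
  proof (rule fps_pairing_summable[OF f'])
    show "norm (g (i + n)) \<le> C * \<rho> ^ i * \<rho> ^ n" for n
      using g[of "i + n"] by (simp add: power_add mult.assoc)
  qed
  ultimately show ?thesis
    by (simp add: fps_pairing_def sums_iff suminf_mult)
qed

section \<open>The sequence that represents sigma\<close>

definition qpoch_partial_sum :: "complex \<Rightarrow> nat \<Rightarrow> complex" where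
  "qpoch_partial_sum q N = (\<Sum>r\<le>N. qpoch (-1) q r)"

definition sigma_seq :: "complex \<Rightarrow> nat \<Rightarrow> complex" where
  "sigma_seq q N = qpoch_partial_sum q N / qpoch (-q) q N"

lemma sigma_seq_0 [simp]: "sigma_seq q 0 = 1"
  by (simp add: sigma_seq_def qpoch_partial_sum_def)

text \<open>
  Apart from a growth bound, this recurrence is all that the contiguous relation of
  \<open>kernel_value\<close> uses. It holds because \<open>(-1)\<^sub>N\<^sub>+\<^sub>1 = 2 (-q)\<^sub>N\<close>.
\<close>
lemma sigma_seq_Suc:
  assumes "norm q < 1"
  shows "(1 + q ^ Suc N) * sigma_seq q (Suc N) = sigma_seq q N + 2"
proof -
  have "qpoch (-q) q (Suc N) \<noteq> 0" using qpoch_nonzero[OF assms, of "-q"] assms by simp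
  hence nz: "qpoch (-q) q N \<noteq> 0" "1 + q * q ^ N \<noteq> 0" by (auto simp: qpoch_Suc)
  have "qpoch_partial_sum q (Suc N) = qpoch_partial_sum q N + 2 * qpoch (-q) q N"
    by (simp add: qpoch_partial_sum_def qpoch_Suc_left)
  thus ?thesis using nz
    by (simp add: sigma_seq_def qpoch_Suc divide_simps)
qed

text \<open>
  The terms \<open>(-1)\<^sub>r\<close> tend to a nonzero limit, so that the sequence grows linearly. A weight \<open>\<rho>\<^sup>N\<close> with
  \<open>\<rho> > 1\<close> as close to \<open>1\<close> as desired absorbs this growth.
\<close>
lemma sigma_seq_bound:
  assumes q: "norm q < 1" and \<rho>: "\<rho> > 1"
  obtains C where "C > 0" "\<And>N. norm (sigma_seq q N) \<le> C * \<rho> ^ N"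
proof -
  obtain C where C: "C > 0" "\<And>a n. norm a \<le> 1 \<Longrightarrow> norm (qpoch a q n) \<le> C"
    using qpoch_bounded[OF q] by blast
  obtain D where D: "D > 0" "\<And>n. norm (1 / qpoch (-q) q n) \<le> D"
    using inverse_qpoch_bounded[OF q, of "-q"] q by auto
  \<comment> \<open>Bernoulli: \<open>1 + N (\<rho> - 1) \<le> \<rho>\<^sup>N\<close>, which bounds \<open>N + 1\<close> by this multiple of \<open>\<rho>\<^sup>N\<close>\<close>
  define L where "L = 1 + 1 / (\<rho> - 1)"
  have L: "L > 0" using \<rho> by (simp add: L_def add_pos_pos)
  have lin: "real (Suc N) \<le> L * \<rho> ^ N" for N
  proof -
    have "1 + real N * (\<rho> - 1) \<le> \<rho> ^ N"
      using Bernoulli_inequality[of "\<rho> - 1" N] \<rho> by simp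
    hence "real N \<le> \<rho> ^ N / (\<rho> - 1)" using \<rho> by (simp add: pos_le_divide_eq)
    moreover have "1 \<le> \<rho> ^ N" using \<rho> by (simp add: one_le_power)
    ultimately show ?thesis by (simp add: L_def algebra_simps)
  qed
  have "norm (sigma_seq q N) \<le> (C * D * L) * \<rho> ^ N" for N
  proof -
    have "norm (qpoch_partial_sum q N) \<le> real (card {..N}) * C"
      unfolding qpoch_partial_sum_def by (rule sum_norm_bound) (use C in auto)
    also have "\<dots> \<le> (L * \<rho> ^ N) * C" using lin[of N] C by (intro mult_right_mono) auto
    finally have "norm (qpoch_partial_sum q N) * norm (1 / qpoch (-q) q N) \<le> (L * \<rho> ^ N * C) * D"
      using L C \<rho> by (intro mult_mono D) auto
    thus ?thesis by (simp add: sigma_seq_def norm_divide mult_ac)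
  qed
  with that C D L show ?thesis by (metis mult_pos_pos)
qed

section \<open>The kernel and its contiguous relation\<close>

definition ratio_fps :: "complex \<Rightarrow> complex \<Rightarrow> complex fps" where
  "ratio_fps q d = Abs_fps (\<lambda>j. ratio_coeff q j * d ^ j)"

definition euler_fps :: "complex \<Rightarrow> complex \<Rightarrow> complex fps" where
  "euler_fps q z = Abs_fps (\<lambda>M. z ^ M / qpoch q q M)"

lemma ratio_fps_dilate: "ratio_fps q d oo (fps_const q * fps_X) = ratio_fps q (d * q)"
  unfolding ratio_fps_def fps_compose_linear by (simp add: power_mult_distrib mult_ac)

lemma euler_fps_dilate: "euler_fps q d oo (fps_const q * fps_X) = euler_fps q (d * q)"
  unfolding euler_fps_def fps_compose_linear by (simp add: power_mult_distrib mult_ac)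

lemma ratio_fps_contiguous:
  assumes q: "norm q < 1"
  shows "ratio_fps q (d * q) * (1 + fps_const (d * q) * fps_X) = (1 - fps_const d * fps_X) * ratio_fps q d"
proof (rule fps_ext)
  fix n
  show "fps_nth (ratio_fps q (d * q) * (1 + fps_const (d * q) * fps_X)) n
     = fps_nth ((1 - fps_const d * fps_X) * ratio_fps q d) n"
  proof (cases n)
    case (Suc m)
    have rec: "ratio_coeff q (Suc m) * (1 - q ^ Suc m) = ratio_coeff q m * (1 + q ^ Suc m)"
      using qpoch_nonzero[OF q q, of m] qpoch_nonzero[OF q q, of "Suc m"]
      by (simp add: ratio_coeff_def qpoch_Suc divide_simps)
    have "ratio_coeff q (Suc m) * (d * q) ^ Suc m + ratio_coeff q m * (d * q) ^ m * (d * q)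
        = d ^ Suc m * (ratio_coeff q m * (1 + q ^ Suc m) - ratio_coeff q (Suc m) * (1 - q ^ Suc m))
          + d ^ Suc m * (ratio_coeff q (Suc m) - ratio_coeff q m)"
      by (simp add: power_mult_distrib algebra_simps)
    also have "\<dots> = d ^ Suc m * (ratio_coeff q (Suc m) - ratio_coeff q m)"
      unfolding rec by simp
    finally show ?thesis
      unfolding Suc
      by (simp add: ratio_fps_def distrib_left left_diff_distrib mult.assoc[symmetric] fps_mult_fps_X_commute)
         (simp add: mult.assoc algebra_simps)
  qed (simp add: ratio_fps_def)
qed

lemma euler_fps_contiguous:
  assumes q: "norm q < 1"
  shows "euler_fps q (z * q) = (1 - fps_const z * fps_X) * euler_fps q z"
proof (rule fps_ext)
  fix n
  show "fps_nth (euler_fps q (z * q)) n = fps_nth ((1 - fps_const z * fps_X) * euler_fps q z) n"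
  proof (cases n)
    case (Suc m)
    have "qpoch q q m \<noteq> 0" "qpoch q q (Suc m) \<noteq> 0" using qpoch_nonzero[OF q q] by blast+
    thus ?thesis unfolding Suc
      by (simp add: euler_fps_def left_diff_distrib mult.assoc qpoch_Suc power_mult_distrib divide_simps)
        (simp add: algebra_simps)
  qed (simp add: euler_fps_def)
qed

lemma weighted_summable_ratio_fps:
  assumes q: "norm q < 1" and \<rho>: "\<rho> \<ge> 0" and d: "norm d * \<rho> < 1"
  shows "weighted_summable \<rho> (ratio_fps q d)"
proof -
  obtain C where C: "\<And>n. norm (ratio_coeff q n) \<le> C" using ratio_coeff_bounded[OF q] by blast
  have "summable (\<lambda>n. norm (ratio_coeff q n * (d * of_real \<rho>) ^ n))"
    by (rule summable_bounded_mult_power[OF C]) (use \<rho> d in \<open>simp add: norm_mult\<close>)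
  thus ?thesis using \<rho>
    by (simp add: weighted_summable_def ratio_fps_def norm_mult norm_power power_mult_distrib mult.assoc)
qed

lemma weighted_summable_euler_fps:
  assumes q: "norm q < 1" and \<rho>: "\<rho> \<ge> 0" and d: "norm d * \<rho> < 1"
  shows "weighted_summable \<rho> (euler_fps q d)"
proof -
  obtain C where C: "\<And>n. norm (1 / qpoch q q n) \<le> C" using inverse_qpoch_bounded[OF q q] by blast
  have "summable (\<lambda>n. norm (1 / qpoch q q n * (d * of_real \<rho>) ^ n))"
    by (rule summable_bounded_mult_power[OF C]) (use \<rho> d in \<open>simp add: norm_mult\<close>)
  thus ?thesis using \<rho>
    by (simp add: weighted_summable_def euler_fps_def norm_mult norm_power norm_divide power_mult_distrib mult_ac)
qed

definition kernel_fps :: "complex \<Rightarrow> complex \<Rightarrow> complex \<Rightarrow> complex fps" where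
  "kernel_fps q c d = ratio_fps q d * (ratio_fps q c * euler_fps q (-(c * d)))"

text \<open>
  The contiguous relation of the kernel, reduced to algebra. The letters stand for the factors of the
  kernel: \<open>D\<close>, \<open>E\<close>, \<open>P\<close> at the parameters \<open>d\<close>, \<open>c\<close>, \<open>-cd\<close>, and \<open>D1\<close>, \<open>E1\<close>, \<open>P1\<close> at these
  parameters times \<open>q\<close>. With \<open>f = d (1 + cX) D E P\<close> and \<open>h = X f\<close>, it says that the kernel at \<open>(c,dq)\<close>
  minus \<open>1 - d\<close> times the kernel at \<open>(c,d)\<close> is \<open>f(X) - h(X) - h(qX)\<close>. The multiplier \<open>d (1 + cX)\<close>
  is found by comparing coefficients of \<open>X\<close>.
\<close>
lemma kernel_telescoping_identity:
  fixes D D1 E E1 P P1 X c d q :: "'a :: idom"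
  assumes D: "D1 * (1 + d * q * X) = (1 - d * X) * D" and E: "E1 * (1 + c * q * X) = (1 - c * X) * E"
    and P: "P1 = (1 + c * d * X) * P" and nz: "1 + d * q * X \<noteq> 0"
  shows "(D1 * (E * P1) + c * (d * q) * (X * (X * (D1 * (E * P1)))))
       + (X * (d * ((1 + c * X) * (D * (E * P)))) + q * X * (d * ((1 + c * (q * X)) * (D1 * (E1 * P1)))))
     = (1 - d) * (D * (E * P) + c * d * (X * (X * (D * (E * P))))) + d * ((1 + c * X) * (D * (E * P)))"
    (is "?l = ?r")
proof -
  have "(1 + c * (q * X)) * (D1 * (E1 * P1)) = D1 * ((E1 * (1 + c * q * X)) * P1)"
    by (simp add: algebra_simps)
  hence E': "(1 + c * (q * X)) * (D1 * (E1 * P1)) = D1 * ((1 - c * X) * E * P1)"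
    unfolding E .
  \<comment> \<open>\<open>U\<close> collects the factors of \<open>D1\<close>, so that the relation for \<open>D1\<close> is used exactly once\<close>
  define U where "U = E * P1 * (1 + c * d * q * X * X + d * q * X * (1 - c * X))"
  define W where "W = d * X * (1 + c * X) * D * E * P"
  have l: "?l = D1 * U + W"
    unfolding E' U_def W_def by (simp add: algebra_simps)
  have "(1 + d * q * X) * ?l = (D1 * (1 + d * q * X)) * U + (1 + d * q * X) * W"
    unfolding l by (simp add: algebra_simps)
  also have "\<dots> = (1 + d * q * X) * ?r"
    unfolding D U_def W_def P by (simp add: algebra_simps)
  finally have "(1 + d * q * X) * ?l = (1 + d * q * X) * ?r" .
  thus ?thesis using nz by simp
qed

lemma weighted_summable_dilate:
  assumes q: "norm q < 1" and \<rho>: "\<rho> \<ge> 0" and f: "weighted_summable \<rho> f"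
  shows "weighted_summable \<rho> (f oo (fps_const q * fps_X))"
  unfolding weighted_summable_def fps_compose_linear
proof (rule summable_comparison_test'[OF f[unfolded weighted_summable_def], of 0])
  fix n
  have "norm q ^ n * (norm (fps_nth f n) * \<rho> ^ n) \<le> 1 * (norm (fps_nth f n) * \<rho> ^ n)"
    using q \<rho> by (intro mult_right_mono power_le_one) auto
  thus "norm (norm (fps_nth (Abs_fps (\<lambda>n. q ^ n * fps_nth f n)) n) * \<rho> ^ n) \<le> norm (fps_nth f n) * \<rho> ^ n"
    using \<rho> by (simp add: norm_mult norm_power mult_ac)
qed

text \<open>
  The recurrence of the sequence in dual form: the functional applied to \<open>h(x) + h(qx)\<close> with
  \<open>h(x) = x f(x)\<close> returns its value at \<open>f\<close> plus \<open>2 f(1)\<close>.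
\<close>
lemma sigma_seq_pairing_shift:
  assumes q: "norm q < 1" and \<rho>: "\<rho> > 1" and f: "weighted_summable \<rho> f"
  shows "fps_pairing (sigma_seq q) (fps_X * f + ((fps_X * f) oo (fps_const q * fps_X)))
       = fps_pairing (sigma_seq q) f + 2 * fps_pairing (\<lambda>_. 1) f"
proof -
  obtain C where C: "\<And>N. norm (sigma_seq q N) \<le> C * \<rho> ^ N"
    using sigma_seq_bound[OF q \<rho>] by blast
  define h where "h = fps_X * f + ((fps_X * f) oo (fps_const q * fps_X))"
  have h0: "fps_nth h 0 = 0" and hSuc: "fps_nth h (Suc n) = (1 + q ^ Suc n) * fps_nth f n" for n
    unfolding h_def fps_compose_linear by (simp_all add: algebra_simps)
  have "weighted_summable \<rho> h"
    unfolding h_def using \<rho> by (intro weighted_summable_intros weighted_summable_dilate q f) auto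
  from suminf_split_head[OF fps_pairing_summable[OF this C]]
  have "fps_pairing (sigma_seq q) h = (\<Sum>n. fps_nth h (Suc n) * sigma_seq q (Suc n))"
    by (simp add: fps_pairing_def h0)
  also have "\<dots> = (\<Sum>n. fps_nth f n * sigma_seq q n + 2 * (fps_nth f n * 1))"
  proof (rule suminf_cong)
    fix n
    have "fps_nth h (Suc n) * sigma_seq q (Suc n) = fps_nth f n * ((1 + q ^ Suc n) * sigma_seq q (Suc n))"
      by (simp only: hSuc mult_ac)
    thus "fps_nth h (Suc n) * sigma_seq q (Suc n) = fps_nth f n * sigma_seq q n + 2 * (fps_nth f n * 1)"
      unfolding sigma_seq_Suc[OF q] by (simp add: algebra_simps)
  qed
  also have "\<dots> = fps_pairing (sigma_seq q) f + 2 * fps_pairing (\<lambda>_. 1) f"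
  proof -
    have "summable (\<lambda>n. fps_nth f n * 1)"
      by (rule fps_pairing_summable[OF f, of _ 1]) (use \<rho> in \<open>auto simp: one_le_power\<close>)
    thus ?thesis
      unfolding fps_pairing_def
      by (subst suminf_add[symmetric]) (auto intro: fps_pairing_summable[OF f C] summable_mult simp: suminf_mult)
  qed
  finally show ?thesis by (simp add: h_def)
qed

text \<open>
  The weight has to exceed \<open>1\<close> to dominate the linearly growing sequence and must still keep all
  geometric series of the kernel convergent.
\<close>
lemma exists_common_radius:
  fixes c d :: complex
  assumes c: "norm c < 1" and d: "norm d < 1"
  obtains \<rho> :: real where "\<rho> > 1" "norm c * \<rho> < 1" "norm d * \<rho> < 1" "norm (c * d) * \<rho> < 1"
proof -
  define m where "m = max (norm c) (norm d)"
  \<comment> \<open>any value strictly between \<open>1\<close> and \<open>1 / m\<close> would do; this one also makes sense for \<open>m = 0\<close>\<close>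
  define \<rho> where "\<rho> = 2 / (1 + m)"
  have m: "0 \<le> m" "m < 1" using c d by (auto simp: m_def le_max_iff_disj)
  have \<rho>: "\<rho> > 1" using m by (simp add: \<rho>_def)
  have m\<rho>: "m * \<rho> < 1" using m by (simp add: \<rho>_def field_simps)
  have le: "x * \<rho> < 1" if "x \<le> m" for x
    using mult_right_mono[OF that, of \<rho>] \<rho> m\<rho> by linarith
  have "norm (c * d) \<le> norm c * 1"
    unfolding norm_mult by (intro mult_left_mono) (use d in auto)
  hence "norm c \<le> m" "norm d \<le> m" "norm (c * d) \<le> m" by (auto simp: m_def)
  with le that[OF \<rho>] show ?thesis by blast
qed

lemma weighted_summable_kernel:
  assumes "norm q < 1" "\<rho> \<ge> 0" "norm c * \<rho> < 1" "norm d * \<rho> < 1" "norm (c * d) * \<rho> < 1"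
  shows "weighted_summable \<rho> (kernel_fps q c d)"
  unfolding kernel_fps_def
  by (intro weighted_summable_mult weighted_summable_ratio_fps weighted_summable_euler_fps) (use assms in auto)

lemma kernel_fps_at_1:
  assumes q: "norm q < 1" and c: "norm c < 1" and d: "norm d < 1"
  shows "fps_pairing (\<lambda>_. 1) (kernel_fps q c d) =
    qpoch_inf (-(c * q)) q * qpoch_inf (-(d * q)) q / (qpoch_inf c q * qpoch_inf d q * qpoch_inf (-(c * d)) q)"
proof -
  have cd: "norm (-(c * d)) < 1" using norm_mult_lt_1[OF c d] by simp
  have ws: "weighted_summable 1 (ratio_fps q c)" "weighted_summable 1 (ratio_fps q d)"
     "weighted_summable 1 (euler_fps q (-(c * d)))"
    using q c d cd by (auto intro!: weighted_summable_ratio_fps weighted_summable_euler_fps)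
  have nth: "fps_nth (ratio_fps q x) = (\<lambda>j. ratio_coeff q j * x ^ j)" for x
    by (simp add: ratio_fps_def fun_eq_iff)
  have val: "(\<Sum>i. fps_nth (ratio_fps q x) i) = qpoch_inf (-(x * q)) q / qpoch_inf x q"
      "summable (fps_nth (ratio_fps q x))" if "norm x < 1" for x
    using ratio_coeff_sums[OF q that] by (auto simp: nth sums_iff)
  have val_e: "(\<Sum>i. fps_nth (euler_fps q (-(c * d))) i) = 1 / qpoch_inf (-(c * d)) q"
    using inverse_qpoch_inf_sums[OF q cd] by (simp add: euler_fps_def sums_iff)
  have "(\<Sum>j. fps_nth (ratio_fps q c * euler_fps q (-(c * d))) j) = qpoch_inf (-(c * q)) q / qpoch_inf c q * (1 / qpoch_inf (-(c * d)) q)"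
    using fps_pairing_mult[OF ws(1,3), of "\<lambda>_. 1" 1]
    by (simp only: fps_pairing_def mult_1_right val_e suminf_mult2[OF val(2)[OF c], symmetric] val(1)[OF c]) simp
  moreover have "fps_pairing (\<lambda>_. 1) (kernel_fps q c d)
      = (\<Sum>i. fps_nth (ratio_fps q d) i * (\<Sum>j. fps_nth (ratio_fps q c * euler_fps q (-(c * d))) j))"
    unfolding kernel_fps_def
    using fps_pairing_mult[OF ws(2) weighted_summable_mult[OF _ ws(1,3)], of "\<lambda>_. 1" 1] by simp
  ultimately show ?thesis
    by (simp only: suminf_mult2[OF val(2)[OF d], symmetric] val(1)[OF d]) (simp add: mult_ac)
qed

text \<open>
  The factor \<open>1 + cdx\<^sup>2\<close> stays outside \<open>kernel_fps\<close>, so that the latter is a product of series whose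
  parameters simply scale when \<open>x\<close> is replaced by \<open>qx\<close>.
\<close>
definition kernel_value :: "complex \<Rightarrow> complex \<Rightarrow> complex \<Rightarrow> complex" where
  "kernel_value q c d = fps_pairing (sigma_seq q)
     (kernel_fps q c d + fps_const (c * d) * (fps_X * (fps_X * kernel_fps q c d)))"

text \<open>
  Apply the functional to the contiguous relation of the kernel. The terms \<open>f\<close> cancel by the dual
  recurrence and leave \<open>-2 f(1)\<close>, which the q-binomial theorem evaluates as infinite products.
\<close>
lemma kernel_value_contiguous:
  assumes q: "norm q < 1" and c: "norm c < 1" and d: "norm d < 1"
  shows "kernel_value q c (d * q) = (1 - d) * kernel_value q c d
    - 2 * d * (qpoch_inf (-c) q * qpoch_inf (-(d * q)) q
        / (qpoch_inf c q * qpoch_inf d q * qpoch_inf (-(c * d)) q))"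
proof -
  obtain \<rho> where \<rho>: "\<rho> > 1" and r: "norm c * \<rho> < 1" "norm d * \<rho> < 1" "norm (c * d) * \<rho> < 1"
    using exists_common_radius[OF c d] .
  have shrink: "norm (x * q) * \<rho> < 1" if "norm x * \<rho> < 1" for x
  proof -
    have "norm (x * q) * \<rho> \<le> norm x * 1 * \<rho>"
      unfolding norm_mult by (intro mult_left_mono mult_right_mono) (use q \<rho> in auto)
    with that show ?thesis by simp
  qed
  have r': "norm (d * q) * \<rho> < 1" "norm (c * (d * q)) * \<rho> < 1"
    using shrink[OF r(2)] shrink[OF r(3)] by (simp_all add: mult.assoc)
  obtain C where C: "\<And>N. norm (sigma_seq q N) \<le> C * \<rho> ^ N"
    using sigma_seq_bound[OF q \<rho>] by blast
  let ?X = "fps_X :: complex fps" and ?c = "fps_const c" and ?d = "fps_const d" and ?q = "fps_const q"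
  define K where "K = kernel_fps q c d"
  define K1 where "K1 = kernel_fps q c (d * q)"
  have wK: "weighted_summable \<rho> K" and wK1: "weighted_summable \<rho> K1"
    unfolding K_def K1_def using q r r' \<rho> by (auto intro!: weighted_summable_kernel)
  define f where "f = ?d * ((1 + ?c * ?X) * K)"
  have wf: "weighted_summable \<rho> f"
    unfolding f_def using \<rho> by (intro weighted_summable_intros wK) auto
  define F where "F = K + fps_const (c * d) * (?X * (?X * K))"
  define F1 where "F1 = K1 + fps_const (c * (d * q)) * (?X * (?X * K1))"
  have wF: "weighted_summable \<rho> F" "weighted_summable \<rho> F1"
    unfolding F_def F1_def using \<rho> by (auto intro!: weighted_summable_intros wK wK1)
  have wh: "weighted_summable \<rho> (?X * f + ((?X * f) oo (?q * ?X)))"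
    using \<rho> by (intro weighted_summable_intros weighted_summable_dilate q wf) auto
  have dil: "((?X * f) oo (?q * ?X)) = ?q * ?X * (?d * ((1 + ?c * (?q * ?X)) *
      (ratio_fps q (d * q) * (ratio_fps q (c * q) * euler_fps q (-(c * (d * q)))))))"
    by (simp add: f_def K_def kernel_fps_def fps_compose_mult_distrib fps_compose_add_distrib
        ratio_fps_dilate euler_fps_dilate mult.assoc)
  have "F1 + (?X * f + ((?X * f) oo (?q * ?X))) = fps_const (1 - d) * F + f"
  proof -
    have "1 + ?d * ?q * ?X \<noteq> 0"
    proof
      assume "1 + ?d * ?q * ?X = 0"
      hence "fps_nth (1 + ?d * ?q * ?X) 0 = 0" by simp
      thus False by simp
    qed
    note * = kernel_telescoping_identity[OF _ _ _ this, of "ratio_fps q (d * q)" "ratio_fps q d"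
        "ratio_fps q (c * q)" ?c "ratio_fps q c" "euler_fps q (-(c * (d * q)))" "euler_fps q (-(c * d))"]
    have 1: "ratio_fps q (d * q) * (1 + ?d * ?q * ?X) = (1 - ?d * ?X) * ratio_fps q d"
      using ratio_fps_contiguous[OF q, of d] by simp
    have 2: "ratio_fps q (c * q) * (1 + ?c * ?q * ?X) = (1 - ?c * ?X) * ratio_fps q c"
      using ratio_fps_contiguous[OF q, of c] by simp
    have 3: "euler_fps q (-(c * (d * q))) = (1 + ?c * ?d * ?X) * euler_fps q (-(c * d))"
      using euler_fps_contiguous[OF q, of "-(c * d)"] by (simp add: mult.assoc flip: fps_const_neg)
    have const: "fps_const (c * (d * q)) = ?c * (?d * ?q)" "fps_const (c * d) = ?c * ?d" "fps_const (1 - d) = 1 - ?d"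
      by (simp_all flip: fps_const_sub)
    show ?thesis
      unfolding dil unfolding F1_def F_def f_def K_def K1_def kernel_fps_def const by (rule *[OF 1 2 3])
  qed
  hence "fps_pairing (sigma_seq q) (F1 + (?X * f + ((?X * f) oo (?q * ?X)))) = fps_pairing (sigma_seq q) (fps_const (1 - d) * F + f)"
    by simp
  hence "fps_pairing (sigma_seq q) F1 + fps_pairing (sigma_seq q) (?X * f + ((?X * f) oo (?q * ?X)))
      = (1 - d) * fps_pairing (sigma_seq q) F + fps_pairing (sigma_seq q) f"
    unfolding fps_pairing_add[OF wF(2) wh C]
      fps_pairing_add[OF weighted_summable_mult[OF _ weighted_summable_const wF(1)] wf C, OF order.strict_implies_order[OF less_trans[OF zero_less_one \<rho>]]]
      fps_pairing_const_mult[OF wF(1) C] .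
  hence "kernel_value q c (d * q) = (1 - d) * kernel_value q c d - 2 * fps_pairing (\<lambda>_. 1) f"
    unfolding sigma_seq_pairing_shift[OF q \<rho> wf] by (simp add: kernel_value_def F_def F1_def K_def K1_def algebra_simps)
  also have "fps_pairing (\<lambda>_. 1) f = d * (1 + c) * fps_pairing (\<lambda>_. 1) K"
  proof -
    have one: "norm (1 :: complex) \<le> 1 * \<rho> ^ n" for n using \<rho> by (simp add: one_le_power)
    have \<rho>0: "\<rho> \<ge> 0" using \<rho> by simp
    have "f = fps_const d * (K + fps_const c * (?X * K))" by (simp add: f_def algebra_simps)
    hence "fps_pairing (\<lambda>_. 1) f = d * fps_pairing (\<lambda>_. 1) (K + fps_const c * (?X * K))"
      using fps_pairing_const_mult[OF _ one, of "K + fps_const c * (?X * K)"] \<rho>0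
      by (simp add: weighted_summable_intros wK)
    also have "fps_pairing (\<lambda>_. 1) (K + fps_const c * (?X * K)) = fps_pairing (\<lambda>_. 1) K + fps_pairing (\<lambda>_. 1) (fps_const c * (?X * K))"
      by (rule fps_pairing_add[OF wK _ one]) (intro weighted_summable_intros wK \<rho>0)
    also have "fps_pairing (\<lambda>_. 1) (fps_const c * (?X * K)) = c * fps_pairing (\<lambda>_. 1) (?X * K)"
      by (rule fps_pairing_const_mult[OF _ one]) (intro weighted_summable_intros wK \<rho>0)
    also have "fps_pairing (\<lambda>_. 1) (?X * K) = fps_pairing (\<lambda>_. 1) K"
      by (rule fps_pairing_X_mult[OF wK one \<rho>0])
    finally show ?thesis by (simp add: algebra_simps)
  qed
  also have "(1 + c) * fps_pairing (\<lambda>_. 1) K = qpoch_inf (-c) q * qpoch_inf (-(d * q)) q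
        / (qpoch_inf c q * qpoch_inf d q * qpoch_inf (-(c * d)) q)"
    using qpoch_inf_step[OF q, of "-c"] by (simp add: K_def kernel_fps_at_1[OF q c d])
  hence "d * (1 + c) * fps_pairing (\<lambda>_. 1) K = d * (qpoch_inf (-c) q * qpoch_inf (-(d * q)) q
        / (qpoch_inf c q * qpoch_inf d q * qpoch_inf (-(c * d)) q))"
    by (simp add: mult.assoc)
  finally show ?thesis by (simp only: mult.assoc)
qed

lemma sigma_seq_combination_bound:
  assumes q: "norm q < 1" and \<rho>: "\<rho> > 1"
  obtains C where "C > 0" "\<And>x N. norm x \<le> 1 \<Longrightarrow> norm (sigma_seq q N + x * sigma_seq q (N + 2)) \<le> C * \<rho> ^ N"
proof -
  obtain C where C: "C > 0" "\<And>N. norm (sigma_seq q N) \<le> C * \<rho> ^ N"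
    using sigma_seq_bound[OF q \<rho>] by blast
  have "norm (sigma_seq q N + x * sigma_seq q (N + 2)) \<le> (C + C * \<rho>\<^sup>2) * \<rho> ^ N" if "norm x \<le> 1" for x N
  proof -
    have "norm (x * sigma_seq q (N + 2)) \<le> 1 * (C * \<rho> ^ (N + 2))"
      unfolding norm_mult by (intro mult_mono C that) auto
    with C(2)[of N] norm_triangle_ineq[of "sigma_seq q N" "x * sigma_seq q (N + 2)"]
    have "norm (sigma_seq q N + x * sigma_seq q (N + 2)) \<le> C * \<rho> ^ N + C * \<rho> ^ (N + 2)" by linarith
    thus ?thesis by (simp only: power_add distrib_left distrib_right mult_ac)
  qed
  moreover have "C + C * \<rho>\<^sup>2 > 0" using C \<rho> by (intro add_pos_pos mult_pos_pos) auto
  ultimately show ?thesis using that by blast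
qed

lemma kernel_value_eq_iterated_sum:
  assumes q: "norm q < 1" and c: "norm c < 1" and d: "norm d < 1"
  shows "kernel_value q c d = (\<Sum>A. ratio_coeff q A * d ^ A * (\<Sum>k. ratio_coeff q k * c ^ k *
     (\<Sum>M. (-(c * d)) ^ M / qpoch q q M * (sigma_seq q (A + k + M) + c * d * sigma_seq q (A + k + M + 2)))))"
proof -
  obtain \<rho> where \<rho>: "\<rho> > 1" and r: "norm c * \<rho> < 1" "norm d * \<rho> < 1" "norm (c * d) * \<rho> < 1"
    using exists_common_radius[OF c d] .
  have \<rho>0: "\<rho> \<ge> 0" using \<rho> by simp
  obtain C where C: "\<And>N. norm (sigma_seq q N) \<le> C * \<rho> ^ N"
    using sigma_seq_bound[OF q \<rho>] by blast
  obtain B where B: "\<And>x N. norm x \<le> 1 \<Longrightarrow> norm (sigma_seq q N + x * sigma_seq q (N + 2)) \<le> B * \<rho> ^ N"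
    using sigma_seq_combination_bound[OF q \<rho>] by blast
  define h where "h N = sigma_seq q N + c * d * sigma_seq q (N + 2)" for N
  have hB: "norm (h N) \<le> B * \<rho> ^ N" for N
    unfolding h_def by (rule B) (use norm_mult_lt_1[OF c d] in simp)
  have hBs: "norm (h (s + N)) \<le> (B * \<rho> ^ s) * \<rho> ^ N" for s N
    using hB[of "s + N"] by (simp add: power_add mult.assoc)
  define K where "K = kernel_fps q c d"
  have ws: "weighted_summable \<rho> (ratio_fps q c)" "weighted_summable \<rho> (ratio_fps q d)"
     "weighted_summable \<rho> (euler_fps q (-(c * d)))"
    using q r \<rho>0 by (auto intro!: weighted_summable_ratio_fps weighted_summable_euler_fps)
  have wK: "weighted_summable \<rho> K"
    unfolding K_def using q r \<rho>0 by (auto intro!: weighted_summable_kernel)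
  have C1: "norm (sigma_seq q (Suc N)) \<le> (C * \<rho>) * \<rho> ^ N" for N using C[of "Suc N"] by (simp add: mult_ac)
  have C2: "norm (sigma_seq q (Suc (Suc N))) \<le> (C * \<rho> * \<rho>) * \<rho> ^ N" for N using C[of "Suc (Suc N)"] by (simp add: mult_ac)
  have "kernel_value q c d = fps_pairing (sigma_seq q) K + fps_pairing (sigma_seq q) (fps_const (c * d) * (fps_X * (fps_X * K)))"
    unfolding kernel_value_def K_def[symmetric]
    by (rule fps_pairing_add[OF wK _ C]) (intro weighted_summable_intros wK \<rho>0)
  also have "fps_pairing (sigma_seq q) (fps_const (c * d) * (fps_X * (fps_X * K))) = c * d * fps_pairing (sigma_seq q) (fps_X * (fps_X * K))"
    by (rule fps_pairing_const_mult[OF _ C]) (intro weighted_summable_intros wK \<rho>0)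
  also have "fps_pairing (sigma_seq q) (fps_X * (fps_X * K)) = fps_pairing (\<lambda>n. sigma_seq q (Suc n)) (fps_X * K)"
    by (rule fps_pairing_X_mult[OF _ C \<rho>0]) (intro weighted_summable_intros wK \<rho>0)
  also have "\<dots> = fps_pairing (\<lambda>n. sigma_seq q (Suc (Suc n))) K"
    by (rule fps_pairing_X_mult[OF wK C1 \<rho>0])
  also have "fps_pairing (sigma_seq q) K + c * d * fps_pairing (\<lambda>n. sigma_seq q (Suc (Suc n))) K = fps_pairing h K"
  proof -
    have s: "summable (\<lambda>n. fps_nth K n * sigma_seq q n)" "summable (\<lambda>n. fps_nth K n * sigma_seq q (Suc (Suc n)))"
      by (rule fps_pairing_summable[OF wK C], rule fps_pairing_summable[OF wK C2])
    have "fps_nth K n * h n = fps_nth K n * sigma_seq q n + c * d * (fps_nth K n * sigma_seq q (Suc (Suc n)))" for n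
      by (simp add: h_def algebra_simps)
    thus ?thesis
      unfolding fps_pairing_def
      by (simp only: suminf_add[OF s(1) summable_mult[OF s(2)], symmetric] suminf_mult[OF s(2)])
  qed
  also have "\<dots> = (\<Sum>A. fps_nth (ratio_fps q d) A * fps_pairing (\<lambda>s. h (A + s)) (ratio_fps q c * euler_fps q (-(c * d))))"
    unfolding K_def kernel_fps_def fps_pairing_mult[OF ws(2) weighted_summable_mult[OF \<rho>0 ws(1,3)] hB \<rho>0]
    by (simp add: fps_pairing_def)
  also have "\<dots> = (\<Sum>A. fps_nth (ratio_fps q d) A * (\<Sum>k. fps_nth (ratio_fps q c) k *
       (\<Sum>M. fps_nth (euler_fps q (-(c * d))) M * h (A + (k + M)))))"
    unfolding fps_pairing_mult[OF ws(1,3) hBs \<rho>0] ..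
  finally show ?thesis
    by (simp add: ratio_fps_def euler_fps_def h_def add.assoc)
qed

section \<open>Letting a parameter tend to zero\<close>

text \<open>
  One layer of Tannery's theorem for a nested series, in a form that reproduces its own hypotheses, so
  that it can be applied to each of the three nested sums of \<open>kernel_value\<close> in turn.
\<close>
lemma tendsto_weighted_tail:
  fixes e X :: "nat \<Rightarrow> nat \<Rightarrow> complex"
  assumes e: "\<And>m j. norm (e m j) \<le> L * r ^ j" and X: "\<And>m j. norm (X m j) \<le> K * \<rho> ^ j"
    and r: "0 \<le> r" "0 \<le> \<rho>" "r * \<rho> < 1"
    and lim: "\<And>j. (\<lambda>m. e m j) \<longlonglongrightarrow> e0 j" "\<And>j. (\<lambda>m. X m j) \<longlonglongrightarrow> X0 j"
  shows "(\<lambda>m. \<Sum>j. e m j * X m (s + j)) \<longlonglongrightarrow> (\<Sum>j. e0 j * X0 (s + j))"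
    and "norm (\<Sum>j. e m j * X m (s + j)) \<le> (L * K / (1 - r * \<rho>)) * \<rho> ^ s"
proof -
  have L: "0 \<le> L" using norm_ge_zero e[of 0 0] by (metis mult.right_neutral order_trans power_0)
  have le: "norm (e m j * X m (s + j)) \<le> (L * K * \<rho> ^ s) * (r * \<rho>) ^ j" for m j
  proof -
    have "norm (e m j * X m (s + j)) \<le> (L * r ^ j) * (K * \<rho> ^ (s + j))"
      unfolding norm_mult by (intro mult_mono e X) (use L r in auto)
    thus ?thesis by (simp add: power_add power_mult_distrib mult_ac)
  qed
  have geo: "(\<lambda>j. (L * K * \<rho> ^ s) * (r * \<rho>) ^ j) sums ((L * K * \<rho> ^ s) * (1 / (1 - r * \<rho>)))"
    using r by (intro sums_mult geometric_sums) simp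
  show "(\<lambda>m. \<Sum>j. e m j * X m (s + j)) \<longlonglongrightarrow> (\<Sum>j. e0 j * X0 (s + j))"
    by (rule tannery_sequentially[OF _ le sums_summable[OF geo]]) (intro tendsto_mult lim)
  have "norm (\<Sum>j. e m j * X m (s + j)) \<le> (\<Sum>j. (L * K * \<rho> ^ s) * (r * \<rho>) ^ j)"
    by (rule norm_suminf_le[OF le sums_summable[OF geo]])
  also have "\<dots> = (L * K / (1 - r * \<rho>)) * \<rho> ^ s"
    using sums_unique[OF geo] by simp
  finally show "norm (\<Sum>j. e m j * X m (s + j)) \<le> (L * K / (1 - r * \<rho>)) * \<rho> ^ s" .
qed

lemma kernel_value_tendsto:
  assumes q: "norm q < 1" and c: "norm c < 1" and d: "norm d < 1"
  shows "(\<lambda>m. kernel_value q c (d * q ^ m)) \<longlonglongrightarrow> kernel_value q c 0"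
proof -
  obtain \<rho> where \<rho>: "\<rho> > 1" and r: "norm c * \<rho> < 1" "norm d * \<rho> < 1" "norm (c * d) * \<rho> < 1"
    using exists_common_radius[OF c d] .
  have \<rho>0: "0 \<le> \<rho>" using \<rho> by simp
  obtain B where B: "\<And>x N. norm x \<le> 1 \<Longrightarrow> norm (sigma_seq q N + x * sigma_seq q (N + 2)) \<le> B * \<rho> ^ N"
    using sigma_seq_combination_bound[OF q \<rho>] by blast
  obtain C where C: "C > 0" "\<And>n. norm (1 / qpoch q q n) \<le> C" using inverse_qpoch_bounded[OF q q] by blast
  obtain D where D: "D > 0" "\<And>n. norm (ratio_coeff q n) \<le> D" using ratio_coeff_bounded[OF q] by blast
  define \<delta> where "\<delta> m = d * q ^ m" for m
  have "(\<lambda>m. d * q ^ m) \<longlonglongrightarrow> d * 0"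
    by (intro tendsto_mult tendsto_const LIMSEQ_power_zero q)
  hence \<delta>: "\<delta> \<longlonglongrightarrow> 0" by (simp add: \<delta>_def[abs_def])
  have \<delta>_le: "norm (\<delta> m) \<le> norm d" for m
    using q by (simp add: \<delta>_def norm_mult norm_power mult_left_le power_le_one)
  have c\<delta>: "norm (c * \<delta> m) \<le> norm (c * d)" for m
    unfolding norm_mult by (intro mult_left_mono \<delta>_le) auto
  define X3 where "X3 m N = sigma_seq q N + c * \<delta> m * sigma_seq q (N + 2)" for m N
  define X30 where "X30 N = sigma_seq q N + c * 0 * sigma_seq q (N + 2)" for N
  define e3 where "e3 m M = (-(c * \<delta> m)) ^ M / qpoch q q M" for m M
  define e30 where "e30 M = (-(c * 0)) ^ M / qpoch q q M" for M
  define X2 where "X2 m s = (\<Sum>M. e3 m M * X3 m (s + M))" for m s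
  define X20 where "X20 s = (\<Sum>M. e30 M * X30 (s + M))" for s
  define X1 where "X1 m s = (\<Sum>k. ratio_coeff q k * c ^ k * X2 m (s + k))" for m s
  define X10 where "X10 s = (\<Sum>k. ratio_coeff q k * c ^ k * X20 (s + k))" for s
  have bX3: "norm (X3 m N) \<le> B * \<rho> ^ N" for m N
    unfolding X3_def using c\<delta>[of m] norm_mult_lt_1[OF c d] by (intro B) linarith
  have be3: "norm (e3 m M) \<le> C * norm (c * d) ^ M" for m M
  proof -
    have "norm (e3 m M) = norm (1 / qpoch q q M) * norm (c * \<delta> m) ^ M"
      by (simp add: e3_def norm_divide norm_power)
    also have "\<dots> \<le> C * norm (c * d) ^ M"
      using C(1) by (intro mult_mono C(2) power_mono c\<delta>) auto
    finally show ?thesis .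
  qed
  have le3: "(\<lambda>m. e3 m M) \<longlonglongrightarrow> e30 M" for M
    unfolding e3_def e30_def by (intro tendsto_intros \<delta>) (use qpoch_nonzero[OF q q] in auto)
  have lX3: "(\<lambda>m. X3 m N) \<longlonglongrightarrow> X30 N" for N
    unfolding X3_def X30_def by (intro tendsto_intros \<delta>)
  note X2 = tendsto_weighted_tail[OF be3 bX3 norm_ge_zero \<rho>0 r(3) le3 lX3, folded X2_def X20_def]
  have be2: "norm (ratio_coeff q k * x ^ k) \<le> D * norm x ^ k" for k x
    unfolding norm_mult norm_power using D(2)[of k] by (intro mult_right_mono) auto
  note X1 = tendsto_weighted_tail[where e = "\<lambda>_ k. ratio_coeff q k * c ^ k",
      OF be2 X2(2) norm_ge_zero \<rho>0 r(1) tendsto_const X2(1), folded X1_def X10_def]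
  have be1: "norm (ratio_coeff q A * \<delta> m ^ A) \<le> D * norm d ^ A" for m A
    using be2[of A "\<delta> m"] D(1) power_mono[OF \<delta>_le[of m] norm_ge_zero, of A]
      mult_left_mono[of "norm (\<delta> m) ^ A" "norm d ^ A" D] by linarith
  have le1: "(\<lambda>m. ratio_coeff q A * \<delta> m ^ A) \<longlonglongrightarrow> ratio_coeff q A * 0 ^ A" for A
    by (intro tendsto_intros \<delta>)
  note X0 = tendsto_weighted_tail(1)[OF be1 X1(2) norm_ge_zero \<rho>0 r(2) le1 X1(1), of 0]
  have "norm (\<delta> m) < 1" for m using \<delta>_le[of m] d by linarith
  hence "kernel_value q c (\<delta> m) = (\<Sum>A. ratio_coeff q A * \<delta> m ^ A * X1 m (0 + A))" for m
    by (simp only: kernel_value_eq_iterated_sum[OF q c] X1_def X2_def X3_def e3_def add_0_left)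
  moreover have "kernel_value q c 0 = (\<Sum>A. ratio_coeff q A * 0 ^ A * X10 (0 + A))"
    unfolding X10_def X20_def X30_def e30_def add_0_left
    by (rule kernel_value_eq_iterated_sum[OF q c]) simp
  ultimately show ?thesis using X0 by (simp only: \<delta>_def)
qed

lemma kernel_value_commute: "kernel_value q c d = kernel_value q d c"
  by (simp add: kernel_value_def kernel_fps_def mult_ac)

lemma kernel_value_0_0: "kernel_value q 0 0 = 1"
proof -
  have "ratio_fps q 0 = 1" "euler_fps q 0 = 1"
    by (auto intro!: fps_ext simp: ratio_fps_def euler_fps_def power_0_left ratio_coeff_def)
  hence "kernel_value q 0 0 = (\<Sum>n. fps_nth 1 n * sigma_seq q n)"
    by (simp add: kernel_value_def kernel_fps_def fps_pairing_def)
  also have "\<dots> = (\<Sum>n\<in>{0}. fps_nth 1 n * sigma_seq q n)"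
    by (rule suminf_finite) auto
  finally show ?thesis by simp
qed

lemma first_order_q_difference_solution:
  fixes f :: "complex \<Rightarrow> complex"
  assumes q: "norm q < 1" and x: "norm x < 1"
    and step: "\<And>x. norm x < 1 \<Longrightarrow> f (x * q) = (1 - x) * f x"
    and lim: "(\<lambda>m. f (x * q ^ m)) \<longlonglongrightarrow> f 0"
  shows "qpoch_inf x q * f x = f 0"
proof -
  have "f (x * q ^ m) = qpoch x q m * f x" for m
  proof (induction m)
    case (Suc m)
    have "f (x * q ^ Suc m) = (1 - x * q ^ m) * f (x * q ^ m)"
      using step[OF norm_mult_power_lt_1[OF q x, of m]] by (simp add: mult_ac)
    thus ?case by (simp add: Suc qpoch_Suc)
  qed simp
  hence "(\<lambda>m. f (x * q ^ m)) \<longlonglongrightarrow> qpoch_inf x q * f x"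
    by (simp add: tendsto_mult LIMSEQ_qpoch[OF q])
  thus ?thesis using lim LIMSEQ_unique by blast
qed

text \<open>
  The inhomogeneous terms of the two contiguous relations agree, so that the difference satisfies the
  homogeneous equation in \<open>d\<close>, and by symmetry also in \<open>c\<close>. This sends both parameters to \<open>0\<close>, where
  the normalised series is sigma itself and the functional is applied to the constant series \<open>1\<close>.
\<close>
lemma sigma_normalised_minus_kernel_value:
  assumes q: "norm q < 1" and c: "norm c < 1" and d: "norm d < 1"
  shows "qpoch_inf c q * qpoch_inf d q * (sigma_normalised q c d - kernel_value q c d) = ramanujan_sigma q - 1"
proof -
  define \<Delta> where "\<Delta> c d = sigma_normalised q c d - kernel_value q c d" for c d
  have reduce: "qpoch_inf y q * \<Delta> x y = \<Delta> x 0" if x: "norm x < 1" and y: "norm y < 1" for x y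
  proof (rule first_order_q_difference_solution[OF q y])
    show "\<Delta> x (z * q) = (1 - z) * \<Delta> x z" if "norm z < 1" for z
      unfolding \<Delta>_def sigma_normalised_contiguous[OF q x that] kernel_value_contiguous[OF q x that]
      by (simp add: algebra_simps)
    show "(\<lambda>m. \<Delta> x (y * q ^ m)) \<longlonglongrightarrow> \<Delta> x 0"
      unfolding \<Delta>_def by (intro tendsto_diff sigma_normalised_tendsto kernel_value_tendsto q x y)
  qed
  have comm: "\<Delta> x y = \<Delta> y x" for x y
    unfolding \<Delta>_def by (simp add: sigma_normalised_commute[of q x y] kernel_value_commute[of q x y])
  have "qpoch_inf c q * (qpoch_inf d q * \<Delta> c d) = \<Delta> 0 0"
    using reduce[OF c d] reduce[OF _ c, of 0] by (simp add: comm[of c 0])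
  thus ?thesis by (simp add: \<Delta>_def sigma_normalised_0_0 kernel_value_0_0 mult.assoc)
qed

section \<open>Weighted double series\<close>

definition double_series ::
  "(nat \<Rightarrow> complex) \<Rightarrow> (nat \<Rightarrow> complex) \<Rightarrow> (nat \<Rightarrow> nat \<Rightarrow> complex) \<Rightarrow> complex" where
  "double_series u v f = (\<Sum>i. u i * (\<Sum>j. v j * f i j))"

lemma double_series_row_summable:
  fixes v :: "nat \<Rightarrow> complex" and \<rho> :: real
  assumes v: "summable (\<lambda>j. norm (v j) * \<rho> ^ j)" and f: "\<And>i j. norm (f i j) \<le> C * (\<rho> ^ i * \<rho> ^ j)"
  shows "summable (\<lambda>j. v j * f i j)"
proof (rule summable_comparison_test'[of "\<lambda>j. C * \<rho> ^ i * (norm (v j) * \<rho> ^ j)" 0])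
  show "norm (v j * f i j) \<le> C * \<rho> ^ i * (norm (v j) * \<rho> ^ j)" for j
    using mult_left_mono[OF f[of i j], of "norm (v j)"] by (simp add: norm_mult mult_ac)
qed (intro summable_mult v)

lemma double_series_summable:
  fixes u v :: "nat \<Rightarrow> complex" and \<rho> :: real
  assumes u: "summable (\<lambda>i. norm (u i) * \<rho> ^ i)" and v: "summable (\<lambda>j. norm (v j) * \<rho> ^ j)"
    and f: "\<And>i j. norm (f i j) \<le> C * (\<rho> ^ i * \<rho> ^ j)"
  shows "summable (\<lambda>i. u i * (\<Sum>j. v j * f i j))"
proof (rule summable_comparison_test'[of "\<lambda>i. (norm (u i) * \<rho> ^ i) * (\<Sum>j. C * (norm (v j) * \<rho> ^ j))" 0])
  fix i
  have "norm (\<Sum>j. v j * f i j) \<le> \<rho> ^ i * (\<Sum>j. C * (norm (v j) * \<rho> ^ j))"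
  proof (rule norm_suminf_row_le)
    show "summable (\<lambda>j. C * (norm (v j) * \<rho> ^ j))" by (intro summable_mult v)
    show "norm (v j * f i j) \<le> \<rho> ^ i * (C * (norm (v j) * \<rho> ^ j))" for i j
      using mult_left_mono[OF f[of i j], of "norm (v j)"] by (simp add: norm_mult mult_ac)
  qed
  thus "norm (u i * (\<Sum>j. v j * f i j)) \<le> (norm (u i) * \<rho> ^ i) * (\<Sum>j. C * (norm (v j) * \<rho> ^ j))"
    unfolding norm_mult mult.assoc by (intro mult_left_mono) auto
qed (intro summable_mult2 u)

lemma double_series_linear:
  assumes u: "summable (\<lambda>i. norm (u i) * \<rho> ^ i)" and v: "summable (\<lambda>j. norm (v j) * \<rho> ^ j)"
    and f: "\<And>i j. norm (f i j) \<le> C * (\<rho> ^ i * \<rho> ^ j)" and g: "\<And>i j. norm (g i j) \<le> D * (\<rho> ^ i * \<rho> ^ j)"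
  shows "double_series u v (\<lambda>i j. x * f i j + y * g i j) = x * double_series u v f + y * double_series u v g"
proof -
  note sf = double_series_row_summable[OF v f] and sg = double_series_row_summable[OF v g]
  note Sf = double_series_summable[OF u v f] and Sg = double_series_summable[OF u v g]
  have "(\<Sum>j. v j * (x * f i j + y * g i j)) = x * (\<Sum>j. v j * f i j) + y * (\<Sum>j. v j * g i j)" for i
  proof -
    have "v j * (x * f i j + y * g i j) = x * (v j * f i j) + y * (v j * g i j)" for j
      by (simp add: algebra_simps)
    thus ?thesis
      by (simp only: suminf_add[OF summable_mult[OF sf] summable_mult[OF sg], symmetric] suminf_mult[OF sf] suminf_mult[OF sg])
  qed
  hence "u i * (\<Sum>j. v j * (x * f i j + y * g i j))
     = x * (u i * (\<Sum>j. v j * f i j)) + y * (u i * (\<Sum>j. v j * g i j))" for i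
    by (simp add: algebra_simps)
  thus ?thesis
    unfolding double_series_def
    by (simp only: suminf_add[OF summable_mult[OF Sf] summable_mult[OF Sg], symmetric] suminf_mult[OF Sf] suminf_mult[OF Sg])
qed

lemma double_series_swap:
  assumes u: "summable (\<lambda>i. norm (u i) * \<rho> ^ i)" and v: "summable (\<lambda>j. norm (v j) * \<rho> ^ j)"
    and f: "\<And>i j. norm (f i j) \<le> C * (\<rho> ^ i * \<rho> ^ j)" and \<rho>: "\<rho> \<ge> 0"
  shows "double_series u v f = double_series v u (\<lambda>j i. f i j)"
proof -
  have C: "C \<ge> 0" using f[of 0 0] by (metis mult.right_neutral norm_ge_zero order_trans power_0)
  have f': "norm (f i j) \<le> C * (\<rho> ^ j * \<rho> ^ i)" for i j using f[of i j] by (simp add: mult_ac)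
  have "double_series u v f = (\<Sum>i. \<Sum>j. u i * (v j * f i j))"
    unfolding double_series_def by (simp add: suminf_mult double_series_row_summable[OF v f])
  also have "\<dots> = (\<Sum>j. \<Sum>i. u i * (v j * f i j))"
  proof (rule suminf_swap[where a = "\<lambda>i. C * (norm (u i) * \<rho> ^ i)" and b = "\<lambda>j. norm (v j) * \<rho> ^ j"])
    fix i j
    have "norm (u i) * norm (v j) * norm (f i j) \<le> norm (u i) * norm (v j) * (C * (\<rho> ^ i * \<rho> ^ j))"
      by (intro mult_left_mono f) auto
    thus "norm (u i * (v j * f i j)) \<le> C * (norm (u i) * \<rho> ^ i) * (norm (v j) * \<rho> ^ j)"
      by (simp add: norm_mult mult_ac)
  qed (use u v C \<rho> in \<open>auto intro!: summable_mult\<close>)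
  also have "\<dots> = (\<Sum>j. v j * (\<Sum>i. u i * f i j))"
  proof (rule suminf_cong)
    fix j
    have "(\<Sum>i. u i * (v j * f i j)) = (\<Sum>i. v j * (u i * f i j))" by (simp only: mult_ac)
    also have "\<dots> = v j * (\<Sum>i. u i * f i j)"
      by (rule suminf_mult[OF double_series_row_summable[where f = "\<lambda>j i. f i j", OF u f']])
    finally show "(\<Sum>i. u i * (v j * f i j)) = v j * (\<Sum>i. u i * f i j)" .
  qed
  finally show ?thesis by (simp add: double_series_def)
qed

definition ratio_term :: "complex \<Rightarrow> complex \<Rightarrow> nat \<Rightarrow> complex" where
  "ratio_term q z k = ratio_coeff q k * z ^ k"

text \<open>
  Convergence bookkeeping for the linearity of \<open>double_series\<close>: coefficient arrays may contain the
  unbounded sequence \<open>S\<close>, which grows more slowly than any geometric weight.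
\<close>
definition dominated :: "real \<Rightarrow> (nat \<Rightarrow> nat \<Rightarrow> complex) \<Rightarrow> bool" where
  "dominated \<rho> f \<longleftrightarrow> (\<exists>C. \<forall>i j. norm (f i j) \<le> C * (\<rho> ^ i * \<rho> ^ j))"

lemma dominatedI: "(\<And>i j. norm (f i j) \<le> C * (\<rho> ^ i * \<rho> ^ j)) \<Longrightarrow> dominated \<rho> f"
  unfolding dominated_def by blast

lemma dominated_add:
  assumes "dominated \<rho> f" "dominated \<rho> g"
  shows "dominated \<rho> (\<lambda>i j. f i j + g i j)"
proof -
  obtain C D where "\<And>i j. norm (f i j) \<le> C * (\<rho> ^ i * \<rho> ^ j)" "\<And>i j. norm (g i j) \<le> D * (\<rho> ^ i * \<rho> ^ j)"
    using assms unfolding dominated_def by blast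
  hence "norm (f i j + g i j) \<le> (C + D) * (\<rho> ^ i * \<rho> ^ j)" for i j
    unfolding distrib_right by (intro order_trans[OF norm_triangle_ineq] add_mono)
  thus ?thesis by (rule dominatedI)
qed

lemma dominated_bounded_mult:
  assumes g: "\<And>i j. norm (g i j) \<le> B" and f: "dominated \<rho> f"
  shows "dominated \<rho> (\<lambda>i j. g i j * f i j)"
proof -
  obtain C where C: "\<And>i j. norm (f i j) \<le> C * (\<rho> ^ i * \<rho> ^ j)"
    using f unfolding dominated_def by blast
  have "0 \<le> B" using order_trans[OF norm_ge_zero g] .
  hence "norm (g i j * f i j) \<le> (B * C) * (\<rho> ^ i * \<rho> ^ j)" for i j
    unfolding norm_mult mult.assoc[of B] by (intro mult_mono g C) auto
  thus ?thesis by (rule dominatedI)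
qed

lemma dominated_cmult: "dominated \<rho> f \<Longrightarrow> dominated \<rho> (\<lambda>i j. x * f i j)"
  by (rule dominated_bounded_mult[of _ "norm x"]) auto

lemma dominated_diff:
  assumes "dominated \<rho> f" "dominated \<rho> g"
  shows "dominated \<rho> (\<lambda>i j. f i j - g i j)"
  using dominated_add[OF assms(1) dominated_cmult[OF assms(2), of "-1"]] by simp

lemma dominated_const:
  assumes "\<rho> \<ge> 1"
  shows "dominated \<rho> (\<lambda>i j. x)"
proof (rule dominatedI)
  fix i j
  have "1 * 1 \<le> \<rho> ^ i * \<rho> ^ j" using assms by (intro mult_mono one_le_power) auto
  from mult_left_mono[OF this norm_ge_zero[of x]]
  show "norm x \<le> norm x * (\<rho> ^ i * \<rho> ^ j)" by simp
qed

lemma dominated_partial_sum: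
  assumes q: "norm q < 1" and \<rho>: "\<rho> > 1"
  shows "dominated \<rho> (\<lambda>i j. qpoch_partial_sum q (i + m))"
    and "dominated \<rho> (\<lambda>i j. qpoch_partial_sum q (i + j + m))"
proof -
  obtain C where C: "C > 0" "\<And>N. norm (sigma_seq q N) \<le> C * \<rho> ^ N"
    using sigma_seq_bound[OF q \<rho>] by blast
  obtain B where B: "B > 0" "\<And>a n. norm a \<le> 1 \<Longrightarrow> norm (qpoch a q n) \<le> B"
    using qpoch_bounded[OF q] by blast
  have S: "norm (qpoch_partial_sum q N) \<le> (C * B) * \<rho> ^ N" for N
  proof -
    have "qpoch (-q) q N \<noteq> 0" using qpoch_nonzero[OF q, of "-q"] q by simp
    hence "norm (qpoch_partial_sum q N) = norm (sigma_seq q N) * norm (qpoch (-q) q N)"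
      by (simp add: sigma_seq_def norm_divide)
    also have "\<dots> \<le> (C * \<rho> ^ N) * B"
      using C(1) \<rho> q by (intro mult_mono C(2) B(2)) auto
    finally show ?thesis by (simp only: mult_ac)
  qed
  have "norm (qpoch_partial_sum q (i + j + m)) \<le> (C * B * \<rho> ^ m) * (\<rho> ^ i * \<rho> ^ j)" for i j
    using S[of "i + j + m"] by (simp add: power_add mult_ac)
  thus "dominated \<rho> (\<lambda>i j. qpoch_partial_sum q (i + j + m))" by (rule dominatedI)
  have "norm (qpoch_partial_sum q (i + m)) \<le> (C * B * \<rho> ^ m) * (\<rho> ^ i * \<rho> ^ j)" for i j
  proof -
    have "1 \<le> \<rho> ^ j" using \<rho> by (intro one_le_power) simp
    hence "(C * B) * \<rho> ^ (i + m) * 1 \<le> (C * B) * \<rho> ^ (i + m) * \<rho> ^ j"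
      using C(1) B(1) \<rho> by (intro mult_left_mono) auto
    with S[of "i + m"] show ?thesis by (simp add: power_add mult_ac)
  qed
  thus "dominated \<rho> (\<lambda>i j. qpoch_partial_sum q (i + m))" by (rule dominatedI)
qed

lemma double_series_cmult:
  fixes u v :: "nat \<Rightarrow> complex"
  assumes "summable (\<lambda>i. norm (u i) * \<rho> ^ i)" "summable (\<lambda>j. norm (v j) * \<rho> ^ j)" "dominated \<rho> f"
  shows "double_series u v (\<lambda>i j. x * f i j) = x * double_series u v f"
proof -
  obtain C where C: "\<And>i j. norm (f i j) \<le> C * (\<rho> ^ i * \<rho> ^ j)"
    using assms(3) unfolding dominated_def by blast
  from double_series_linear[OF assms(1,2) C C, of x 0] show ?thesis by simp
qed

lemma double_series_add:
  fixes u v :: "nat \<Rightarrow> complex"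
  assumes "summable (\<lambda>i. norm (u i) * \<rho> ^ i)" "summable (\<lambda>j. norm (v j) * \<rho> ^ j)"
    "dominated \<rho> f" "dominated \<rho> g"
  shows "double_series u v (\<lambda>i j. f i j + g i j) = double_series u v f + double_series u v g"
proof -
  obtain C D where "\<And>i j. norm (f i j) \<le> C * (\<rho> ^ i * \<rho> ^ j)" "\<And>i j. norm (g i j) \<le> D * (\<rho> ^ i * \<rho> ^ j)"
    using assms unfolding dominated_def by blast
  from double_series_linear[OF assms(1,2) this, of 1 1] show ?thesis by simp
qed

lemma double_series_swap_bounded:
  fixes u v :: "nat \<Rightarrow> complex"
  assumes "summable (\<lambda>i. norm (u i))" "summable (\<lambda>j. norm (v j))" "\<And>i j. norm (f i j) \<le> B"
  shows "double_series u v f = double_series v u (\<lambda>j i. f i j)"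
  by (rule double_series_swap[where \<rho> = 1 and C = B]) (use assms in auto)

lemma bounded_weighted_series:
  fixes u h :: "nat \<Rightarrow> complex"
  assumes "summable (\<lambda>n. norm (u n))" "\<And>n. norm (h n) \<le> B"
  shows "summable (\<lambda>n. u n * h n)" "norm (\<Sum>n. u n * h n) \<le> (\<Sum>n. norm (u n)) * B"
proof -
  have le: "norm (u n * h n) \<le> norm (u n) * B" for n
    unfolding norm_mult by (intro mult_left_mono assms) auto
  show "summable (\<lambda>n. u n * h n)"
    by (rule summable_comparison_test'[OF summable_mult2[OF assms(1)]]) (rule le)
  show "norm (\<Sum>n. u n * h n) \<le> (\<Sum>n. norm (u n)) * B"
    using norm_suminf_le[OF le summable_mult2[OF assms(1)]] by (simp add: suminf_mult2[OF assms(1)])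
qed

lemma summable_ratio_term:
  assumes q: "norm q < 1" and \<rho>: "\<rho> \<ge> 0" and z: "norm z * \<rho> < 1"
  shows "summable (\<lambda>k. norm (ratio_term q z k) * \<rho> ^ k)"
  using weighted_summable_ratio_fps[OF assms] by (simp add: weighted_summable_def ratio_fps_def ratio_term_def)

lemma summable_norm_ratio_term:
  assumes q: "norm q < 1" and z: "norm z < 1"
  shows "summable (\<lambda>k. norm (ratio_term q z k))"
  using summable_ratio_term[OF q, of 1 z] z by simp

section \<open>Rewriting the four parts of Lambda\<close>

lemma qpoch_minus_one_Suc: "qpoch (-1) q (Suc n) = 2 * qpoch (-q) q n"
  by (simp add: qpoch_Suc_left)

lemma qpoch_minus_one_add: "qpoch (-1) q (m + n) = qpoch (-1) q m * qpoch (-(q ^ m)) q n"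
  by (simp add: qpoch_add)

text \<open>
  This is why the last factors in \<open>\<Lambda>\<close> are harmless: multiplied by \<open>(-1)\<^sub>p\<close>, the factor
  \<open>(1 + q\<^sup>p) (1 + q\<^sup>p\<^sup>+\<^sup>1)\<close> just shifts the index by two.
\<close>
lemma qpoch_minus_one_add_2: "qpoch (-1) q p * (1 + q ^ p) * (1 + q ^ (p + 1)) = qpoch (-1) q (p + 2)"
  by (simp add: qpoch_Suc numeral_2_eq_2)

lemma sum_qpoch_minus_one:
  "(\<Sum>i\<le>n. qpoch (-1) q (i + 1 + k)) = qpoch_partial_sum q (k + n + 1) - qpoch_partial_sum q k"
  by (induction n) (simp_all add: qpoch_partial_sum_def add_ac)

lemma qpoch_partial_sum_1: "qpoch_partial_sum q 1 = 3"
  by (simp add: qpoch_partial_sum_def qpoch_Suc)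

lemma qpoch_shifted_ratio:
  assumes q: "norm q < 1"
  shows "qpoch (-(q ^ (p + 1))) q k / qpoch (q ^ (p + 1)) q k = ratio_coeff q (p + k) / ratio_coeff q p"
proof -
  have "qpoch (-q) q p \<noteq> 0" "qpoch q q p \<noteq> 0" using qpoch_nonzero[OF q] q by auto
  moreover have "qpoch (-q) q (p + k) = qpoch (-q) q p * qpoch (-(q ^ (p + 1))) q k"
    "qpoch q q (p + k) = qpoch q q p * qpoch (q ^ (p + 1)) q k"
    by (simp_all add: qpoch_add)
  ultimately show ?thesis by (simp add: ratio_coeff_def)
qed

lemma ratio_coeff_nonzero: "norm q < 1 \<Longrightarrow> ratio_coeff q p \<noteq> 0"
  using qpoch_nonzero[of q q] qpoch_nonzero[of q "-q"] by (simp add: ratio_coeff_def)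

lemma summable_triangular_weight:
  fixes x :: "nat \<Rightarrow> complex"
  assumes q: "norm q < 1" and x: "\<And>n. norm (x n) \<le> C"
  shows "summable (\<lambda>n. norm (x n * q ^ (n * (n + 1) div 2 + s * n)))"
proof (rule summable_comparison_test')
  show "summable (\<lambda>n. C * norm q ^ n)" using q by (intro summable_mult summable_geometric) simp
  fix n
  have "norm (q ^ (n * (n + 1) div 2 + s * n)) = norm (q ^ (n * (n + 1) div 2)) * norm q ^ (s * n)"
    by (simp add: power_add norm_mult norm_power)
  also have "\<dots> \<le> norm q ^ n * 1"
    using q by (intro mult_mono norm_power_triangle_le power_le_one) auto
  finally have "norm (x n) * norm (q ^ (n * (n + 1) div 2 + s * n)) \<le> C * norm q ^ n"
    using order_trans[OF norm_ge_zero x] by (intro mult_mono x) auto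
  thus "norm (norm (x n * q ^ (n * (n + 1) div 2 + s * n))) \<le> C * norm q ^ n"
    by (simp only: norm_mult real_norm_def abs_mult abs_norm_cancel)
qed

lemma power_triangle_shift:
  "(q :: complex) ^ (n * (n + 1) div 2 + s * n) * q ^ (t * n) = q ^ (n * (n + 1) div 2 + (s + t) * n)"
  by (simp only: power_add[symmetric] add.assoc add_mult_distrib)

text \<open>
  The term with \<open>q\<^sup>2\<^sup>n\<close> is the same sum with \<open>s\<close> replaced by \<open>s + 2\<close>, so that one evaluation of
  \<open>\<Sum>n. x n q\<^sup>n\<^sup>(\<^sup>n\<^sup>+\<^sup>1\<^sup>)\<^sup>/\<^sup>2\<^sup>+\<^sup>s\<^sup>n\<close> for all \<open>s\<close> covers both terms of the last factor.
\<close>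
lemma triangular_sum_split:
  fixes x :: "nat \<Rightarrow> complex"
  assumes q: "norm q < 1" and x: "\<And>n. norm (x n) \<le> C"
  shows "(\<Sum>n. x n * q ^ (n * (n + 1) div 2 + s * n) * (1 + z * q ^ (2 * n) * y * y'))
    = (\<Sum>n. x n * q ^ (n * (n + 1) div 2 + s * n)) + z * y * y' * (\<Sum>n. x n * q ^ (n * (n + 1) div 2 + (s + 2) * n))"
proof -
  note s = summable_norm_cancel[OF summable_triangular_weight[of q x C, OF q x]]
  have "x n * q ^ (n * (n + 1) div 2 + s * n) * (1 + z * q ^ (2 * n) * y * y')
    = x n * q ^ (n * (n + 1) div 2 + s * n) + z * y * y' * (x n * q ^ (n * (n + 1) div 2 + (s + 2) * n))" for n
  proof -
    have ring: "a * t * (1 + z * w * y * y') = a * t + z * y * y' * (a * (t * w))" for a t w :: complex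
      by (simp add: algebra_simps)
    show ?thesis unfolding power_triangle_shift[symmetric] by (rule ring)
  qed
  thus ?thesis by (simp only: suminf_add[OF s summable_mult[OF s], symmetric] suminf_mult[OF s])
qed

lemma euler_term_le:
  assumes q: "norm q < 1" 
  obtains C where "C > 0" "\<And>a M s. norm (a ^ M / qpoch q q M / qpoch (-q) q (s + M)) \<le> C * norm a ^ M"
proof -
  obtain C where C: "C > 0" "\<And>n. norm (1 / qpoch q q n) \<le> C" using inverse_qpoch_bounded[OF q q] by blast
  obtain D where D: "D > 0" "\<And>n. norm (1 / qpoch (-q) q n) \<le> D"
    using inverse_qpoch_bounded[OF q, of "-q"] q by auto
  have "norm (a ^ M / qpoch q q M / qpoch (-q) q (s + M)) \<le> (C * D) * norm a ^ M" for a M s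
  proof -
    have "norm (1 / qpoch q q M) * norm (1 / qpoch (-q) q (s + M)) * norm a ^ M \<le> C * D * norm a ^ M"
      using C(1) D(1) by (intro mult_mono C(2) D(2)) auto
    thus ?thesis by (simp add: norm_divide norm_mult norm_power)
  qed
  with that[of "C * D"] C D show ?thesis by simp
qed

lemma euler_series_sums:
  assumes q: "norm q < 1" and a: "norm a < 1"
  shows "(\<lambda>M. a ^ M / qpoch q q M / qpoch (-q) q (s + M)) sums euler_series a q s"
proof -
  obtain C where C: "\<And>M s. norm (a ^ M / qpoch q q M / qpoch (-q) q (s + M)) \<le> C * norm a ^ M"
    using euler_term_le[OF q] by metis
  have "summable (\<lambda>M. a ^ M / qpoch q q M / qpoch (-q) q (s + M))"
    by (rule summable_comparison_test'[OF _ C]) (use a in \<open>auto intro!: summable_mult summable_geometric\<close>)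
  thus ?thesis unfolding euler_series_def by (rule summable_sums)
qed

lemma euler_series_bounded:
  assumes q: "norm q < 1" and a: "norm a < 1"
  obtains B where "B > 0" "\<And>s. norm (euler_series a q s) \<le> B"
proof -
  obtain C where C: "C > 0" "\<And>M s. norm (a ^ M / qpoch q q M / qpoch (-q) q (s + M)) \<le> C * norm a ^ M"
    using euler_term_le[OF q] by metis
  have geo: "(\<lambda>M. C * norm a ^ M) sums (C * (1 / (1 - norm a)))"
    using a by (intro sums_mult geometric_sums) simp
  have "norm (euler_series a q s) \<le> C * (1 / (1 - norm a))" for s
    unfolding euler_series_def
    using norm_suminf_le[OF C(2)[of _ s] sums_summable[OF geo]] sums_unique[OF geo] by simp
  moreover have "C * (1 / (1 - norm a)) > 0" using C a by simp
  ultimately show ?thesis using that by blast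
qed

lemma heine_limit_with_ratio:
  assumes q: "norm q < 1" and a: "norm a < 1" and d: "norm d < 1"
  shows "(\<Sum>n. qpoch a q n / qpoch q q n * (qpoch d q n / qpoch (-(d * q)) q n) * q ^ (n * (n + 1) div 2 + s * n))
    = qpoch_inf d q / qpoch_inf (-(d * q)) q * (qpoch_inf a q * qpoch_inf (-q) q)
      * (\<Sum>A. ratio_term q d A * euler_series a q (s + A))"
proof -
  obtain C where C: "\<And>n. norm (qpoch a q n / qpoch q q n) \<le> C" using qpoch_ratio_bounded[OF q q] by blast
  define \<alpha> where "\<alpha> n = qpoch a q n / qpoch q q n * q ^ (n * (n + 1) div 2 + s * n)" for n
  have \<alpha>: "summable (\<lambda>n. norm (\<alpha> n))"
    unfolding \<alpha>_def by (rule summable_triangular_weight[OF q C])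
  have inner: "(\<Sum>n. \<alpha> n * q ^ (A * n)) = qpoch_inf a q * qpoch_inf (-q) q * euler_series a q (s + A)" for A
    unfolding heine_limit[OF q a, symmetric] \<alpha>_def unfolding mult.assoc power_triangle_shift ..
  obtain B where B: "\<And>s. norm (euler_series a q s) \<le> B" using euler_series_bounded[OF q a] by blast
  have "(\<Sum>n. qpoch a q n / qpoch q q n * (qpoch d q n / qpoch (-(d * q)) q n) * q ^ (n * (n + 1) div 2 + s * n))
    = (\<Sum>n. \<alpha> n * (qpoch d q n / qpoch (-(d * q)) q n))"
    by (simp only: \<alpha>_def mult_ac)
  also have "\<dots> = qpoch_inf d q / qpoch_inf (-(d * q)) q *
     (\<Sum>A. qpoch_inf a q * qpoch_inf (-q) q * (ratio_term q d A * euler_series a q (s + A)))"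
    unfolding suminf_qpoch_ratio_factor[OF q d \<alpha>] inner ratio_term_def by (simp only: mult_ac)
  also have "(\<Sum>A. qpoch_inf a q * qpoch_inf (-q) q * (ratio_term q d A * euler_series a q (s + A)))
     = qpoch_inf a q * qpoch_inf (-q) q * (\<Sum>A. ratio_term q d A * euler_series a q (s + A))"
    by (rule suminf_mult[OF bounded_weighted_series(1)[OF summable_norm_ratio_term[OF q d] B]])
  finally show ?thesis by (simp only: mult.assoc)
qed

lemma qpoch_minus_one_bounded:
  assumes "norm q < 1"
  obtains C where "C > 0" "\<And>n. norm (qpoch (-1) q n) \<le> C"
  using qpoch_bounded[OF assms] by (metis norm_minus_cancel norm_one order_refl)

lemma qpoch_minus_one_nonzero: "norm q < 1 \<Longrightarrow> qpoch (-1) q p \<noteq> 0"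
  using qpoch_nonzero[of q "-q"] by (cases p) (simp_all add: qpoch_minus_one_Suc)

context
  fixes q c d :: complex
  assumes q: "norm q < 1" and c: "norm c < 1" and d: "norm d < 1"
begin

lemma norm_neg_cd_less_1: "norm (-(c * d)) < 1"
  using norm_mult_lt_1[OF c d] by simp

lemma qpoch_inf_factors_nonzero:
  "qpoch_inf c q \<noteq> 0" "qpoch_inf d q \<noteq> 0" "qpoch_inf (-(c * q)) q \<noteq> 0" "qpoch_inf (-(d * q)) q \<noteq> 0"
  "qpoch_inf (-(c * d)) q \<noteq> 0" "qpoch_inf (-q) q \<noteq> 0"
  using qpoch_inf_nonzero[OF q] c d q norm_neg_cd_less_1 norm_mult_lt_1[OF c q] norm_mult_lt_1[OF d q] by auto

text \<open>
  Both quotients \<open>(c)\<^sub>n / (-cq)\<^sub>n\<close> and \<open>(d)\<^sub>n / (-dq)\<^sub>n\<close> are expanded, and the remaining sum over \<open>n\<close> is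
  the Heine limit.
\<close>
lemma Lambda_first_series:
  "3 * c * d * (qpoch_inf (-(c * q)) q * qpoch_inf (-(d * q)) q) / (qpoch_inf (-(c * d)) q * qpoch_inf (-q) q)
     * (\<Sum>n. (qpoch c q n * qpoch d q n * qpoch (-(c * d)) q n)
                / (qpoch (-(c * q)) q n * qpoch (-(d * q)) q n * qpoch q q n)
                * q ^ (n * (n + 1) div 2 + 2 * n))
   = qpoch_inf c q * qpoch_inf d q * (3 * c * d * double_series (ratio_term q c) (ratio_term q d)
       (\<lambda>k A. euler_series (-(c * d)) q (k + A + 2)))"
proof -
  define a where "a = -(c * d)"
  have a: "norm a < 1" using norm_neg_cd_less_1 by (simp add: a_def)
  define \<alpha> where "\<alpha> n = qpoch a q n / qpoch q q n * (qpoch d q n / qpoch (-(d * q)) q n)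
     * q ^ (n * (n + 1) div 2 + 2 * n)" for n
  define K where "K = qpoch_inf d q / qpoch_inf (-(d * q)) q * (qpoch_inf a q * qpoch_inf (-q) q)"
  have dq: "norm (-(d * q)) < 1" using norm_mult_lt_1[OF d q] by simp
  obtain C where C: "\<And>n. norm (qpoch a q n / qpoch q q n) \<le> C" using qpoch_ratio_bounded[OF q q] by blast
  obtain D where D: "\<And>n. norm (qpoch d q n / qpoch (-(d * q)) q n) \<le> D" using qpoch_ratio_bounded[OF q dq] by blast
  have "norm (qpoch a q n / qpoch q q n * (qpoch d q n / qpoch (-(d * q)) q n)) \<le> C * D" for n
    unfolding norm_mult using order_trans[OF norm_ge_zero C] by (intro mult_mono C D) auto
  hence \<alpha>: "summable (\<lambda>n. norm (\<alpha> n))"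
    unfolding \<alpha>_def by (rule summable_triangular_weight[OF q])
  obtain B where B: "\<And>s. norm (euler_series a q s) \<le> B" using euler_series_bounded[OF q a] by blast
  have inner: "(\<Sum>n. \<alpha> n * q ^ (k * n)) = K * (\<Sum>A. ratio_term q d A * euler_series a q (k + A + 2))" for k
  proof -
    have "(\<Sum>n. \<alpha> n * q ^ (k * n)) = (\<Sum>n. qpoch a q n / qpoch q q n * (qpoch d q n / qpoch (-(d * q)) q n)
     * q ^ (n * (n + 1) div 2 + (k + 2) * n))"
      unfolding \<alpha>_def mult.assoc power_triangle_shift by (simp only: add.commute[of 2 k])
    thus ?thesis unfolding heine_limit_with_ratio[OF q a d] K_def by (simp add: add_ac)
  qed
  have "(\<Sum>n. (qpoch c q n * qpoch d q n * qpoch a q n)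
                / (qpoch (-(c * q)) q n * qpoch (-(d * q)) q n * qpoch q q n)
                * q ^ (n * (n + 1) div 2 + 2 * n))
     = (\<Sum>n. \<alpha> n * (qpoch c q n / qpoch (-(c * q)) q n))"
    unfolding \<alpha>_def by (rule suminf_cong) (simp add: mult_ac)
  also have "\<dots> = qpoch_inf c q / qpoch_inf (-(c * q)) q * (\<Sum>k. K * (ratio_term q c k *
      (\<Sum>A. ratio_term q d A * euler_series a q (k + A + 2))))"
    unfolding suminf_qpoch_ratio_factor[OF q c \<alpha>] inner ratio_term_def[of q c] by (simp only: mult_ac)
  also have "(\<Sum>k. K * (ratio_term q c k * (\<Sum>A. ratio_term q d A * euler_series a q (k + A + 2))))
     = K * double_series (ratio_term q c) (ratio_term q d) (\<lambda>k A. euler_series a q (k + A + 2))"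
    unfolding double_series_def
    by (rule suminf_mult[OF bounded_weighted_series(1)[OF summable_norm_ratio_term[OF q c]]],
        rule bounded_weighted_series(2)[OF summable_norm_ratio_term[OF q d] B])
  finally show ?thesis
    unfolding a_def[symmetric] using qpoch_inf_factors_nonzero unfolding a_def[symmetric]
    by (simp add: K_def)
qed

text \<open>
  With \<open>N = p + k\<close> the coefficients combine to \<open>w\<^sub>N c\<^sup>N (-1)\<^sub>p\<close> while the inner sum depends on \<open>N\<close> alone, apart
  from the factor that shifts \<open>(-1)\<^sub>p\<close> to \<open>(-1)\<^sub>p\<^sub>+\<^sub>2\<close>. Summing over \<open>p \<le> N\<close> gives \<open>S\<^sub>N\<close> for the
  unshifted part; the shifted part starts at \<open>(-1)\<^sub>2\<close> and gives \<open>S\<^sub>N\<^sub>+\<^sub>2 - 3\<close>.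
\<close>
lemma Lambda_second_series:
  "(qpoch_inf (-(d * q)) q * qpoch_inf c q) / (qpoch_inf (-(c * d)) q * qpoch_inf (-q) q)
       * (\<Sum>p. qpoch (-q) q p * qpoch (-1) q p * c ^ p / qpoch q q p
           * (\<Sum>k. qpoch (-(q ^ (p + 1))) q k * c ^ k / qpoch (q ^ (p + 1)) q k
               * (\<Sum>n. (qpoch (-(c * d)) q n * qpoch d q n)
                        / (qpoch (-(d * q)) q n * qpoch q q n)
                        * q ^ (n * (n + 1) div 2 + (p + k) * n)
                        * (1 + c * d * q ^ (2 * n) * (1 + q ^ p) * (1 + q ^ (p + 1))))))
   = qpoch_inf c q * qpoch_inf d q * double_series (ratio_term q c) (ratio_term q d)
       (\<lambda>k A. qpoch_partial_sum q k * euler_series (-(c * d)) q (k + A)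
          + c * d * (qpoch_partial_sum q (k + 2) - 3) * euler_series (-(c * d)) q (k + A + 2))"
proof -
  define a where "a = -(c * d)"
  have a: "norm a < 1" using norm_neg_cd_less_1 by (simp add: a_def)
  define K where "K = qpoch_inf d q / qpoch_inf (-(d * q)) q * (qpoch_inf a q * qpoch_inf (-q) q)"
  define R where "R s = (\<Sum>A. ratio_term q d A * euler_series a q (s + A))" for s
  let ?S = "qpoch_partial_sum q"
  have dq: "norm (-(d * q)) < 1" using norm_mult_lt_1[OF d q] by simp
  obtain C where C: "\<And>n. norm (qpoch a q n / qpoch q q n) \<le> C" using qpoch_ratio_bounded[OF q q] by blast
  obtain D where D: "\<And>n. norm (qpoch d q n / qpoch (-(d * q)) q n) \<le> D" using qpoch_ratio_bounded[OF q dq] by blast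
  have CD: "norm (qpoch a q n / qpoch q q n * (qpoch d q n / qpoch (-(d * q)) q n)) \<le> C * D" for n
    unfolding norm_mult using order_trans[OF norm_ge_zero C] by (intro mult_mono C D) auto
  obtain B where B: "\<And>s. norm (euler_series a q s) \<le> B" using euler_series_bounded[OF q a] by blast
  note R_summable = bounded_weighted_series(1)[OF summable_norm_ratio_term[OF q d] B]
  have R_sums: "(\<lambda>A. ratio_term q d A * euler_series a q (s + A)) sums R s" for s
    unfolding R_def by (rule summable_sums[OF R_summable])
  \<comment> \<open>\<open>R\<close> is bounded, hence so is the array \<open>T\<close> below, and \<open>F\<close> has a geometric majorant\<close>
  define BR where "BR = (\<Sum>A. norm (ratio_term q d A)) * B"
  have BR: "norm (R s) \<le> BR" for s
    unfolding R_def BR_def by (rule bounded_weighted_series(2)[OF summable_norm_ratio_term[OF q d] B])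
  obtain W where W: "W > 0" "\<And>n. norm (ratio_coeff q n) \<le> W" using ratio_coeff_bounded[OF q] by blast
  obtain \<Phi> where \<Phi>: "\<Phi> > 0" "\<And>n. norm (qpoch (-1) q n) \<le> \<Phi>" using qpoch_bounded[OF q] by (metis norm_minus_cancel norm_one order_refl)
  define T where "T p s = qpoch (-1) q p * R s + c * d * qpoch (-1) q (p + 2) * R (s + 2)" for p s
  have T_le: "norm (T p s) \<le> 2 * (\<Phi> * BR)" for p s
  proof -
    have 1: "norm (qpoch (-1) q m * R t) \<le> \<Phi> * BR" for m t
      unfolding norm_mult using \<Phi>(1) by (intro mult_mono \<Phi>(2) BR) auto
    have "norm (c * d) * norm (qpoch (-1) q (p + 2) * R (s + 2)) \<le> 1 * (\<Phi> * BR)"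
      using norm_mult_lt_1[OF c d] by (intro mult_mono 1) auto
    hence 2: "norm (c * d * qpoch (-1) q (p + 2) * R (s + 2)) \<le> \<Phi> * BR"
      by (simp only: norm_mult mult.assoc mult_1_left)
    show ?thesis unfolding T_def
      using norm_triangle_ineq[of "qpoch (-1) q p * R s" "c * d * qpoch (-1) q (p + 2) * R (s + 2)"] 1[of p s] 2 by linarith
  qed
  define F where "F p k = ratio_term q c (p + k) * (K * T p (p + k))" for p k
  have inner: "(\<Sum>n. (qpoch a q n * qpoch d q n) / (qpoch (-(d * q)) q n * qpoch q q n)
       * q ^ (n * (n + 1) div 2 + (p + k) * n) * (1 + c * d * q ^ (2 * n) * (1 + q ^ p) * (1 + q ^ (p + 1))))
     = K * (R (p + k) + c * d * (1 + q ^ p) * (1 + q ^ (p + 1)) * R (p + k + 2))" for p k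
  proof -
    have "(\<Sum>n. (qpoch a q n * qpoch d q n) / (qpoch (-(d * q)) q n * qpoch q q n)
       * q ^ (n * (n + 1) div 2 + (p + k) * n) * (1 + c * d * q ^ (2 * n) * (1 + q ^ p) * (1 + q ^ (p + 1))))
      = (\<Sum>n. qpoch a q n / qpoch q q n * (qpoch d q n / qpoch (-(d * q)) q n)
       * q ^ (n * (n + 1) div 2 + (p + k) * n) * (1 + c * d * q ^ (2 * n) * (1 + q ^ p) * (1 + q ^ (p + 1))))"
      by (simp add: mult_ac)
    also have "\<dots> = K * R (p + k) + c * d * (1 + q ^ p) * (1 + q ^ (p + 1)) * (K * R (p + k + 2))"
      unfolding triangular_sum_split[OF q CD] heine_limit_with_ratio[OF q a d] K_def R_def ..
    finally show ?thesis by (simp only: distrib_left mult_ac)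
  qed
  have row: "qpoch (-q) q p * qpoch (-1) q p * c ^ p / qpoch q q p
      * (\<Sum>k. qpoch (-(q ^ (p + 1))) q k * c ^ k / qpoch (q ^ (p + 1)) q k *
         (K * (R (p + k) + c * d * (1 + q ^ p) * (1 + q ^ (p + 1)) * R (p + k + 2)))) = (\<Sum>k. F p k)" for p
  proof -
    define x where "x = ratio_coeff q p * qpoch (-1) q p * c ^ p"
    define y where "y k = ratio_coeff q (p + k) / ratio_coeff q p * c ^ k *
         (K * (R (p + k) + c * d * (1 + q ^ p) * (1 + q ^ (p + 1)) * R (p + k + 2)))" for k
    have xy: "x * y k = F p k" for k
    proof -
      have "x * y k = ratio_term q c (p + k) * (K * (qpoch (-1) q p * R (p + k)
           + c * d * (qpoch (-1) q p * (1 + q ^ p) * (1 + q ^ (p + 1))) * R (p + k + 2)))"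
        using ratio_coeff_nonzero[OF q, of p]
        by (simp add: x_def y_def ratio_term_def power_add distrib_left mult_ac)
      thus ?thesis unfolding qpoch_minus_one_add_2 F_def T_def .
    qed
    have "qpoch (-1) q p \<noteq> 0"
      using qpoch_nonzero[OF q, of "-q"] q by (cases p) (simp_all add: qpoch_minus_one_Suc)
    have "summable y"
    proof -
      \<comment> \<open>summability of \<open>y\<close> cannot be read off from \<open>x * y k = F p k\<close>, as \<open>x\<close> may vanish when \<open>c = 0\<close>\<close>
      have y: "y k = (1 / (ratio_coeff q p * qpoch (-1) q p)) * (ratio_coeff q (p + k) * c ^ k * (K * T p (p + k)))" for k
        using ratio_coeff_nonzero[OF q, of p] \<open>qpoch (-1) q p \<noteq> 0\<close>
        unfolding y_def T_def qpoch_minus_one_add_2[symmetric]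
        by (simp add: divide_simps) (simp add: distrib_left mult_ac)
      have "norm (ratio_coeff q (p + k) * (K * T p (p + k))) \<le> W * (norm K * (2 * (\<Phi> * BR)))" for k
        unfolding norm_mult using W(1) by (intro mult_mono W(2) T_le order_refl) auto
      from summable_norm_cancel[OF summable_bounded_mult_power[OF this c]]
      have "summable (\<lambda>k. ratio_coeff q (p + k) * c ^ k * (K * T p (p + k)))"
        by (simp only: mult_ac)
      thus ?thesis unfolding y by (rule summable_mult)
    qed
    have "qpoch (-q) q p * qpoch (-1) q p * c ^ p / qpoch q q p
      * (\<Sum>k. qpoch (-(q ^ (p + 1))) q k * c ^ k / qpoch (q ^ (p + 1)) q k *
         (K * (R (p + k) + c * d * (1 + q ^ p) * (1 + q ^ (p + 1)) * R (p + k + 2)))) = x * (\<Sum>k. y k)"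
    proof -
      have "qpoch (-q) q p * qpoch (-1) q p * c ^ p / qpoch q q p = x"
        by (simp add: x_def ratio_coeff_def)
      moreover have "qpoch (-(q ^ (p + 1))) q k * c ^ k / qpoch (q ^ (p + 1)) q k
          = ratio_coeff q (p + k) / ratio_coeff q p * c ^ k" for k
        unfolding qpoch_shifted_ratio[OF q, of p k, symmetric] by (simp only: times_divide_eq_left)
      ultimately show ?thesis by (simp only: y_def)
    qed
    also have "\<dots> = (\<Sum>k. F p k)"
      using suminf_mult[OF \<open>summable y\<close>, of x] by (simp only: xy)
    finally show ?thesis .
  qed
  have F_le: "norm (F p k) \<le> W * (norm K * (2 * (\<Phi> * BR))) * norm c ^ p * norm c ^ k" for p k
  proof -
    have "norm (ratio_coeff q (p + k)) * (norm K * norm (T p (p + k))) \<le> W * (norm K * (2 * (\<Phi> * BR)))"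
      using W(1) by (intro mult_mono W(2) T_le order_refl) auto
    from mult_right_mono[OF this, of "norm c ^ (p + k)"]
    show ?thesis by (simp add: F_def ratio_term_def norm_mult norm_power power_add mult_ac)
  qed
  have BR0: "BR \<ge> 0" using order_trans[OF norm_ge_zero BR] .
  have "(\<Sum>p. \<Sum>k. F p k) = (\<Sum>N. \<Sum>p\<le>N. F p (N - p))"
    by (rule sums_unique[OF suminf_diagonals[OF _ _ F_le]])
      (use c W \<Phi> BR0 in \<open>auto intro!: summable_mult summable_geometric mult_nonneg_nonneg\<close>)
  also have "\<dots> = (\<Sum>N. ratio_term q c N * (\<Sum>A. ratio_term q d A * (K * (?S N * euler_series a q (N + A)
          + c * d * (?S (N + 2) - 3) * euler_series a q (N + A + 2)))))"
  proof (rule suminf_cong)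
    fix N
    have "(\<Sum>p\<le>N. F p (N - p)) = (\<Sum>p\<le>N. ratio_term q c N * (K * T p N))"
      by (rule sum.cong) (auto simp: F_def)
    also have "\<dots> = ratio_term q c N * (K * (?S N * R N + c * d * (\<Sum>p\<le>N. qpoch (-1) q (p + 1 + 1)) * R (N + 2)))"
    proof -
      have "(\<Sum>p\<le>N. T p N) = ?S N * R N + c * d * (\<Sum>p\<le>N. qpoch (-1) q (p + 1 + 1)) * R (N + 2)"
        by (simp add: T_def qpoch_partial_sum_def sum_distrib_left sum_distrib_right sum.distrib)
      thus ?thesis by (simp only: sum_distrib_left[symmetric])
    qed
    also have "(\<Sum>p\<le>N. qpoch (-1) q (p + 1 + 1)) = ?S (N + 2) - 3"
      unfolding sum_qpoch_minus_one qpoch_partial_sum_1 by (simp add: numeral_2_eq_2)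
    also have "K * (?S N * R N + c * d * (?S (N + 2) - 3) * R (N + 2))
      = (\<Sum>A. ratio_term q d A * (K * (?S N * euler_series a q (N + A)
          + c * d * (?S (N + 2) - 3) * euler_series a q (N + A + 2))))"
    proof (rule sums_unique)
      have "(\<lambda>A. K * (?S N * (ratio_term q d A * euler_series a q (N + A)) + c * d * (?S (N + 2) - 3) * (ratio_term q d A * euler_series a q (N + 2 + A))))
         sums (K * (?S N * R N + c * d * (?S (N + 2) - 3) * R (N + 2)))"
        by (intro sums_mult sums_add R_sums)
      thus "(\<lambda>A. ratio_term q d A * (K * (?S N * euler_series a q (N + A)
          + c * d * (?S (N + 2) - 3) * euler_series a q (N + A + 2))))
         sums (K * (?S N * R N + c * d * (?S (N + 2) - 3) * R (N + 2)))"
        by (simp only: distrib_left mult_ac add_ac)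
    qed
    finally show "(\<Sum>p\<le>N. F p (N - p)) = ratio_term q c N * (\<Sum>A. ratio_term q d A * (K * (?S N * euler_series a q (N + A)
          + c * d * (?S (N + 2) - 3) * euler_series a q (N + A + 2))))" .
  qed
  also have "\<dots> = K * double_series (ratio_term q c) (ratio_term q d) (\<lambda>k A. ?S k * euler_series a q (k + A)
          + c * d * (?S (k + 2) - 3) * euler_series a q (k + A + 2))"
  proof -
    obtain \<rho> where \<rho>: "\<rho> > 1" and r: "norm c * \<rho> < 1" "norm d * \<rho> < 1"
      using exists_common_radius[OF c d] .
    have "dominated \<rho> (\<lambda>k A. ?S k * euler_series a q (k + A)
        + c * d * (?S (k + 2) - 3) * euler_series a q (k + A + 2))"
      unfolding mult.commute[of "_ - _" "euler_series _ _ _"] mult.commute[of "?S _" "euler_series _ _ _"] mult.assoc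
      using \<rho> dominated_partial_sum(1)[OF q \<rho>, of 0]
      by (intro dominated_add dominated_cmult dominated_bounded_mult[OF B] dominated_diff
           dominated_const dominated_partial_sum[OF q]) auto
    from double_series_cmult[OF summable_ratio_term[OF q _ r(1)] summable_ratio_term[OF q _ r(2)] this, of K]
    show ?thesis using \<rho> by (simp add: double_series_def)
  qed
  finally show ?thesis
    unfolding a_def[symmetric] inner row using qpoch_inf_factors_nonzero unfolding a_def[symmetric]
    by (simp add: K_def)
qed

lemma sum_qpoch_minus_one_combination:
  "(\<Sum>i\<le>n. qpoch (-1) q (i + 1 + k) * x + c * d * qpoch (-1) q (i + 1 + k + 2) * y)
   = (qpoch_partial_sum q (k + Suc n) - qpoch_partial_sum q k) * x
     + c * d * (qpoch_partial_sum q (k + Suc n + 2) - qpoch_partial_sum q (k + 2)) * y"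
proof -
  have "(\<Sum>i\<le>n. qpoch (-1) q (i + 1 + k) * x + c * d * qpoch (-1) q (i + 1 + k + 2) * y)
     = (\<Sum>i\<le>n. qpoch (-1) q (i + 1 + k)) * x + c * d * (\<Sum>i\<le>n. qpoch (-1) q (i + 1 + (k + 2))) * y"
    by (simp add: sum.distrib sum_distrib_left sum_distrib_right add.assoc)
  thus ?thesis unfolding sum_qpoch_minus_one by (simp add: add_ac)
qed

text \<open>
  Here \<open>A = p + j\<close> is the exponent of \<open>d\<close>. The coefficients combine to
  \<open>w\<^sub>A d\<^sup>A w\<^sub>k c\<^sup>k (-1)\<^sub>p\<^sub>+\<^sub>k\<close>, since \<open>(-1)\<^sub>p (-q\<^sup>p)\<^sub>k = (-1)\<^sub>p\<^sub>+\<^sub>k\<close>. The sum over \<open>k\<close> is moved to the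
  outside, and summing over \<open>1 \<le> p \<le> A\<close> leaves \<open>S\<^sub>k\<^sub>+\<^sub>A - S\<^sub>k\<close>; the term \<open>A = 0\<close>, which does not occur
  in the sum over \<open>p\<close>, can be added because this difference then vanishes.
\<close>
lemma Lambda_third_series:
  "(qpoch_inf d q * qpoch_inf c q) / (qpoch_inf (-(c * d)) q * qpoch_inf (-q) q)
       * (\<Sum>i. let p = i + 1 in
           qpoch (-q) q p * qpoch (-1) q p * d ^ p / qpoch q q p
           * (\<Sum>k. qpoch (-q) q k * qpoch (-(q ^ p)) q k * c ^ k / qpoch q q k
               * (\<Sum>j. qpoch (-(q ^ (p + 1))) q j * d ^ j / qpoch (q ^ (p + 1)) q j
                   * (\<Sum>n. qpoch (-(c * d)) q n / qpoch q q n
                            * q ^ (n * (n + 1) div 2 + (p + k + j) * n)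
                            * (1 + c * d * q ^ (2 * n)
                                   * (1 + q ^ (p + k)) * (1 + q ^ (p + k + 1)))))))
   = qpoch_inf c q * qpoch_inf d q * double_series (ratio_term q c) (ratio_term q d)
       (\<lambda>k A. (qpoch_partial_sum q (k + A) - qpoch_partial_sum q k) * euler_series (-(c * d)) q (k + A)
          + c * d * (qpoch_partial_sum q (k + A + 2) - qpoch_partial_sum q (k + 2)) * euler_series (-(c * d)) q (k + A + 2))"
proof -
  define a where "a = -(c * d)"
  have a: "norm a < 1" using norm_neg_cd_less_1 by (simp add: a_def)
  define K where "K = qpoch_inf a q * qpoch_inf (-q) q"
  let ?S = "qpoch_partial_sum q"
  define Y where "Y = euler_series a q"
  obtain C where C: "\<And>n. norm (qpoch a q n / qpoch q q n) \<le> C" using qpoch_ratio_bounded[OF q q] by blast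
  obtain B where B: "\<And>s. norm (Y s) \<le> B" unfolding Y_def using euler_series_bounded[OF q a] by blast
  have B0: "B \<ge> 0" using order_trans[OF norm_ge_zero B] .
  obtain W where W: "W > 0" "\<And>n. norm (ratio_coeff q n) \<le> W" using ratio_coeff_bounded[OF q] by blast
  obtain \<Phi> where \<Phi>: "\<Phi> > 0" "\<And>n. norm (qpoch (-1) q n) \<le> \<Phi>" using qpoch_minus_one_bounded[OF q] by blast
  \<comment> \<open>below, \<open>r\<close> is \<open>p + k\<close> and \<open>s\<close> is the total exponent \<open>p + k + j\<close>\<close>
  define T where "T r s = qpoch (-1) q r * Y s + c * d * qpoch (-1) q (r + 2) * Y (s + 2)" for r s
  have T_le: "norm (T r s) \<le> 2 * (\<Phi> * B)" for r s
  proof -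
    have 1: "norm (qpoch (-1) q m * Y t) \<le> \<Phi> * B" for m t
      unfolding norm_mult using \<Phi>(1) by (intro mult_mono \<Phi>(2) B) auto
    have "norm (c * d) * norm (qpoch (-1) q (r + 2) * Y (s + 2)) \<le> 1 * (\<Phi> * B)"
      using norm_mult_lt_1[OF c d] by (intro mult_mono 1) auto
    hence 2: "norm (c * d * qpoch (-1) q (r + 2) * Y (s + 2)) \<le> \<Phi> * B"
      by (simp only: norm_mult mult.assoc mult_1_left)
    show ?thesis unfolding T_def
      using norm_triangle_ineq[of "qpoch (-1) q r * Y s" "c * d * qpoch (-1) q (r + 2) * Y (s + 2)"] 1[of r s] 2 by linarith
  qed
  define L where "L p k j = K * (Y (p + k + j) + c * d * (1 + q ^ (p + k)) * (1 + q ^ (p + k + 1)) * Y (p + k + j + 2))" for p k j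
  have inner: "(\<Sum>n. qpoch a q n / qpoch q q n * q ^ (n * (n + 1) div 2 + (p + k + j) * n)
        * (1 + c * d * q ^ (2 * n) * (1 + q ^ (p + k)) * (1 + q ^ (p + k + 1)))) = L p k j" for p k j
    unfolding triangular_sum_split[OF q C] heine_limit[OF q a] L_def K_def Y_def
    by (simp add: distrib_left mult_ac)
  have L_T: "qpoch (-1) q (p + k) * L p k j = K * T (p + k) (p + k + j)" for p k j
    unfolding L_def T_def qpoch_minus_one_add_2[symmetric] by (simp add: distrib_left mult_ac)
  define z where "z p j = ratio_coeff q (p + j) / ratio_coeff q p * d ^ j" for p j
  have z: "qpoch (-(q ^ (p + 1))) q j * d ^ j / qpoch (q ^ (p + 1)) q j = z p j" for p j
    unfolding z_def qpoch_shifted_ratio[OF q, of p j, symmetric] by (simp only: times_divide_eq_left)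
  define F where "F k i j = ratio_term q d (i + 1 + j) * (K * T (i + 1 + k) (i + 1 + k + j))" for k i j
  define M where "M = W * (norm K * (2 * (\<Phi> * B)))"
  have M0: "M \<ge> 0" using W \<Phi> B0 by (simp add: M_def)
  have rKT: "norm (ratio_coeff q n * (K * T r s)) \<le> M" for n r s
    unfolding norm_mult M_def using W(1) by (intro mult_mono W(2) T_le order_refl) auto
  have F_le: "norm (F k i j) \<le> M * norm d ^ (i + 1) * norm d ^ j" for k i j
  proof -
    have "norm (F k i j) = norm (ratio_coeff q (i + 1 + j) * (K * T (i + 1 + k) (i + 1 + k + j))) * norm d ^ (i + 1 + j)"
      by (simp add: F_def ratio_term_def norm_mult norm_power)
    also have "\<dots> \<le> M * norm d ^ (i + 1 + j)" by (intro mult_right_mono rKT) auto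
    finally show ?thesis by (simp add: power_add mult_ac)
  qed
  have geo: "summable (\<lambda>i. M * norm d ^ (i + 1))" "summable (\<lambda>j. norm d ^ j)"
  proof -
    show g: "summable (\<lambda>j. norm d ^ j)" using d by (intro summable_geometric) simp
    have "summable (\<lambda>i. M * norm d * norm d ^ i)" by (rule summable_mult[OF g])
    thus "summable (\<lambda>i. M * norm d ^ (i + 1))" by (simp add: mult_ac)
  qed
  define x where "x i = ratio_coeff q (i + 1) * qpoch (-1) q (i + 1) * d ^ (i + 1)" for i
  define G where "G i k = qpoch (-(q ^ (i + 1))) q k * (\<Sum>j. z (i + 1) j * L (i + 1) k j)" for i k
  have zL: "z p j * L p k j = 1 / (ratio_coeff q p * qpoch (-1) q (p + k)) * (ratio_coeff q (p + j) * (K * T (p + k) (p + k + j)) * d ^ j)" for p k j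
    using qpoch_minus_one_nonzero[OF q] ratio_coeff_nonzero[OF q]
    unfolding L_T[symmetric] z_def by simp
  have zL_summable: "summable (\<lambda>j. z p j * L p k j)" for p k
    unfolding zL by (rule summable_mult[OF summable_norm_cancel[OF summable_bounded_mult_power[OF rKT d]]])
  have x_G: "x i * G i k = (\<Sum>j. F k i j)" for i k
  proof -
    have "x i * G i k = (\<Sum>j. x i * qpoch (-(q ^ (i + 1))) q k * (z (i + 1) j * L (i + 1) k j))"
      unfolding G_def suminf_mult[OF zL_summable] by (simp only: mult.assoc)
    also have "\<dots> = (\<Sum>j. F k i j)"
    proof (rule suminf_cong)
      fix j
      have "x i * qpoch (-(q ^ (i + 1))) q k * (z (i + 1) j * L (i + 1) k j)
        = ratio_term q d (i + 1 + j) * ((qpoch (-1) q (i + 1) * qpoch (-(q ^ (i + 1))) q k) * L (i + 1) k j)"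
        using ratio_coeff_nonzero[OF q, of "i + 1"]
        by (simp add: x_def z_def ratio_term_def power_add mult_ac)
      thus "x i * qpoch (-(q ^ (i + 1))) q k * (z (i + 1) j * L (i + 1) k j) = F k i j"
        unfolding qpoch_minus_one_add[symmetric] L_T F_def .
    qed
    finally show ?thesis .
  qed
  have x_summable: "summable (\<lambda>i. norm (x i))"
  proof (rule summable_comparison_test')
    show "summable (\<lambda>i. W * \<Phi> * norm d * norm d ^ i)" by (rule summable_mult[OF geo(2)])
    fix i
    have "norm (ratio_coeff q (i + 1)) * norm (qpoch (-1) q (i + 1)) * norm d ^ (i + 1) \<le> W * \<Phi> * norm d ^ (i + 1)"
      using W(1) by (intro mult_right_mono mult_mono W(2) \<Phi>(2)) auto
    thus "norm (norm (x i)) \<le> W * \<Phi> * norm d * norm d ^ i" by (simp add: x_def norm_mult norm_power mult_ac)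
  qed
  obtain BG where G_le: "\<And>i k. norm (G i k) \<le> BG"
  proof -
    obtain P where P: "P > 0" "\<And>n. norm (qpoch q q n) \<le> P" using qpoch_bounded[OF q] q by (metis order_less_imp_le)
    obtain D where D: "D > 0" "\<And>n. norm (1 / qpoch (-q) q n) \<le> D"
      using inverse_qpoch_bounded[OF q, of "-q"] q by auto
    \<comment> \<open>the growth in \<open>k\<close> cancels: \<open>(-q\<^sup>p)\<^sub>k / (-1)\<^sub>p\<^sub>+\<^sub>k = 1 / (-1)\<^sub>p\<close>, which bounds \<open>G\<close> uniformly\<close>
    define \<theta> where "\<theta> i = 1 / (ratio_coeff q (i + 1) * qpoch (-1) q (i + 1))" for i
    have \<theta>: "norm (\<theta> i) \<le> P * D * D" for i
    proof -
      have "\<theta> i = qpoch q q (i + 1) * (1 / qpoch (-q) q (i + 1)) * (1 / qpoch (-q) q i) / 2"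
        using qpoch_minus_one_Suc[of q i] by (simp add: \<theta>_def ratio_coeff_def)
      hence "norm (\<theta> i) = norm (qpoch q q (i + 1)) * norm (1 / qpoch (-q) q (i + 1)) * norm (1 / qpoch (-q) q i) / 2"
        by (simp only: norm_mult norm_divide norm_numeral)
      also have "\<dots> \<le> norm (qpoch q q (i + 1)) * norm (1 / qpoch (-q) q (i + 1)) * norm (1 / qpoch (-q) q i)"
        by simp
      also have "\<dots> \<le> P * D * D"
        using P(1) D(1) by (intro mult_mono P(2) D(2)) auto
      finally show ?thesis .
    qed
    define h where "h i k j = ratio_coeff q (i + 1 + j) * (K * T (i + 1 + k) (i + 1 + k + j))" for i k j
    have "summable (\<lambda>j. norm (d ^ j))" using geo(2) by (simp add: norm_power)
    note hb = bounded_weighted_series[OF this, of "h i k" M for i k]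
    have h_le: "norm (h i k j) \<le> M" for i k j unfolding h_def by (rule rKT)
    have "G i k = \<theta> i * (\<Sum>j. d ^ j * h i k j)" for i k
    proof -
      have "qpoch (-(q ^ (i + 1))) q k * (1 / (ratio_coeff q (i + 1) * qpoch (-1) q (i + 1 + k))) = \<theta> i"
      proof -
        have "qpoch (-(q ^ (i + 1))) q k \<noteq> 0"
          using qpoch_minus_one_nonzero[OF q, of "i + 1 + k"] unfolding qpoch_minus_one_add by auto
        thus ?thesis unfolding qpoch_minus_one_add \<theta>_def by simp
      qed
      moreover have "(\<Sum>j. z (i + 1) j * L (i + 1) k j)
        = 1 / (ratio_coeff q (i + 1) * qpoch (-1) q (i + 1 + k)) * (\<Sum>j. d ^ j * h i k j)"
        unfolding zL using suminf_mult[OF hb(1)[OF h_le]] by (simp only: h_def mult.commute[of "d ^ _"])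
      ultimately show ?thesis by (simp only: G_def mult.assoc[symmetric])
    qed
    hence "norm (G i k) \<le> P * D * D * ((\<Sum>j. norm (d ^ j)) * M)" for i k
      using P(1) D(1) by (simp only: norm_mult) (intro mult_mono \<theta> hb(2) h_le; simp)
    with that show ?thesis by blast
  qed
  have "(\<Sum>i. let p = i + 1 in
           qpoch (-q) q p * qpoch (-1) q p * d ^ p / qpoch q q p
           * (\<Sum>k. qpoch (-q) q k * qpoch (-(q ^ p)) q k * c ^ k / qpoch q q k
               * (\<Sum>j. z p j * L p k j)))
      = double_series x (ratio_term q c) G"
    unfolding double_series_def Let_def
    by (simp add: x_def G_def ratio_term_def ratio_coeff_def mult_ac)
  also have "\<dots> = double_series (ratio_term q c) x (\<lambda>k i. G i k)"
    by (rule double_series_swap_bounded[OF x_summable summable_norm_ratio_term[OF q c] G_le])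
  also have "\<dots> = double_series (ratio_term q c) (ratio_term q d)
       (\<lambda>k A. K * ((?S (k + A) - ?S k) * Y (k + A) + c * d * (?S (k + A + 2) - ?S (k + 2)) * Y (k + A + 2)))"
    unfolding double_series_def
  proof (rule suminf_cong)
    fix k
    define H where "H A = ratio_term q d A * (K * ((?S (k + A) - ?S k) * Y (k + A)
       + c * d * (?S (k + A + 2) - ?S (k + 2)) * Y (k + A + 2)))" for A
    have "(\<lambda>n. \<Sum>i\<le>n. F k i (n - i)) sums (\<Sum>i. \<Sum>j. F k i j)"
      by (rule suminf_diagonals[OF geo F_le]) (use M0 in auto)
    moreover have "(\<Sum>i\<le>n. F k i (n - i)) = H (Suc n)" for n
    proof -
      have "(\<Sum>i\<le>n. F k i (n - i)) = (\<Sum>i\<le>n. ratio_term q d (Suc n) * (K * T (i + 1 + k) (k + Suc n)))"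
        by (rule sum.cong) (auto simp: F_def)
      also have "\<dots> = ratio_term q d (Suc n) * (K * (\<Sum>i\<le>n. T (i + 1 + k) (k + Suc n)))"
        by (simp only: sum_distrib_left)
      finally show ?thesis unfolding T_def sum_qpoch_minus_one_combination H_def .
    qed
    ultimately have "(\<lambda>n. H (Suc n)) sums (\<Sum>i. \<Sum>j. F k i j)" by (simp only:)
    moreover have "H 0 = 0" by (simp add: H_def)
    ultimately have "H sums (\<Sum>i. \<Sum>j. F k i j)" using sums_Suc_iff[of H] by simp
    hence "(\<Sum>i. \<Sum>j. F k i j) = suminf H" by (rule sums_unique)
    thus "ratio_term q c k * (\<Sum>i. x i * G i k) = ratio_term q c k * (\<Sum>j. ratio_term q d j * (K * ((?S (k + j) - ?S k) * Y (k + j)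
       + c * d * (?S (k + j + 2) - ?S (k + 2)) * Y (k + j + 2))))"
      by (simp only: x_G H_def[abs_def])
  qed
  also have "\<dots> = K * double_series (ratio_term q c) (ratio_term q d)
       (\<lambda>k A. (?S (k + A) - ?S k) * Y (k + A) + c * d * (?S (k + A + 2) - ?S (k + 2)) * Y (k + A + 2))"
  proof -
    obtain \<rho> where \<rho>: "\<rho> > 1" and r: "norm c * \<rho> < 1" "norm d * \<rho> < 1"
      using exists_common_radius[OF c d] .
    have "dominated \<rho> (\<lambda>k A. (?S (k + A) - ?S k) * Y (k + A) + c * d * (?S (k + A + 2) - ?S (k + 2)) * Y (k + A + 2))"
      unfolding mult.commute[of "_ - _" "Y _"] mult.assoc
      using \<rho> dominated_partial_sum(1)[OF q \<rho>, of 0] dominated_partial_sum(2)[OF q \<rho>, of 0]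
      by (intro dominated_add dominated_cmult dominated_bounded_mult[OF B] dominated_diff
           dominated_partial_sum[OF q \<rho>]) auto
    from double_series_cmult[OF summable_ratio_term[OF q _ r(1)] summable_ratio_term[OF q _ r(2)] this, of K]
    show ?thesis using \<rho> by simp
  qed
  finally show ?thesis
    unfolding a_def[symmetric] inner z using qpoch_inf_factors_nonzero unfolding a_def[symmetric] Y_def
    by (simp add: K_def)
qed


text \<open>
  With \<open>M = p + m\<close> and \<open>t = j + k\<close>, one has \<open>(q)\<^sub>p (q\<^sup>p\<^sup>+\<^sup>1)\<^sub>m = (q)\<^sub>M\<close> and
  \<open>2 / (-q\<^sup>t\<^sup>+\<^sup>p)\<^sub>m\<^sub>+\<^sub>1 = (-1)\<^sub>t\<^sub>+\<^sub>p / (-q)\<^sub>t\<^sub>+\<^sub>M\<close>. The sum over \<open>p\<close> is moved inside the sums over \<open>j\<close> and \<open>k\<close>,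
  and summing over \<open>1 \<le> p \<le> M\<close> leaves \<open>S\<^sub>t\<^sub>+\<^sub>M - S\<^sub>t\<close>.
\<close>
lemma Lambda_fourth_series:
  "2 * (qpoch_inf d q * qpoch_inf c q)
       * (\<Sum>i. let p = i + 1 in
           (-(c * d)) ^ p / qpoch q q p
           * (\<Sum>j. qpoch (-q) q j * d ^ j / qpoch q q j
               * (\<Sum>k. qpoch (-q) q k * c ^ k / qpoch q q k
                   * (\<Sum>m. (-(c * d)) ^ m
                            / (qpoch (q ^ (p + 1)) q m
                               * qpoch (-(q ^ (p + k + j))) q (m + 1))
                            * (1 + c * d
                                   * (((1 + q ^ (p + k + j)) * (1 + q ^ (p + k + j + 1)))
                                      / ((1 + q ^ (p + k + j + m + 1))
                                         * (1 + q ^ (p + k + j + m + 2)))))))))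
   = qpoch_inf c q * qpoch_inf d q * double_series (ratio_term q c) (ratio_term q d)
       (\<lambda>k A. \<Sum>M. (-(c * d)) ^ M / qpoch q q M *
          ((qpoch_partial_sum q (k + A + M) - qpoch_partial_sum q (k + A)) / qpoch (-q) q (k + A + M)
            + c * d * (qpoch_partial_sum q (k + A + M + 2) - qpoch_partial_sum q (k + A + 2)) / qpoch (-q) q (k + A + M + 2)))"
proof -
  define a where "a = -(c * d)"
  have a: "norm a < 1" using norm_neg_cd_less_1 by (simp add: a_def)
  let ?S = "qpoch_partial_sum q"
  have mq: "norm (-q) < 1" using q by simp
  obtain D where D: "D > 0" "\<And>n. norm (1 / qpoch (-q) q n) \<le> D"
    using inverse_qpoch_bounded[OF q mq] by blast
  obtain C where C: "C > 0" "\<And>n. norm (1 / qpoch q q n) \<le> C" using inverse_qpoch_bounded[OF q q] by blast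
  obtain P where P: "P > 0" "\<And>n. norm (qpoch q q n) \<le> P" using qpoch_bounded[OF q] q by (metis order_less_imp_le)
  obtain \<Phi> where \<Phi>: "\<Phi> > 0" "\<And>n. norm (qpoch (-1) q n) \<le> \<Phi>" using qpoch_minus_one_bounded[OF q] by blast
  define T where "T r s = qpoch (-1) q r / qpoch (-q) q s + c * d * qpoch (-1) q (r + 2) / qpoch (-q) q (s + 2)" for r s
  have T_le: "norm (T r s) \<le> 2 * (\<Phi> * D)" for r s
  proof -
    have 1: "norm (qpoch (-1) q m * (1 / qpoch (-q) q t)) \<le> \<Phi> * D" for m t
      unfolding norm_mult using \<Phi>(1) by (intro mult_mono \<Phi>(2) D(2)) auto
    have "norm (c * d) * norm (qpoch (-1) q (r + 2) * (1 / qpoch (-q) q (s + 2))) \<le> 1 * (\<Phi> * D)"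
      using norm_mult_lt_1[OF c d] by (intro mult_mono 1) auto
    hence 2: "norm (c * d * qpoch (-1) q (r + 2) / qpoch (-q) q (s + 2)) \<le> \<Phi> * D"
      by (simp add: norm_mult norm_divide mult.assoc)
    show ?thesis unfolding T_def
      using norm_triangle_ineq[of "qpoch (-1) q r / qpoch (-q) q s" "c * d * qpoch (-1) q (r + 2) / qpoch (-q) q (s + 2)"] 1[of r s] 2
      by simp
  qed
  define h where "h p t m = a ^ m / (qpoch (q ^ (p + 1)) q m * qpoch (-(q ^ (p + t))) q (m + 1))
      * (1 + c * d * (((1 + q ^ (p + t)) * (1 + q ^ (p + t + 1))) / ((1 + q ^ (p + t + m + 1)) * (1 + q ^ (p + t + m + 2)))))" for p t m
  \<comment> \<open>bounded form of the summand: the power of \<open>a\<close> is the only factor that decays\<close>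
  define b where "b p t m = 1 / qpoch q q (p + m) * T (p + t) (p + t + m)" for p t m
  have h_b: "h p t m = qpoch q q p / 2 * (b p t m * a ^ m)" for p t m
  proof -
    define s where "s = p + t"
    have q_split: "qpoch q q (p + m) = qpoch q q p * qpoch (q ^ (p + 1)) q m"
      by (simp add: qpoch_add)
    have s_split: "qpoch (-1) q s * qpoch (-(q ^ s)) q (m + 1) = 2 * qpoch (-q) q (s + m)"
      using qpoch_minus_one_add[of q s "m + 1"] qpoch_minus_one_Suc[of q "s + m"] by simp
    have e: "qpoch (-q) q (s + m + 2) = qpoch (-q) q (s + m) * ((1 + q ^ (s + m + 1)) * (1 + q ^ (s + m + 2)))"
      by (simp add: qpoch_Suc numeral_2_eq_2)
    have nz: "qpoch (-1) q s \<noteq> 0" "qpoch (-q) q (s + m) \<noteq> 0" "qpoch (-q) q (s + m + 2) \<noteq> 0" "qpoch q q (p + m) \<noteq> 0"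
      using qpoch_minus_one_nonzero[OF q] qpoch_nonzero[OF q mq] qpoch_nonzero[OF q q] by blast+
    have w: "1 / qpoch (-(q ^ s)) q (m + 1) = qpoch (-1) q s / (2 * qpoch (-q) q (s + m))"
    proof -
      have "qpoch (-1) q s / (2 * qpoch (-q) q (s + m)) = qpoch (-1) q s / (qpoch (-1) q s * qpoch (-(q ^ s)) q (m + 1))"
        by (simp only: s_split)
      thus ?thesis using nz(1) by simp
    qed
    have T: "T s (s + m) = qpoch (-1) q s / qpoch (-q) q (s + m) *
       (1 + c * d * (((1 + q ^ s) * (1 + q ^ (s + 1))) / ((1 + q ^ (s + m + 1)) * (1 + q ^ (s + m + 2)))))"
    proof -
      have frac: "f / v + g * (f * y * y') / (v * z) = f / v * (1 + g * ((y * y') / z))" for f g v y y' z :: complex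
        by (simp add: distrib_left mult_ac)
      show ?thesis unfolding T_def e qpoch_minus_one_add_2[symmetric] by (rule frac)
    qed
    have "h p t m = a ^ m * (1 / qpoch (q ^ (p + 1)) q m) * (1 / qpoch (-(q ^ s)) q (m + 1))
       * (1 + c * d * (((1 + q ^ s) * (1 + q ^ (s + 1))) / ((1 + q ^ (s + m + 1)) * (1 + q ^ (s + m + 2)))))"
      by (simp add: h_def s_def)
    also have "\<dots> = a ^ m * (1 / qpoch (q ^ (p + 1)) q m) * (T s (s + m) / 2)"
    proof -
      have "x * y * (f / (2 * v)) * g = x * y * (f / v * g / 2)" for x y f v g :: complex
        by (simp add: mult_ac)
      thus ?thesis unfolding w T .
    qed
    also have "1 / qpoch (q ^ (p + 1)) q m = qpoch q q p * (1 / qpoch q q (p + m))"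
      using nz(4) unfolding q_split by simp
    finally show ?thesis by (simp add: b_def s_def mult_ac)
  qed
  define M where "M = C * (2 * (\<Phi> * D))"
  have M0: "M \<ge> 0" using C \<Phi> D by (simp add: M_def)
  have b_le: "norm (b p t m) \<le> M" for p t m
    unfolding b_def M_def norm_mult using C(1) by (intro mult_mono C(2) T_le) auto
  have ba: "summable (\<lambda>m. b p t m * a ^ m)" for p t
    by (rule summable_norm_cancel[OF summable_bounded_mult_power[OF b_le a]])
  have geo: "summable (\<lambda>j. norm (a ^ j))" "summable (\<lambda>j. norm a ^ j)" using a by (simp_all add: norm_power summable_geometric)
  define Hs where "Hs p t = (\<Sum>m. h p t m)" for p t
  have Hs_b: "Hs p t = qpoch q q p / 2 * (\<Sum>m. b p t m * a ^ m)" for p t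
    unfolding Hs_def h_b by (rule suminf_mult[OF ba])
  define BH where "BH = P * ((\<Sum>j. norm (a ^ j)) * M)"
  have Hs_le: "norm (Hs p t) \<le> BH" for p t
  proof -
    have "norm (\<Sum>m. a ^ m * b p t m) \<le> (\<Sum>j. norm (a ^ j)) * M"
      by (rule bounded_weighted_series(2)[OF geo(1) b_le])
    moreover have "norm (qpoch q q p / 2) \<le> P" using P(1) P(2)[of p] by (simp add: norm_divide)
    ultimately show ?thesis
      unfolding Hs_b norm_mult BH_def using P(1) by (intro mult_mono) (auto simp: mult.commute)
  qed
  define x where "x i = a ^ (i + 1) / qpoch q q (i + 1)" for i
  define F where "F t i m = a ^ (i + 1 + m) * b (i + 1) t m" for t i m
  have x_Hs: "2 * (x i * Hs (i + 1) t) = (\<Sum>m. F t i m)" for i t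
  proof -
    have "2 * (x i * Hs (i + 1) t) = a ^ (i + 1) * (\<Sum>m. b (i + 1) t m * a ^ m)"
      using qpoch_nonzero[OF q q, of "i + 1"] by (simp add: x_def Hs_b)
    also have "\<dots> = (\<Sum>m. a ^ (i + 1) * (b (i + 1) t m * a ^ m))"
      by (rule suminf_mult[OF ba, symmetric])
    also have "\<dots> = (\<Sum>m. F t i m)"
      by (simp only: F_def power_add mult_ac)
    finally show ?thesis .
  qed
  have x_summable: "summable (\<lambda>i. norm (x i))"
  proof -
    have "summable (\<lambda>i. norm (1 / qpoch q q i * a ^ i))" by (rule summable_bounded_mult_power[OF C(2) a])
    hence "summable (\<lambda>i. norm (1 / qpoch q q (Suc i) * a ^ Suc i))" by (subst summable_Suc_iff)
    thus ?thesis by (simp add: x_def)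
  qed
  define Q where "Q t = (\<Sum>M. a ^ M / qpoch q q M * ((?S (t + M) - ?S t) / qpoch (-q) q (t + M)
            + c * d * (?S (t + M + 2) - ?S (t + 2)) / qpoch (-q) q (t + M + 2)))" for t
  have x_sum: "2 * (\<Sum>i. x i * Hs (i + 1) t) = Q t" for t
  proof -
    define H where "H N = a ^ N / qpoch q q N * ((?S (t + N) - ?S t) / qpoch (-q) q (t + N)
            + c * d * (?S (t + N + 2) - ?S (t + 2)) / qpoch (-q) q (t + N + 2))" for N
    have F_le: "norm (F t i m) \<le> M * norm a ^ (i + 1) * norm a ^ m" for i m
    proof -
      have "norm (F t i m) = norm a ^ (i + 1 + m) * norm (b (i + 1) t m)" by (simp only: F_def norm_mult norm_power)
      also have "\<dots> \<le> norm a ^ (i + 1 + m) * M" by (intro mult_left_mono b_le) auto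
      finally show ?thesis by (simp only: power_add mult_ac)
    qed
    have "summable (\<lambda>i. M * norm a * norm a ^ i)" by (rule summable_mult[OF geo(2)])
    hence g: "summable (\<lambda>i. M * norm a ^ (i + 1))" by (simp add: mult_ac)
    have "(\<lambda>n. \<Sum>i\<le>n. F t i (n - i)) sums (\<Sum>i. \<Sum>m. F t i m)"
      by (rule suminf_diagonals[OF g geo(2) F_le]) (use M0 in auto)
    moreover have "(\<Sum>i\<le>n. F t i (n - i)) = H (Suc n)" for n
    proof -
      have "(\<Sum>i\<le>n. F t i (n - i)) = (\<Sum>i\<le>n. a ^ Suc n / qpoch q q (Suc n) * T (i + 1 + t) (t + Suc n))"
        by (rule sum.cong) (auto simp: F_def b_def add_ac)
      also have "\<dots> = a ^ Suc n / qpoch q q (Suc n) * (\<Sum>i\<le>n. T (i + 1 + t) (t + Suc n))"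
        by (simp only: sum_distrib_left)
      also have "(\<Sum>i\<le>n. T (i + 1 + t) (t + Suc n)) = (\<Sum>i\<le>n. qpoch (-1) q (i + 1 + t) * (1 / qpoch (-q) q (t + Suc n))
           + c * d * qpoch (-1) q (i + 1 + t + 2) * (1 / qpoch (-q) q (t + Suc n + 2)))"
        by (simp add: T_def)
      finally show ?thesis unfolding sum_qpoch_minus_one_combination H_def by simp
    qed
    ultimately have "(\<lambda>n. H (Suc n)) sums (\<Sum>i. \<Sum>m. F t i m)" by (simp only:)
    moreover have "H 0 = 0" by (simp add: H_def)
    ultimately have "H sums (\<Sum>i. \<Sum>m. F t i m)" using sums_Suc_iff[of H] by simp
    hence "(\<Sum>i. \<Sum>m. F t i m) = Q t" unfolding H_def Q_def by (rule sums_unique)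
    moreover have "(\<Sum>i. \<Sum>m. F t i m) = 2 * (\<Sum>i. x i * Hs (i + 1) t)"
      unfolding x_Hs[symmetric] by (rule suminf_mult[OF bounded_weighted_series(1)[OF x_summable Hs_le]])
    ultimately show ?thesis by simp
  qed
  note uv = summable_norm_ratio_term[OF q c] summable_norm_ratio_term[OF q d]
  let ?u = "ratio_term q c" and ?v = "ratio_term q d"
  have "(\<Sum>i. let p = i + 1 in
           a ^ p / qpoch q q p
           * (\<Sum>j. qpoch (-q) q j * d ^ j / qpoch q q j
               * (\<Sum>k. qpoch (-q) q k * c ^ k / qpoch q q k
                   * (\<Sum>m. a ^ m
                            / (qpoch (q ^ (p + 1)) q m
                               * qpoch (-(q ^ (p + k + j))) q (m + 1))
                            * (1 + c * d
                                   * (((1 + q ^ (p + k + j)) * (1 + q ^ (p + k + j + 1)))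
                                      / ((1 + q ^ (p + k + j + m + 1))
                                         * (1 + q ^ (p + k + j + m + 2)))))))))
     = double_series x ?v (\<lambda>i j. \<Sum>k. ?u k * Hs (i + 1) (k + j))"
    unfolding double_series_def Let_def Hs_def h_def x_def
    by (simp add: ratio_term_def ratio_coeff_def add.assoc)
  also have "\<dots> = double_series ?v x (\<lambda>j i. \<Sum>k. ?u k * Hs (i + 1) (k + j))"
    by (rule double_series_swap_bounded[OF x_summable uv(2)]) (rule bounded_weighted_series(2)[OF uv(1) Hs_le])
  also have "\<dots> = (\<Sum>j. ?v j * double_series x ?u (\<lambda>i k. Hs (i + 1) (k + j)))"
    by (simp only: double_series_def)
  also have "\<dots> = (\<Sum>j. ?v j * double_series ?u x (\<lambda>k i. Hs (i + 1) (k + j)))"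
    by (simp only: double_series_swap_bounded[OF x_summable uv(1) Hs_le])
  also have "\<dots> = double_series ?v ?u (\<lambda>j k. \<Sum>i. x i * Hs (i + 1) (k + j))"
    by (simp only: double_series_def)
  also have "\<dots> = double_series ?u ?v (\<lambda>k j. \<Sum>i. x i * Hs (i + 1) (k + j))"
    by (rule double_series_swap_bounded[OF uv(2,1) bounded_weighted_series(2)[OF x_summable Hs_le]])
  finally have main: "(\<Sum>i. let p = i + 1 in
           a ^ p / qpoch q q p
           * (\<Sum>j. qpoch (-q) q j * d ^ j / qpoch q q j
               * (\<Sum>k. qpoch (-q) q k * c ^ k / qpoch q q k
                   * (\<Sum>m. a ^ m
                            / (qpoch (q ^ (p + 1)) q m
                               * qpoch (-(q ^ (p + k + j))) q (m + 1))
                            * (1 + c * d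
                                   * (((1 + q ^ (p + k + j)) * (1 + q ^ (p + k + j + 1)))
                                      / ((1 + q ^ (p + k + j + m + 1))
                                         * (1 + q ^ (p + k + j + m + 2)))))))))
      = double_series ?u ?v (\<lambda>k j. \<Sum>i. x i * Hs (i + 1) (k + j))" .
  have "dominated 1 (\<lambda>k j. \<Sum>i. x i * Hs (i + 1) (k + j))"
    using bounded_weighted_series(2)[OF x_summable Hs_le]
    by (intro dominatedI[where C = "(\<Sum>n. norm (x n)) * BH"]) simp
  hence "double_series ?u ?v (\<lambda>k j. 2 * (\<Sum>i. x i * Hs (i + 1) (k + j)))
      = 2 * double_series ?u ?v (\<lambda>k j. \<Sum>i. x i * Hs (i + 1) (k + j))"
    by (intro double_series_cmult[where \<rho> = 1]) (use uv in simp_all)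
  hence "2 * double_series ?u ?v (\<lambda>k j. \<Sum>i. x i * Hs (i + 1) (k + j)) = double_series ?u ?v (\<lambda>k A. Q (k + A))"
    unfolding x_sum by (rule sym)
  thus ?thesis unfolding a_def[symmetric] main Q_def by (simp add: mult_ac)
qed

section \<open>The main identity\<close>

text \<open>
  With \<open>Y(s)\<close> for the Euler series, the coefficients of the second and third part add up to
  \<open>S\<^sub>t Y(t) + cd (S\<^sub>t\<^sub>+\<^sub>2 - 3) Y(t + 2)\<close> with \<open>t = k + A\<close>; the first part removes the \<open>3\<close>, and the fourth
  cancels the \<open>S\<^sub>t\<close> and \<open>S\<^sub>t\<^sub>+\<^sub>2\<close>, which leaves the inner sum of \<open>kernel_value\<close>.
\<close>
lemma Lambda_eq_kernel_value:
  "Lambda_cdq c d q = 1 - qpoch_inf c q * qpoch_inf d q * kernel_value q c d"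
proof -
  define a where "a = -(c * d)"
  have a: "norm a < 1" using norm_neg_cd_less_1 by (simp add: a_def)
  let ?S = "qpoch_partial_sum q" and ?u = "ratio_term q c" and ?v = "ratio_term q d"
  define Y where "Y = euler_series a q"
  obtain B where B: "\<And>s. norm (Y s) \<le> B" unfolding Y_def using euler_series_bounded[OF q a] by blast
  obtain \<rho> where \<rho>: "\<rho> > 1" and r: "norm c * \<rho> < 1" "norm d * \<rho> < 1" "norm (c * d) * \<rho> < 1"
    using exists_common_radius[OF c d] .
  have su: "summable (\<lambda>k. norm (?u k) * \<rho> ^ k)" and sv: "summable (\<lambda>k. norm (?v k) * \<rho> ^ k)"
    using summable_ratio_term[OF q] \<rho> r by auto
  define f1 where "f1 k A = Y (k + A + 2)" for k A
  define f2 where "f2 k A = ?S k * Y (k + A) + c * d * (?S (k + 2) - 3) * Y (k + A + 2)" for k A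
  define f3 where "f3 k A = (?S (k + A) - ?S k) * Y (k + A) + c * d * (?S (k + A + 2) - ?S (k + 2)) * Y (k + A + 2)" for k A
  define Q where "Q t = (\<Sum>M. a ^ M / qpoch q q M * ((?S (t + M) - ?S t) / qpoch (-q) q (t + M)
            + c * d * (?S (t + M + 2) - ?S (t + 2)) / qpoch (-q) q (t + M + 2)))" for t
  define J where "J t = (\<Sum>M. a ^ M / qpoch q q M * (sigma_seq q (t + M) + c * d * sigma_seq q (t + M + 2)))" for t
  have Y_sums: "(\<lambda>M. a ^ M / qpoch q q M / qpoch (-q) q (t + M)) sums Y t" for t
    unfolding Y_def by (rule euler_series_sums[OF q a])
  obtain C where C: "\<And>x N. norm x \<le> 1 \<Longrightarrow> norm (sigma_seq q N + x * sigma_seq q (N + 2)) \<le> C * \<rho> ^ N"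
    using sigma_seq_combination_bound[OF q \<rho>] by metis
  have s_le: "norm (sigma_seq q (t + M) + c * d * sigma_seq q (t + M + 2)) \<le> C * (\<rho> ^ t * \<rho> ^ M)" for t M
    using C[of "c * d" "t + M"] norm_mult_lt_1[OF c d] by (simp add: power_add)
  have ws: "summable (\<lambda>M. norm (a ^ M / qpoch q q M) * \<rho> ^ M)"
    using weighted_summable_euler_fps[OF q, of \<rho> a] \<rho> r(3) by (simp add: weighted_summable_def euler_fps_def a_def)
  have J_sums: "(\<lambda>M. a ^ M / qpoch q q M * (sigma_seq q (t + M) + c * d * sigma_seq q (t + M + 2))) sums J t" for t
    unfolding J_def by (rule summable_sums[OF double_series_row_summable[OF ws s_le]])
  have Q_J: "Q t = J t - (?S t * Y t + c * d * ?S (t + 2) * Y (t + 2))" for t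
  proof -
    have "(\<lambda>M. a ^ M / qpoch q q M * (sigma_seq q (t + M) + c * d * sigma_seq q (t + M + 2))
        - (?S t * (a ^ M / qpoch q q M / qpoch (-q) q (t + M))
           + c * d * ?S (t + 2) * (a ^ M / qpoch q q M / qpoch (-q) q (t + 2 + M))))
      sums (J t - (?S t * Y t + c * d * ?S (t + 2) * Y (t + 2)))"
      by (intro sums_diff sums_add sums_mult J_sums Y_sums)
    moreover have "a ^ M / qpoch q q M * (sigma_seq q (t + M) + c * d * sigma_seq q (t + M + 2))
        - (?S t * (a ^ M / qpoch q q M / qpoch (-q) q (t + M))
           + c * d * ?S (t + 2) * (a ^ M / qpoch q q M / qpoch (-q) q (t + 2 + M)))
      = a ^ M / qpoch q q M * ((?S (t + M) - ?S t) / qpoch (-q) q (t + M)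
            + c * d * (?S (t + M + 2) - ?S (t + 2)) / qpoch (-q) q (t + M + 2))" for M
    proof -
      have "t + 2 + M = t + M + 2" by simp
      thus ?thesis
        by (simp only: sigma_seq_def diff_divide_distrib right_diff_distrib distrib_left left_diff_distrib)
          (simp add: mult_ac)
    qed
    ultimately show ?thesis unfolding Q_def by (simp only: sums_iff)
  qed
  have dJ: "dominated \<rho> (\<lambda>k A. J (k + A))"
  proof (rule dominatedI)
    fix k A
    have "norm (J (k + A)) \<le> \<rho> ^ (k + A) * (\<Sum>M. C * (norm (a ^ M / qpoch q q M) * \<rho> ^ M))"
      unfolding J_def
    proof (rule norm_suminf_row_le[OF summable_mult[OF ws]])
      fix t M
      show "norm (a ^ M / qpoch q q M * (sigma_seq q (t + M) + c * d * sigma_seq q (t + M + 2)))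
        \<le> \<rho> ^ t * (C * (norm (a ^ M / qpoch q q M) * \<rho> ^ M))"
        using mult_left_mono[OF s_le[of t M] norm_ge_zero[of "a ^ M / qpoch q q M"]]
        by (simp only: norm_mult mult_ac)
    qed
    thus "norm (J (k + A)) \<le> (\<Sum>M. C * (norm (a ^ M / qpoch q q M) * \<rho> ^ M)) * (\<rho> ^ k * \<rho> ^ A)"
      by (simp only: power_add mult_ac)
  qed
  have \<rho>1: "\<rho> \<ge> 1" using \<rho> by simp
  note S_dom = dominated_partial_sum(1)[OF q \<rho>, of 0, simplified] dominated_partial_sum(2)[OF q \<rho>, of 0, simplified]
    dominated_partial_sum[OF q \<rho>, of 2]
  have YS: "dominated \<rho> (\<lambda>k A. g k A * Y (h k A))" if "dominated \<rho> g" for g h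
    using dominated_bounded_mult[of "\<lambda>k A. Y (h k A)" B, OF B that] by (simp only: mult.commute)
  have d1: "dominated \<rho> f1" unfolding f1_def
    using YS[OF dominated_const[OF \<rho>1, of 1], of "\<lambda>k A. k + A + 2"] by simp
  have d2: "dominated \<rho> f2" unfolding f2_def
    by (intro dominated_add YS dominated_cmult dominated_diff S_dom dominated_const[OF \<rho>1])
  have d3: "dominated \<rho> f3" unfolding f3_def
    by (intro dominated_add YS dominated_cmult dominated_diff S_dom dominated_const[OF \<rho>1])
  have d4: "dominated \<rho> (\<lambda>k A. Q (k + A))" unfolding Q_J
    by (intro dominated_diff dominated_add dJ YS dominated_cmult S_dom)
  have "3 * c * d * double_series ?u ?v f1 + double_series ?u ?v f2 + double_series ?u ?v f3 + double_series ?u ?v (\<lambda>k A. Q (k + A))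
     = double_series ?u ?v (\<lambda>k A. 3 * c * d * f1 k A + f2 k A + f3 k A + Q (k + A))"
    by (simp only: double_series_cmult[OF su sv d1] double_series_add[OF su sv dominated_cmult[OF d1] d2]
        double_series_add[OF su sv dominated_add[OF dominated_cmult[OF d1] d2] d3]
        double_series_add[OF su sv dominated_add[OF dominated_add[OF dominated_cmult[OF d1] d2] d3] d4])
  also have "(\<lambda>k A. 3 * c * d * f1 k A + f2 k A + f3 k A + Q (k + A)) = (\<lambda>k A. J (k + A))"
    by (intro ext) (simp add: f1_def f2_def f3_def Q_J algebra_simps)
  also have "double_series ?u ?v (\<lambda>k A. J (k + A)) = kernel_value q c d"
    unfolding kernel_value_commute[of q c d] kernel_value_eq_iterated_sum[OF q d c]
    by (simp add: double_series_def ratio_term_def J_def a_def mult.commute[of d c])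
  finally have sum: "3 * c * d * double_series ?u ?v f1 + double_series ?u ?v f2 + double_series ?u ?v f3
     + double_series ?u ?v (\<lambda>k A. Q (k + A)) = kernel_value q c d" .
  show ?thesis
    unfolding Lambda_cdq_def Lambda_first_series Lambda_second_series
      Lambda_third_series Lambda_fourth_series sum[symmetric]
      f1_def[abs_def] f2_def[abs_def] f3_def[abs_def] Q_def Y_def a_def
    by (simp only: distrib_left diff_diff_add add.assoc)
qed

end

theorem theorem1p2:
  fixes q c d :: complex
  assumes "norm q < 1" and "norm c < 1" and "norm d < 1"
  shows "ramanujan_sigma q =
           (qpoch_inf (-c) q * qpoch_inf (-d) q) / qpoch_inf (-(c * d)) q
           * (\<Sum>n. (qpoch (-(c * d)) q n * (1 - c * d * q ^ (2 * n)) * q ^ (n * (n + 1) div 2))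
                    / (qpoch (-q) q n * (1 - c * q ^ n) * (1 - d * q ^ n)))
           + Lambda_cdq c d q"
proof -
  have "qpoch_inf c q * qpoch_inf d q * sigma_normalised q c d
      = (qpoch_inf (-c) q * qpoch_inf (-d) q) / qpoch_inf (-(c * d)) q * sigma_deform q c d"
    using qpoch_inf_factors_nonzero(1,2)[OF assms] by (simp add: sigma_normalised_def)
  with sigma_normalised_minus_kernel_value[OF assms]
  have "(qpoch_inf (-c) q * qpoch_inf (-d) q) / qpoch_inf (-(c * d)) q * sigma_deform q c d
      - qpoch_inf c q * qpoch_inf d q * kernel_value q c d = ramanujan_sigma q - 1"
    by (simp only: right_diff_distrib)
  hence "ramanujan_sigma q = (qpoch_inf (-c) q * qpoch_inf (-d) q) / qpoch_inf (-(c * d)) q * sigma_deform q c d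
      + Lambda_cdq c d q"
    unfolding Lambda_eq_kernel_value[OF assms] by (simp add: diff_eq_eq)
  thus ?thesis by (simp only: sigma_deform_def sigma_deform_term_def)
qed

end
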